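(* Let $H\in(\frac12,1)$, let $A\in\mathbb{R}^{d\times d}$ and $f:\mathbb{R}^d\to\mathbb{R}^d$, and let $h_A,c_f>0$ be constants such that $$\langle x,Ax\rangle\le -h_A\|x\|^2,\qquad \|f(x)-f(y)\|\le c_f\|x-y\|\qquad\text{for all }x,y\in\mathbb{R}^d .$$ Assume that $h_A>c_f$. Then there exists $\epsilon>0$ such that for every $C\in\mathbb{R}^{d\times d}$ with $\|C\|<\epsilon$, the random dynamical system $\varphi$ generated by $$dx(t)=[Ax(t)+f(x(t))]\,dt+Cx(t)\,dB^H(t),\qquad x(0)=x_0\in\mathbb{R}^d,$$ where $B^H$ is a one-dimensional fractional Brownian motion with Hurst index $H$, possesses a random pullback attractor consisting of only one random point $a(\omega)$ in the universe $\mathcal{D}$ of tempered random sets. Moreover, every tempered random set converges to the random attractor in the pullback sense with exponential rate.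
   Context: Notation: $\|\cdot\|$ is the Euclidean norm (and the induced operator norm on matrices). Fractional Brownian motion $B^H=\{B^H(t)\}_{t\in\mathbb{R}}$ is the centered Gaussian process with continuous paths and covariance $R_H(s,t)=\frac12(|t|^{2H}+|s|^{2H}-|t-s|^{2H})$. It is realized canonically: $\Omega=C_0(\mathbb{R},\mathbb{R})$ is the space of continuous functions on $\mathbb{R}$ vanishing at $0$ with Borel $\sigma$-algebra $\mathcal{F}$, $B^H(t,\omega)=\omega(t)$, $\mathbb{P}^H$ is the law of $B^H$, and $\theta_t\omega(\cdot)=\omega(t+\cdot)-\omega(t)$ is the Wiener shift; $\mathbb{P}^H$ is $\theta$-invariant and $\theta$ is ergodic. Fix $\frac12<\nu<H$; almost all $\omega$ are $\nu$-Hölder continuous on every compact interval, and $\Omega$ is restricted to (a $\theta$-invariant set of full measure of) such paths. Statements about $\omega$ hold for almost all $\omega$. For such $\omega$ the equation is solved pathwise, $x(t)=x_0+\int_0^t[Ax(s)+f(x(s))]ds+\int_0^tCx(s)\,d\omega(s)$, the last integral being a Young integral (limit of Riemann–Stieltjes sums with left endpoints as the mesh tends to $0$); it has a unique solution $x(t,\omega,x_0)$ and $\varphi(t,\omega)x_0:=x(t,\omega,x_0)$ defines a continuous random dynamical system over $\theta$, i.e. $\varphi$ is measurable, continuous in $(t,x_0)$, and $\varphi(t+s,\omega)=\varphi(t,\theta_s\omega)\circ\varphi(s,\omega)$. For nonempty $E,F\subset\mathbb{R}^d$, $d(E|F)=\sup_{x\in E}\inf_{y\in F}\|x-y\|$ and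 $d(x|F)=d(\{x\}|F)$. A random set is a family $\hat M=\{M(\omega)\}_{\omega\in\Omega}$ of nonempty subsets such that $\omega\mapsto d(x|M(\omega))$ is $\mathcal{F}$-measurable for each $x\in\mathbb{R}^d$. A random variable $\rho(\omega)>0$ is tempered if $\lim_{t\to\pm\infty}\frac1t\log\rho(\theta_t\omega)=0$. The universe $\mathcal{D}$ of tempered random sets consists of all random sets $\hat D$ for which $D(\omega)\subset B(0,\rho(\omega))$ for all $\omega$, for some tempered random variable $\rho$. An invariant (i.e. $\varphi(t,\omega)\mathcal{A}(\omega)=\mathcal{A}(\theta_t\omega)$ for $t\ge0$) random compact set $\mathcal{A}\in\mathcal{D}$ is a pullback random attractor in $\mathcal{D}$ if for every closed random set $\hat D\in\mathcal{D}$, $\lim_{t\to\infty}d\big(\varphi(t,\theta_{-t}\omega)D(\theta_{-t}\omega)\,|\,\mathcal{A}(\omega)\big)=0$. Convergence of $\hat D\in\mathcal{D}$ to $\mathcal{A}$ in the pullback sense with exponential rate means $\varlimsup_{t\to\infty}\frac1t\log d\big(\varphi(t,\theta_{-t}\omega)D(\theta_{-t}\omega)\,|\,\mathcal{A}(\omega)\big)<0$. *)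

theory Defs
  imports "HOL-Probability.Probability"
begin

definition C0_paths :: "(real \<Rightarrow> real) set" where
  "C0_paths = {\<omega>. continuous_on UNIV \<omega> \<and> \<omega> 0 = 0}"

text \<open>The compact-open topology, i.e. locally uniform convergence.
  The choice of the empty compact set puts all of \<open>C0_paths\<close> into the subbase.\<close>

definition C0_topology :: "(real \<Rightarrow> real) topology" where
  "C0_topology = topology_generated_by
     {{\<omega> \<in> C0_paths. \<omega> ` K \<subseteq> U} | K U. compact K \<and> open U}"

definition borel_C0 :: "(real \<Rightarrow> real) measure" where
  "borel_C0 = sigma C0_paths {U. openin C0_topology U}"

definition wiener_shift :: "real \<Rightarrow> (real \<Rightarrow> real) \<Rightarrow> real \<Rightarrow> real" where
  "wiener_shift t \<omega> = (\<lambda>s. \<omega> (t + s) - \<omega> t)"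

definition fbm_cov :: "real \<Rightarrow> real \<Rightarrow> real \<Rightarrow> real" where
  "fbm_cov H s t = (\<bar>t\<bar> powr (2 * H) + \<bar>s\<bar> powr (2 * H) - \<bar>t - s\<bar> powr (2 * H)) / 2"

text \<open>Univariate normal laws, with the degenerate ones (point masses) included.\<close>

definition gaussian_law :: "real measure \<Rightarrow> bool" where
  "gaussian_law N \<longleftrightarrow>
     (\<exists>\<mu>. N = return borel \<mu>) \<or>
     (\<exists>\<mu> \<sigma>. \<sigma> > 0 \<and> N = density lborel (\<lambda>x. ennreal (normal_density \<mu> \<sigma> x)))"

text \<open>A process is Gaussian if all finite linear combinations of its values are.
  Mean and covariance are Bochner integrals, which exist by Gaussianity.\<close>

definition fbm_law :: "real \<Rightarrow> (real \<Rightarrow> real) measure \<Rightarrow> bool" where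
  "fbm_law H P \<longleftrightarrow>
     prob_space P \<and> sets P = sets borel_C0 \<and>
     (\<forall>T c. finite T \<longrightarrow> gaussian_law (distr P borel (\<lambda>\<omega>. \<Sum>t\<in>T. c t * \<omega> t))) \<and>
     (\<forall>t. (\<integral>\<omega>. \<omega> t \<partial>P) = 0) \<and>
     (\<forall>s t. (\<integral>\<omega>. \<omega> s * \<omega> t \<partial>P) = fbm_cov H s t)"

definition locally_Hoelder :: "real \<Rightarrow> (real \<Rightarrow> real) \<Rightarrow> bool" where
  "locally_Hoelder \<nu> \<omega> \<longleftrightarrow>
     (\<forall>a b. \<exists>K. \<forall>s\<in>{a..b}. \<forall>t\<in>{a..b}. \<bar>\<omega> s - \<omega> t\<bar> \<le> K * \<bar>s - t\<bar> powr \<nu>)"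

definition admissible_paths ::
    "real \<Rightarrow> (real \<Rightarrow> real) measure \<Rightarrow> (real \<Rightarrow> real) set \<Rightarrow> bool" where
  "admissible_paths \<nu> P \<Omega> \<longleftrightarrow>
     \<Omega> \<in> sets P \<and> (AE \<omega> in P. \<omega> \<in> \<Omega>) \<and>
     (\<forall>\<omega>\<in>\<Omega>. locally_Hoelder \<nu> \<omega>) \<and>
     (\<forall>t. \<forall>\<omega>\<in>\<Omega>. wiener_shift t \<omega> \<in> \<Omega>)"

definition has_young_integral ::
    "(real \<Rightarrow> 'a::real_normed_vector) \<Rightarrow> (real \<Rightarrow> real) \<Rightarrow> real \<Rightarrow> real \<Rightarrow> 'a \<Rightarrow> bool" where
  "has_young_integral y \<omega> a b J \<longleftrightarrow>
     (\<forall>e>0. \<exists>\<delta>>0. \<forall>n::nat. \<forall>p::nat \<Rightarrow> real.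
        p 0 = a \<and> p n = b \<and> (\<forall>i<n. p i \<le> p (Suc i) \<and> p (Suc i) - p i < \<delta>) \<longrightarrow>
        norm ((\<Sum>i<n. (\<omega> (p (Suc i)) - \<omega> (p i)) *\<^sub>R y (p i)) - J) < e)"

definition young_solution ::
    "real^'n^'n \<Rightarrow> (real^'n \<Rightarrow> real^'n) \<Rightarrow> real^'n^'n \<Rightarrow> (real \<Rightarrow> real) \<Rightarrow> real^'n
      \<Rightarrow> (real \<Rightarrow> real^'n) \<Rightarrow> bool" where
  "young_solution A f C \<omega> x0 x \<longleftrightarrow>
     continuous_on {0..} x \<and>
     (\<forall>t\<ge>0. \<exists>J. has_young_integral (\<lambda>s. C *v x s) \<omega> 0 t J \<and>
        x t = x0 + integral {0..t} (\<lambda>s. A *v x s + f (x s)) + J)"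

text \<open>\<open>\<phi> t \<omega> x\<close> is only meaningful for \<open>t \<ge> 0\<close> and \<open>\<omega> \<in> space M\<close>.\<close>

definition continuous_rds ::
    "(real \<Rightarrow> 'w \<Rightarrow> 'w) \<Rightarrow> 'w measure \<Rightarrow> (real \<Rightarrow> 'w \<Rightarrow> 'a \<Rightarrow> 'a::euclidean_space) \<Rightarrow> bool" where
  "continuous_rds \<theta> M \<phi> \<longleftrightarrow>
     (\<lambda>(t, \<omega>, x). \<phi> t \<omega> x) \<in> borel_measurable (restrict_space borel {0..} \<Otimes>\<^sub>M M \<Otimes>\<^sub>M borel) \<and>
     (\<forall>\<omega>\<in>space M. continuous_on ({0..} \<times> UNIV) (\<lambda>(t, x). \<phi> t \<omega> x)) \<and>
     (\<forall>\<omega>\<in>space M. \<forall>s\<ge>0. \<forall>t\<ge>0. \<phi> (t + s) \<omega> = \<phi> t (\<theta> s \<omega>) \<circ> \<phi> s \<omega>)"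

definition young_rds ::
    "real^'n^'n \<Rightarrow> (real^'n \<Rightarrow> real^'n) \<Rightarrow> real^'n^'n \<Rightarrow> (real \<Rightarrow> real) measure
      \<Rightarrow> (real \<Rightarrow> (real \<Rightarrow> real) \<Rightarrow> real^'n \<Rightarrow> real^'n) \<Rightarrow> bool" where
  "young_rds A f C M \<phi> \<longleftrightarrow>
     continuous_rds wiener_shift M \<phi> \<and>
     (\<forall>\<omega>\<in>space M. \<forall>x0. young_solution A f C \<omega> x0 (\<lambda>t. \<phi> t \<omega> x0))"

text \<open>The semidistance \<open>d(E|F)\<close> of nonempty sets; it is infinite if the supremum is.\<close>

definition semidist :: "'a::euclidean_space set \<Rightarrow> 'a set \<Rightarrow> ereal" where
  "semidist E F = (SUP x\<in>E. ereal (infdist x F))"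

text \<open>The logarithm with \<open>log 0 = -\<infinity>\<close> and \<open>log \<infinity> = \<infinity>\<close>, in contrast to
  the convention \<open>ln 0 = 0\<close> on the reals.\<close>

definition ereal_ln :: "ereal \<Rightarrow> ereal" where
  "ereal_ln r = (if r \<le> 0 then -\<infinity> else if r = \<infinity> then \<infinity> else ereal (ln (real_of_ereal r)))"

definition random_set :: "'w measure \<Rightarrow> ('w \<Rightarrow> 'a::euclidean_space set) \<Rightarrow> bool" where
  "random_set M D \<longleftrightarrow>
     (\<forall>\<omega>\<in>space M. D \<omega> \<noteq> {}) \<and>
     (\<forall>x. (\<lambda>\<omega>. infdist x (D \<omega>)) \<in> borel_measurable M)"

definition tempered_variable ::
    "(real \<Rightarrow> 'w \<Rightarrow> 'w) \<Rightarrow> 'w measure \<Rightarrow> ('w \<Rightarrow> real) \<Rightarrow> bool" where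
  "tempered_variable \<theta> M \<rho> \<longleftrightarrow>
     \<rho> \<in> borel_measurable M \<and> (\<forall>\<omega>\<in>space M. \<rho> \<omega> > 0) \<and>
     (AE \<omega> in M. ((\<lambda>t. 1 / t * ln (\<rho> (\<theta> t \<omega>))) \<longlongrightarrow> 0) at_top \<and>
                 ((\<lambda>t. 1 / t * ln (\<rho> (\<theta> t \<omega>))) \<longlongrightarrow> 0) at_bot)"

definition tempered_sets ::
    "(real \<Rightarrow> 'w \<Rightarrow> 'w) \<Rightarrow> 'w measure \<Rightarrow> ('w \<Rightarrow> 'a::euclidean_space set) set" where
  "tempered_sets \<theta> M =
     {D. random_set M D \<and>
         (\<exists>\<rho>. tempered_variable \<theta> M \<rho> \<and> (\<forall>\<omega>\<in>space M. D \<omega> \<subseteq> ball 0 (\<rho> \<omega>)))}"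

definition pullback_attractor ::
    "(real \<Rightarrow> 'w \<Rightarrow> 'w) \<Rightarrow> 'w measure \<Rightarrow> (real \<Rightarrow> 'w \<Rightarrow> 'a \<Rightarrow> 'a::euclidean_space)
      \<Rightarrow> ('w \<Rightarrow> 'a set) \<Rightarrow> bool" where
  "pullback_attractor \<theta> M \<phi> \<A> \<longleftrightarrow>
     \<A> \<in> tempered_sets \<theta> M \<and>
     (\<forall>\<omega>\<in>space M. compact (\<A> \<omega>)) \<and>
     (AE \<omega> in M. \<forall>t\<ge>0. \<phi> t \<omega> ` \<A> \<omega> = \<A> (\<theta> t \<omega>)) \<and>
     (\<forall>D\<in>tempered_sets \<theta> M. (\<forall>\<omega>\<in>space M. closed (D \<omega>)) \<longrightarrow>
        (AE \<omega> in M. ((\<lambda>t. semidist (\<phi> t (\<theta> (- t) \<omega>) ` D (\<theta> (- t) \<omega>)) (\<A> \<omega>)) \<longlongrightarrow> 0) at_top))"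

definition exponential_pullback_convergence ::
    "(real \<Rightarrow> 'w \<Rightarrow> 'w) \<Rightarrow> 'w measure \<Rightarrow> (real \<Rightarrow> 'w \<Rightarrow> 'a \<Rightarrow> 'a::euclidean_space)
      \<Rightarrow> ('w \<Rightarrow> 'a set) \<Rightarrow> ('w \<Rightarrow> 'a set) \<Rightarrow> bool" where
  "exponential_pullback_convergence \<theta> M \<phi> D \<A> \<longleftrightarrow>
     (AE \<omega> in M. Limsup at_top (\<lambda>t. ereal (1 / t) *
        ereal_ln (semidist (\<phi> t (\<theta> (- t) \<omega>) ` D (\<theta> (- t) \<omega>)) (\<A> \<omega>))) < 0)"

end

theory Submission
  imports Defs "HOL-Real_Asymp.Real_Asymp"
begin

text \<open>As the noise is one-dimensional, \<open>u(t) = exp (- \<omega>(t) C) x(t)\<close> solves an ordinary differential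
  equation. While \<open>\<bar>\<omega>\<bar> \<le> 1\<close>, its drift is dissipative with a rate close to \<open>hA - cf\<close> when \<open>C\<close>
  is small, and returning to \<open>x\<close> costs a factor \<open>exp \<parallel>C\<parallel>\<close>. Hence, if an interval of length \<open>T\<close> can be
  cut into \<open>N\<close> pieces on which \<open>\<omega>\<close> oscillates by at most 1, two solutions approach each other by a factor
  \<open>exp (\<parallel>C\<parallel> N - \<kappa> T)\<close> on it. It remains to see that almost surely \<open>N \<le> \<mu> T\<close> up to a sublinear error, with
  a deterministic \<open>\<mu>\<close>; then contraction wins for small \<open>C\<close>, the values at time \<open>0\<close> of the solutions started
  from \<open>0\<close> at time \<open>- n\<close> converge to the attracting point, and this point is tempered.

  For the bound on \<open>N\<close>, a bisection argument controls the number of pieces of a unit interval by a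
  dyadic Sobolev seminorm, which is a quadratic functional of the Gaussian process. Its time averages
  converge almost surely by a second moment computation, which replaces the ergodic theorem.\<close>

text \<open>\<open>young_solution\<close> demands only that the Riemann sums converge, so no Hoelder
  regularity of the solution is at hand and the Young-Loeve inequality does not apply; a Henstock
  lemma, extracted from the convergence itself, takes its place.

  The cost of returning from \<open>u\<close> to \<open>x\<close> enters the exponent once per
  piece, so a law of large numbers for the number of pieces is what decides. The dyadic seminorm is
  suited to this for two reasons. It is a series of squares of Gaussian variables, hence accessible
  through fourth moments. And passing to the two halves of an interval it loses a fixed factor, so
  that counting by bisection gives a bound that is linear in it. Its weight \<open>\<gamma>\<close>
  has to be positive for the loss and below \<open>2 * \<nu> - 1\<close> for finiteness; here
  \<open>\<nu> > 1/2\<close> enters a second time, after the vanishing of the quadratic variation in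
  the transform.

  The fluctuation of the time averages is sublinear because its second moment over time
  \<open>n\<close> grows like \<open>n powr (2 * H)\<close> with \<open>H < 1\<close>. All errors
  are kept in the form of a small multiple of \<open>\<bar>s\<bar> + \<bar>t\<bar>\<close> plus a
  random constant, from which temperedness results.\<close>

section \<open>Exponentials of operators\<close>

text \<open>\<open>exp\<close> lives on Banach algebras with unit. This copy of the bounded
  operators takes composition as multiplication, so that \<open>exp\<close> becomes the operator
  exponential. A Euclidean space has positive dimension, hence its identity has norm 1, as the class
  demands.\<close>

typedef (overloaded) ('a::euclidean_space) endo = "UNIV :: ('a \<Rightarrow>\<^sub>L 'a) set"
  by simp

setup_lifting type_definition_endo

instantiation endo :: (euclidean_space) real_normed_algebra_1
begin
lift_definition zero_endo :: "'a endo" is 0 .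
lift_definition one_endo :: "'a endo" is id_blinfun .
lift_definition plus_endo :: "'a endo \<Rightarrow> 'a endo \<Rightarrow> 'a endo" is "(+)" .
lift_definition minus_endo :: "'a endo \<Rightarrow> 'a endo \<Rightarrow> 'a endo" is "(-)" .
lift_definition uminus_endo :: "'a endo \<Rightarrow> 'a endo" is "uminus" .
lift_definition times_endo :: "'a endo \<Rightarrow> 'a endo \<Rightarrow> 'a endo" is "(o\<^sub>L)" .
lift_definition scaleR_endo :: "real \<Rightarrow> 'a endo \<Rightarrow> 'a endo" is "scaleR" .
lift_definition norm_endo :: "'a endo \<Rightarrow> real" is norm .
definition "sgn_endo (x::'a endo) = scaleR (inverse (norm x)) x"
definition "dist_endo (x::'a endo) y = norm (x - y)"
definition "uniformity_endo = (INF e\<in>{0 <..}. principal {(x::'a endo, y). dist x y < e})"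
definition "open_endo (U::'a endo set) = (\<forall>x\<in>U. eventually (\<lambda>(x', y). x' = x \<longrightarrow> y \<in> U) uniformity)"
instance
  apply standard
  subgoal by transfer simp
  subgoal by transfer simp
  subgoal by transfer simp
  subgoal by transfer simp
  subgoal by transfer simp
  subgoal by transfer (simp add: scaleR_add_right)
  subgoal by transfer (simp add: scaleR_add_left)
  subgoal by transfer simp
  subgoal by transfer simp
  subgoal by transfer (rule blinfun_eqI; simp)
  subgoal by transfer (rule blinfun_eqI; simp add: blinfun.bilinear_simps)
  subgoal by transfer (rule blinfun_eqI; simp add: blinfun.bilinear_simps)
  subgoal by transfer (rule blinfun_eqI; simp add: blinfun.bilinear_simps)
  subgoal by transfer (rule blinfun_eqI; simp add: blinfun.bilinear_simps)
  subgoal by transfer (rule blinfun_eqI; simp)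
  subgoal by transfer (rule blinfun_eqI; simp)
  subgoal by transfer (metis norm_blinfun_id norm_zero zero_neq_one)
  subgoal by (rule dist_endo_def)
  subgoal by (rule sgn_endo_def)
  subgoal by (rule uniformity_endo_def)
  subgoal by (rule open_endo_def)
  subgoal by transfer simp
  subgoal by transfer (rule norm_triangle_ineq)
  subgoal by transfer simp
  subgoal by transfer (rule norm_blinfun_compose)
  subgoal by transfer simp
  done
end

instance endo :: (euclidean_space) banach
proof
  fix X :: "nat \<Rightarrow> 'a endo" assume "Cauchy X"
  then have "Cauchy (\<lambda>n. Rep_endo (X n))"
    unfolding Cauchy_def dist_norm by (simp add: minus_endo.rep_eq norm_endo.rep_eq)
  then obtain L where "(\<lambda>n. Rep_endo (X n)) \<longlonglongrightarrow> L"
    using Cauchy_convergent convergent_def by blast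
  then have "X \<longlonglongrightarrow> Abs_endo L"
    unfolding tendsto_iff dist_norm
    by (simp add: minus_endo.rep_eq norm_endo.rep_eq Abs_endo_inverse)
  then show "convergent X" by (auto simp: convergent_def)
qed

definition endo_apply :: "'a endo \<Rightarrow> 'a \<Rightarrow> 'a::euclidean_space" (infixr "\<bullet>\<^sub>E" 75)
  where "endo_apply T x = blinfun_apply (Rep_endo T) x"

lemma endo_apply_simps:
  "(S * T) \<bullet>\<^sub>E x = S \<bullet>\<^sub>E T \<bullet>\<^sub>E x" "1 \<bullet>\<^sub>E x = x"
  by (simp_all add: endo_apply_def times_endo.rep_eq one_endo.rep_eq)

interpretation endo_apply: bounded_bilinear "endo_apply"
proof (rule bounded_bilinear.intro)
  show "\<exists>K. \<forall>a b. norm (a \<bullet>\<^sub>E b) \<le> norm a * norm b * K"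
    by (rule exI[of _ 1]) (simp add: endo_apply_def norm_endo.rep_eq norm_blinfun)
qed (simp_all add: endo_apply_def plus_endo.rep_eq scaleR_endo.rep_eq blinfun.bilinear_simps)

lemma norm_endo_apply: "norm (T \<bullet>\<^sub>E x) \<le> norm T * norm x"
  by (simp add: endo_apply_def norm_endo.rep_eq norm_blinfun)

definition endo_of_matrix :: "real^'n^'n \<Rightarrow> (real^'n) endo"
  where "endo_of_matrix M = Abs_endo (Blinfun ((*v) M))"

lemma endo_of_matrix_apply: "endo_of_matrix M \<bullet>\<^sub>E x = M *v x"
  unfolding endo_of_matrix_def endo_apply_def
  by (simp add: Abs_endo_inverse bounded_linear_Blinfun_apply)

lemma norm_endo_of_matrix: "norm (endo_of_matrix M) = onorm ((*v) M)"
  unfolding endo_of_matrix_def norm_endo.rep_eq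
  by (simp add: Abs_endo_inverse norm_blinfun.rep_eq bounded_linear_Blinfun_apply)

text \<open>Term by term comparison of the two exponential series without their constant
  terms.\<close>

lemma norm_exp_diff_one: "norm (exp x - 1) \<le> exp (norm x) - (1::real)"
  for x :: "'a::{banach,real_normed_algebra_1}"
proof -
  have sn: "summable (\<lambda>n. norm x ^ Suc n /\<^sub>R fact (Suc n))"
    by (rule summable_Suc_iff[THEN iffD2, OF summable_exp_generic])
  have e: "exp y - 1 = (\<Sum>n. y ^ Suc n /\<^sub>R fact (Suc n))" for y :: "'b::{banach,real_normed_algebra_1}"
    unfolding exp_def using suminf_split_head[OF summable_exp_generic[of y]] by simp
  show ?thesis unfolding e
    by (rule norm_suminf_le[OF _ sn]) (auto simp: divide_inverse intro!: mult_left_mono norm_power_ineq order_trans[OF norm_mult_ineq])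
qed

text \<open>Bounding \<open>1 / fact (n + 2)\<close> by \<open>1 / fact n\<close> lets the square of
  the norm factor out of the remainder series. The quadratic order matters: applied to an increment
  of \<omega>, the remainder has the size of a term of the quadratic variation.\<close>

lemma norm_exp_second_order: "norm (exp x - 1 - x) \<le> (norm x)\<^sup>2 * exp (norm x)"
  for x :: "'a::{banach,real_normed_algebra_1}"
proof -
  have e: "exp x - 1 - x = (\<Sum>n. x ^ (n+2) /\<^sub>R fact (n+2))"
    unfolding exp_def using suminf_split_initial_segment[OF summable_exp_generic[of x], of 2]
    by (simp add: numeral_2_eq_2)
  have sn: "summable (\<lambda>n. (norm x)\<^sup>2 * (norm x ^ n /\<^sub>R fact n))"
    by (rule summable_mult[OF summable_exp_generic])
  have "norm (exp x - 1 - x) \<le> (\<Sum>n. (norm x)\<^sup>2 * (norm x ^ n /\<^sub>R fact n))"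
    unfolding e
  proof (rule norm_suminf_le[OF _ sn])
    fix n
    have "norm (x ^ (n+2) /\<^sub>R fact (n+2)) \<le> norm x ^ (n+2) / fact (n+2)"
      by (simp add: divide_inverse mult.commute mult_right_mono del: power_Suc power_add fact_Suc add_2_eq_Suc' add_2_eq_Suc add: norm_power_ineq)
    also have "\<dots> \<le> norm x ^ (n+2) / fact n"
      by (intro divide_left_mono fact_mono) auto
    also have "\<dots> = (norm x)\<^sup>2 * (norm x ^ n /\<^sub>R fact n)"
      by (simp add: power2_eq_square divide_inverse)
    finally show "norm (x ^ (n+2) /\<^sub>R fact (n+2)) \<le> (norm x)\<^sup>2 * (norm x ^ n /\<^sub>R fact n)" .
  qed
  also have "\<dots> = (norm x)\<^sup>2 * exp (norm x)"
    unfolding exp_def by (rule suminf_mult[OF summable_exp_generic])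
  finally show ?thesis .
qed

section \<open>Young equations and the Doss-Sussmann transform\<close>

text \<open>An inductive relation, in place of partitions indexed by numbers, lets sums over
  adjacent intervals be concatenated by induction; \<open>nil\<close> is the empty partition of a
  degenerate interval. \<open>riemann_sum_partition\<close> translates back.\<close>

inductive riemann_sum ::
    "(real \<Rightarrow> 'a::real_normed_vector) \<Rightarrow> (real \<Rightarrow> real) \<Rightarrow> real \<Rightarrow> real \<Rightarrow> real \<Rightarrow> 'a \<Rightarrow> bool"
  for y \<omega> \<delta> where
  nil: "riemann_sum y \<omega> \<delta> a a 0"
| snoc: "riemann_sum y \<omega> \<delta> a b \<sigma> \<Longrightarrow> b \<le> c \<Longrightarrow> c - b < \<delta> \<Longrightarrow>
    riemann_sum y \<omega> \<delta> a c (\<sigma> + (\<omega> c - \<omega> b) *\<^sub>R y b)"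

lemma riemann_sum_append:
  assumes "riemann_sum y \<omega> \<delta> b c \<tau>" "riemann_sum y \<omega> \<delta> a b \<sigma>"
  shows "riemann_sum y \<omega> \<delta> a c (\<sigma> + \<tau>)"
  using assms
proof (induction arbitrary: \<sigma> rule: riemann_sum.induct)
  case (nil b)
  then show ?case by simp
next
  case (snoc b c \<tau> d)
  from riemann_sum.snoc[OF snoc.IH[OF snoc.prems] snoc.hyps(2,3)]
  show ?case by (simp add: add.assoc)
qed

lemma riemann_sum_mono:
  assumes "riemann_sum y \<omega> \<delta> a b \<sigma>" "\<delta> \<le> \<delta>'"
  shows "riemann_sum y \<omega> \<delta>' a b \<sigma>"
  using assms by (induction rule: riemann_sum.induct) (auto intro: riemann_sum.intros)

lemma riemann_sum_partition:
  assumes "riemann_sum y \<omega> \<delta> a b \<sigma>"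
  shows "\<exists>(n::nat) p. p 0 = a \<and> p n = b \<and> (\<forall>i<n. p i \<le> p (Suc i) \<and> p (Suc i) - p i < \<delta>) \<and>
     \<sigma> = (\<Sum>i<n. (\<omega> (p (Suc i)) - \<omega> (p i)) *\<^sub>R y (p i))"
  using assms
proof (induction rule: riemann_sum.induct)
  case (nil a)
  then show ?case by (intro exI[of _ 0] exI[of _ "\<lambda>_. a"]) simp
next
  case (snoc a b \<sigma> c)
  then obtain n :: nat and p where p: "p 0 = a" "p n = b"
    "\<forall>i<n. p i \<le> p (Suc i) \<and> p (Suc i) - p i < \<delta>"
    "\<sigma> = (\<Sum>i<n. (\<omega> (p (Suc i)) - \<omega> (p i)) *\<^sub>R y (p i))" by blast
  show ?case
    by (rule exI[of _ "Suc n"], rule exI[of _ "p(Suc n := c)"])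
       (use p snoc.hyps in \<open>auto simp: less_Suc_eq intro!: sum.cong\<close>)
qed

text \<open>A uniform partition with enough points; it ensures that convergence of Riemann sums is
  never a vacuous property.\<close>

lemma riemann_sum_exists:
  assumes "a \<le> b" "\<delta> > 0"
  shows "\<exists>\<sigma>. riemann_sum y \<omega> \<delta> a b \<sigma>"
proof -
  obtain m :: nat where m: "(b - a) / \<delta> < real m" using reals_Archimedean2 by blast
  have mp: "m > 0" using m assms by (cases m) (auto simp: divide_less_0_iff not_less)
  define h where "h = (b - a) / m"
  have h: "0 \<le> h" "h < \<delta>" using assms m mp by (auto simp: h_def field_simps)
  have "\<exists>\<sigma>. riemann_sum y \<omega> \<delta> a (a + real k * h) \<sigma>" for k
  proof (induction k)
    case 0 then show ?case by (auto intro!: exI[of _ 0] riemann_sum.nil)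
  next
    case (Suc k)
    then obtain \<sigma> where "riemann_sum y \<omega> \<delta> a (a + real k * h) \<sigma>" by blast
    from riemann_sum.snoc[OF this, of "a + real (Suc k) * h"] h show ?case
      by (auto simp: algebra_simps)
  qed
  from this[of m] mp show ?thesis by (simp add: h_def)
qed

lemma has_young_integralD:
  assumes "has_young_integral y \<omega> a b J" "e > 0"
  obtains \<delta> where "\<delta> > 0" "\<And>\<sigma>. riemann_sum y \<omega> \<delta> a b \<sigma> \<Longrightarrow> norm (\<sigma> - J) < e"
proof -
  from assms obtain \<delta> where d: "\<delta> > 0" "\<forall>n::nat. \<forall>p::nat \<Rightarrow> real.
        p 0 = a \<and> p n = b \<and> (\<forall>i<n. p i \<le> p (Suc i) \<and> p (Suc i) - p i < \<delta>) \<longrightarrow>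
        norm ((\<Sum>i<n. (\<omega> (p (Suc i)) - \<omega> (p i)) *\<^sub>R y (p i)) - J) < e"
    unfolding has_young_integral_def by blast
  show thesis
  proof (rule that[OF d(1)])
    fix \<sigma> assume "riemann_sum y \<omega> \<delta> a b \<sigma>"
    from riemann_sum_partition[OF this] obtain n :: nat and p where
      "p 0 = a \<and> p n = b \<and> (\<forall>i<n. p i \<le> p (Suc i) \<and> p (Suc i) - p i < \<delta>)"
      "\<sigma> = (\<Sum>i<n. (\<omega> (p (Suc i)) - \<omega> (p i)) *\<^sub>R y (p i))" by blast
    with d(2) show "norm (\<sigma> - J) < e" by simp
  qed
qed

lemma has_young_integral_degenerate:
  assumes "has_young_integral y \<omega> a a J"
  shows "J = 0"
proof (rule ccontr)
  assume "J \<noteq> 0"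
  then obtain d where "d > 0" "\<And>\<sigma>. riemann_sum y \<omega> d a a \<sigma> \<Longrightarrow> norm (\<sigma> - J) < norm J"
    using has_young_integralD[OF assms, of "norm J"] by auto
  from this(2)[OF riemann_sum.nil] show False by simp
qed

text \<open>A fine sum over \<open>[a, s]\<close> put in front of one over \<open>[s, t]\<close> is
  a fine sum over \<open>[a, t]\<close>; subtracting the two errors, each below
  \<open>e / 2\<close>, leaves the error on \<open>[s, t]\<close>.\<close>

lemma young_integral_subinterval:
  assumes "has_young_integral y \<omega> a s J" "has_young_integral y \<omega> a t J'" "a \<le> s" "s \<le> t" "e > 0"
  obtains \<delta> where "\<delta> > 0" "\<And>\<sigma>. riemann_sum y \<omega> \<delta> s t \<sigma> \<Longrightarrow> norm (\<sigma> - (J' - J)) < e"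
proof -
  have e2: "e / 2 > 0" using \<open>e > 0\<close> by simp
  obtain d1 where d1: "d1 > 0" "\<And>\<sigma>. riemann_sum y \<omega> d1 a s \<sigma> \<Longrightarrow> norm (\<sigma> - J) < e/2"
    using has_young_integralD[OF assms(1) e2] by blast
  obtain d2 where d2: "d2 > 0" "\<And>\<sigma>. riemann_sum y \<omega> d2 a t \<sigma> \<Longrightarrow> norm (\<sigma> - J') < e/2"
    using has_young_integralD[OF assms(2) e2] by blast
  define d where "d = min d1 d2"
  have d: "d > 0" "d \<le> d1" "d \<le> d2" using d1 d2 by (auto simp: d_def)
  show thesis
  proof (rule that[OF d(1)])
    fix \<sigma> assume s: "riemann_sum y \<omega> d s t \<sigma>"
    obtain \<sigma>' where s': "riemann_sum y \<omega> d a s \<sigma>'" using riemann_sum_exists[OF \<open>a \<le> s\<close> d(1)] by blast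
    have "norm (\<sigma>' - J) < e/2" using d1(2)[OF riemann_sum_mono[OF s' d(2)]] .
    moreover have "norm (\<sigma>' + \<sigma> - J') < e/2"
      using d2(2)[OF riemann_sum_mono[OF riemann_sum_append[OF s s'] d(3)]] .
    ultimately have "norm ((\<sigma>' + \<sigma> - J') - (\<sigma>' - J)) < e"
      using norm_triangle_ineq4[of "\<sigma>' + \<sigma> - J'" "\<sigma>' - J"] by linarith
    then show "norm (\<sigma> - (J' - J)) < e" by (simp add: algebra_simps)
  qed
qed

text \<open>The analogue of Henstock's lemma: refining the partition outside an arbitrary subfamily
  of its intervals shows that already the partial sums of the local errors are small.\<close>

lemma young_integral_Henstock:
  fixes y :: "real \<Rightarrow> 'a::euclidean_space"
  assumes J: "\<And>t. 0 \<le> t \<Longrightarrow> t \<le> T \<Longrightarrow> has_young_integral y \<omega> 0 t (J t)" and T: "T \<ge> 0" and e: "e > 0"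
  obtains \<delta> where "\<delta> > 0"
    "\<And>n p. p 0 = 0 \<Longrightarrow> p n = T \<Longrightarrow> (\<And>i. i < n \<Longrightarrow> p i \<le> p (Suc i) \<and> p (Suc i) - p i < \<delta>) \<Longrightarrow>
      (\<Sum>i<n. norm (J (p (Suc i)) - J (p i) - (\<omega> (p (Suc i)) - \<omega> (p i)) *\<^sub>R y (p i))) \<le> e"
proof -
  \<comment> \<open>The bound over all subfamilies loses twice the dimension, and each subfamily
    contributes at most \<open>2 * e'\<close>.\<close>
  define e' where "e' = e / (4 * DIM('a))"
  have e': "e' > 0" using e by (simp add: e'_def)
  obtain d where d: "d > 0" "\<And>\<sigma>. riemann_sum y \<omega> d 0 T \<sigma> \<Longrightarrow> norm (\<sigma> - J T) < e'"
    using has_young_integralD[OF J[OF T order_refl] e'] by blast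
  have J0: "J 0 = 0" by (rule has_young_integral_degenerate[OF J[OF order_refl T]])
  show thesis
  proof (rule that[OF d(1)])
    fix n and p :: "nat \<Rightarrow> real"
    assume p0: "p 0 = 0" and pn: "p n = T"
      and pm: "\<And>i. i < n \<Longrightarrow> p i \<le> p (Suc i) \<and> p (Suc i) - p i < d"
    have mono: "p i \<le> p j" if "i \<le> j" "j \<le> n" for i j
      using that
    proof (induction j)
      case (Suc j)
      then show ?case using pm[of j] by (cases "i = Suc j") auto
    qed simp
    define R where "R i = J (p (Suc i)) - J (p i) - (\<omega> (p (Suc i)) - \<omega> (p i)) *\<^sub>R y (p i)" for i
    have tel: "(\<Sum>i<k. J (p (Suc i)) - J (p i)) = J (p k)" for k
      using sum_lessThan_telescope[of "\<lambda>i. J (p i)" k] p0 J0 by simp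
    have sub: "norm (sum R S) \<le> 2 * e'" if "S \<subseteq> {..<n}" for S
    proof -
      define \<eta> where "\<eta> = e' / (real n + 1)"
      have eta: "\<eta> > 0" using e' by (simp add: \<eta>_def)
      \<comment> \<open>A piece in \<open>S\<close> keeps its single left endpoint term, whose error
        is \<open>- R i\<close>; any other piece is refined until its error is at most
        \<open>\<eta>\<close>. The concatenation still has mesh below \<open>d\<close>.\<close>
      have piece: "\<exists>\<sigma>. riemann_sum y \<omega> d (p i) (p (Suc i)) \<sigma> \<and>
          norm (\<sigma> - (J (p (Suc i)) - J (p i)) + (if i \<in> S then R i else 0)) \<le> \<eta>" if "i < n" for i
      proof (cases "i \<in> S")
        case True
        have "riemann_sum y \<omega> d (p i) (p (Suc i)) (0 + (\<omega> (p (Suc i)) - \<omega> (p i)) *\<^sub>R y (p i))"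
          using pm[OF that] by (intro riemann_sum.intros) auto
        moreover have "norm (0 + (\<omega> (p (Suc i)) - \<omega> (p i)) *\<^sub>R y (p i) - (J (p (Suc i)) - J (p i)) + R i) \<le> \<eta>"
          using eta by (simp add: R_def)
        ultimately show ?thesis using True by auto
      next
        case False
        have i: "0 \<le> p i" "p i \<le> p (Suc i)" "p (Suc i) \<le> T"
          using mono[of 0 i] mono[of "Suc i" n] pm[OF that] that p0 pn by auto
        obtain d' where d': "d' > 0" "\<And>\<sigma>. riemann_sum y \<omega> d' (p i) (p (Suc i)) \<sigma> \<Longrightarrow>
            norm (\<sigma> - (J (p (Suc i)) - J (p i))) < \<eta>"
          by (rule young_integral_subinterval[OF J J i(1,2) eta]) (use i in auto)
        obtain \<sigma> where s: "riemann_sum y \<omega> (min d d') (p i) (p (Suc i)) \<sigma>"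
          using riemann_sum_exists[OF i(2), of "min d d'"] d(1) d'(1) by fastforce
        show ?thesis
          using riemann_sum_mono[OF s, of d] d'(2)[OF riemann_sum_mono[OF s, of d']] False
          by (intro exI[of _ \<sigma>]) auto
      qed
      have "\<exists>\<sigma>. riemann_sum y \<omega> d (p 0) (p k) \<sigma> \<and>
          norm (\<sigma> - J (p k) + (\<Sum>i<k. if i \<in> S then R i else 0)) \<le> real k * \<eta>" if "k \<le> n" for k
        using that
      proof (induction k)
        case 0 then show ?case using riemann_sum.nil[of y \<omega> d "p 0"] p0 J0 by (intro exI[of _ 0]) auto
      next
        case (Suc k)
        then obtain \<sigma> where s: "riemann_sum y \<omega> d (p 0) (p k) \<sigma>"
          "norm (\<sigma> - J (p k) + (\<Sum>i<k. if i \<in> S then R i else 0)) \<le> real k * \<eta>" by auto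
        obtain \<tau> where t: "riemann_sum y \<omega> d (p k) (p (Suc k)) \<tau>"
          "norm (\<tau> - (J (p (Suc k)) - J (p k)) + (if k \<in> S then R k else 0)) \<le> \<eta>"
          using piece[of k] Suc.prems by auto
        have "norm ((\<sigma> + \<tau>) - J (p (Suc k)) + (\<Sum>i<Suc k. if i \<in> S then R i else 0))
          = norm ((\<sigma> - J (p k) + (\<Sum>i<k. if i \<in> S then R i else 0)) +
             (\<tau> - (J (p (Suc k)) - J (p k)) + (if k \<in> S then R k else 0)))"
          by (simp add: algebra_simps)
        also have "\<dots> \<le> real k * \<eta> + \<eta>" by (rule norm_triangle_mono[OF s(2) t(2)])
        finally show ?case using riemann_sum_append[OF t(1) s(1)]
          by (intro exI[of _ "\<sigma> + \<tau>"]) (simp add: algebra_simps)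
      qed
      from this[of n] obtain \<sigma> where s: "riemann_sum y \<omega> d (p 0) (p n) \<sigma>"
          "norm (\<sigma> - J (p n) + (\<Sum>i<n. if i \<in> S then R i else 0)) \<le> real n * \<eta>" by auto
      \<comment> \<open>The refined pieces together cost at most \<open>e'\<close>, and the whole
        sum is within another \<open>e'\<close> of the integral.\<close>
      have "real n * \<eta> \<le> e'" using e' by (simp add: \<eta>_def field_simps)
      moreover have "norm (\<sigma> - J T) < e'" using d(2) s(1) p0 pn by simp
      moreover have "(\<Sum>i<n. if i \<in> S then R i else 0) = sum R S"
        using that by (simp add: sum.If_cases Int_absorb1)
      ultimately show ?thesis using s(2) pn
        norm_triangle_ineq4[of "\<sigma> - J (p n) + sum R S" "\<sigma> - J T"] by (simp add: algebra_simps)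
    qed
    have "(\<Sum>i<n. norm (R i)) \<le> 2 * real DIM('a) * (2 * e')"
      by (rule sum_norm_allsubsets_bound) (use sub in auto)
    also have "\<dots> = e" by (simp add: e'_def)
    finally show "(\<Sum>i<n. norm (J (p (Suc i)) - J (p i) - (\<omega> (p (Suc i)) - \<omega> (p i)) *\<^sub>R y (p i))) \<le> e"
      by (simp add: R_def)
  qed
qed

lemma continuous_on_exp_scaleR:
  fixes S :: "'a::{banach,real_normed_algebra_1}"
  assumes "continuous_on X h"
  shows "continuous_on X (\<lambda>r. exp (h r *\<^sub>R S))"
proof -
  have "continuous_on UNIV (\<lambda>t. exp (t *\<^sub>R S))"
    using has_vector_derivative_continuous[OF exp_scaleR_has_vector_derivative_right]
    by (auto simp: continuous_on_eq_continuous_within)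
  from continuous_on_compose2[OF this assms] show ?thesis by simp
qed

text \<open>The product rule has no correction term because a path that is Hoelder of order above
  1/2 has vanishing quadratic variation. Over each step of a uniform partition, the increment of
  \<open>u\<close> differs from that of the integral by three errors: the local Young error, summed
  by \<open>young_integral_Henstock\<close>, the second order remainder of the exponential, and the
  variation of \<open>g\<close> in front of the drift.\<close>

lemma Doss_Sussmann_transform:
  fixes C A :: "real^'n^'n" and f :: "real^'n \<Rightarrow> real^'n"
  assumes sol: "young_solution A f C \<omega> x0 x"
    and hoelder: "locally_Hoelder \<nu> \<omega>" and \<nu>: "\<nu> > 1/2" and cont: "continuous_on UNIV \<omega>" and "\<omega> 0 = 0"
    and contf: "continuous_on UNIV f" and T: "T \<ge> 0"
  defines "g \<equiv> \<lambda>r. exp ((- \<omega> r) *\<^sub>R endo_of_matrix C)" and "b \<equiv> \<lambda>r. A *v x r + f (x r)"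
  shows "g T \<bullet>\<^sub>E x T = x0 + integral {0..T} (\<lambda>r. g r \<bullet>\<^sub>E b r)"
proof -
  define c where "c = norm (endo_of_matrix C)"
  have contx: "continuous_on {0..T} x"
    using sol unfolding young_solution_def by (auto intro: continuous_on_subset)
  have contg: "continuous_on {0..T} g"
    unfolding g_def by (intro continuous_on_exp_scaleR continuous_intros continuous_on_subset[OF cont]) auto
  have contb: "continuous_on {0..T} b"
    unfolding b_def
    by (intro continuous_intros contx continuous_on_compose2[OF contf contx]
        linear_continuous_on_compose[OF contx]) (auto simp: matrix_vector_mul_linear)
  have contgb: "continuous_on {0..T} (\<lambda>r. g r \<bullet>\<^sub>E b r)"
    by (intro endo_apply.continuous_on contg contb)
  obtain J where J: "\<And>t. t \<ge> 0 \<Longrightarrow> has_young_integral (\<lambda>s. C *v x s) \<omega> 0 t (J t)"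
      "\<And>t. t \<ge> 0 \<Longrightarrow> x t = x0 + integral {0..t} b + J t"
    using sol unfolding young_solution_def b_def[symmetric] by metis
  obtain W where W: "W > 0" "\<And>r. r \<in> {0..T} \<Longrightarrow> \<bar>\<omega> r\<bar> \<le> W"
    using compact_imp_bounded[OF compact_continuous_image[OF continuous_on_subset[OF cont subset_UNIV] compact_Icc[of 0 T]]]
    by (auto simp: bounded_pos)
  obtain X where X: "X > 0" "\<And>r. r \<in> {0..T} \<Longrightarrow> norm (x r) \<le> X"
    using compact_imp_bounded[OF compact_continuous_image[OF contx compact_Icc]]
    by (auto simp: bounded_pos)
  obtain Kb where Kb: "Kb > 0" "\<And>r. r \<in> {0..T} \<Longrightarrow> norm (b r) \<le> Kb"
    using compact_imp_bounded[OF compact_continuous_image[OF contb compact_Icc]]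
    by (auto simp: bounded_pos)
  obtain M where M: "M > 0" "\<And>r. r \<in> {0..T} \<Longrightarrow> norm (g r) \<le> M"
    using compact_imp_bounded[OF compact_continuous_image[OF contg compact_Icc]]
    by (auto simp: bounded_pos)
  obtain K0 where K0: "\<forall>s\<in>{0..T}. \<forall>t\<in>{0..T}. \<bar>\<omega> s - \<omega> t\<bar> \<le> K0 * \<bar>s - t\<bar> powr \<nu>"
    using hoelder unfolding locally_Hoelder_def by blast
  define K where "K = max K0 0"
  have K: "\<bar>\<omega> s - \<omega> t\<bar> \<le> K * \<bar>s - t\<bar> powr \<nu>" "K \<ge> 0" if "s \<in> {0..T}" "t \<in> {0..T}" for s t
  proof -
    have "\<bar>\<omega> s - \<omega> t\<bar> \<le> K0 * \<bar>s - t\<bar> powr \<nu>" using K0 that by blast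
    also have "\<dots> \<le> K * \<bar>s - t\<bar> powr \<nu>" by (intro mult_right_mono) (auto simp: K_def)
    finally show "\<bar>\<omega> s - \<omega> t\<bar> \<le> K * \<bar>s - t\<bar> powr \<nu>" .
  qed (simp add: K_def)
  define I where "I t = integral {0..t} (\<lambda>r. g r \<bullet>\<^sub>E b r)" for t
  define u where "u t = g t \<bullet>\<^sub>E x t" for t
  define R where "R s t = J t - J s - (\<omega> t - \<omega> s) *\<^sub>R (C *v x s)" for s t
  define Q where "Q = c\<^sup>2 * exp (2 * W * c) * X"
  have Q: "Q \<ge> 0" using X by (auto simp: Q_def)
  have I_diff: "integral {0..t} h - integral {0..s} h = integral {s..t} h"
    if "continuous_on {0..T} h" "0 \<le> s" "s \<le> t" "t \<le> T" for h :: "real \<Rightarrow> real^'n" and s t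
  proof -
    have "h integrable_on {0..t}"
      using that by (intro integrable_continuous_real continuous_on_subset[OF that(1)]) auto
    then show ?thesis
      using Henstock_Kurzweil_Integration.integral_combine[OF that(2,3)] by (metis add_diff_cancel_left')
  qed
  have key: "norm (u T - x0 - I T) \<le> (M + M * Q + Kb * T) * e" if e: "e > 0" for e
  proof -
    obtain d1 where d1: "d1 > 0"
      "\<And>n p. p 0 = 0 \<Longrightarrow> p n = T \<Longrightarrow> (\<And>i. i < n \<Longrightarrow> p i \<le> p (Suc i) \<and> p (Suc i) - p i < d1) \<Longrightarrow>
      (\<Sum>i<n. norm (J (p (Suc i)) - J (p i) - (\<omega> (p (Suc i)) - \<omega> (p i)) *\<^sub>R (C *v x (p i)))) \<le> e"
      using young_integral_Henstock[where J=J, OF J(1) T e] by blast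
    obtain d2 where d2: "d2 > 0" "\<And>r s. r \<in> {0..T} \<Longrightarrow> s \<in> {0..T} \<Longrightarrow> dist s r < d2 \<Longrightarrow> dist (g s) (g r) < e"
      using compact_uniformly_continuous[OF contg compact_Icc] e unfolding uniformly_continuous_on_def by blast
    have "((\<lambda>n. T / real n) \<longlonglongrightarrow> 0)" by real_asymp
    then have ev1: "\<forall>\<^sub>F n in sequentially. T / real n < min d1 d2"
      using d1 d2 by (intro order_tendstoD) auto
    \<comment> \<open>This bounds the sum of \<open>n\<close> squared increments over steps of
      length \<open>T / n\<close>; it vanishes in the limit because \<open>1 - 2 * \<nu>\<close> is
      negative.\<close>
    have "((\<lambda>n. K\<^sup>2 * T powr (2 * \<nu>) * real n powr (1 - 2 * \<nu>)) \<longlonglongrightarrow> 0)"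
      using \<nu> by real_asymp
    then have ev2: "\<forall>\<^sub>F n in sequentially. K\<^sup>2 * T powr (2 * \<nu>) * real n powr (1 - 2 * \<nu>) < e"
      using e by (intro order_tendstoD) auto
    obtain n where n: "n > 0" "T / real n < min d1 d2" "K\<^sup>2 * T powr (2 * \<nu>) * real n powr (1 - 2 * \<nu>) < e"
      using eventually_happens[OF eventually_conj[OF eventually_gt_at_top[of 0] eventually_conj[OF ev1 ev2]]] by auto
    define p where "p i = T * (real i / real n)" for i
    have p0: "p 0 = 0" and pn: "p n = T" using n by (auto simp: p_def)
    have pd: "p (Suc i) - p i = T / n" for i using n by (simp add: p_def field_simps)
    have pT: "p i \<in> {0..T}" if "i \<le> n" for i
    proof -
      have "real i / real n \<le> 1" using that n by simp
      then have "T * (real i / real n) \<le> T * 1" using T by (intro mult_left_mono)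
      then show ?thesis using T by (simp add: p_def)
    qed
    have step: "norm ((u t - u s) - (I t - I s)) \<le> M * norm (R s t) + M * Q * (\<omega> t - \<omega> s)\<^sup>2 + e * Kb * (t - s)"
      if st: "s \<in> {0..T}" "t \<in> {0..T}" "s \<le> t" "t - s < d2" for s t
    proof -
      define \<Delta> where "\<Delta> = \<omega> t - \<omega> s"
      define Ex where "Ex = exp (\<Delta> *\<^sub>R endo_of_matrix C)"
      \<comment> \<open>With both end points expressed through \<open>g t\<close>, the increment of
        \<open>u\<close> is \<open>g t\<close> applied to \<open>x t\<close> minus the image of
        \<open>x s\<close> under the pure noise flow.\<close>
      have gE: "g s = g t * Ex"
      proof -
        have "g t * Ex = exp ((- \<omega> t) *\<^sub>R endo_of_matrix C + \<Delta> *\<^sub>R endo_of_matrix C)"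
          unfolding g_def Ex_def by (subst exp_add_commuting) auto
        also have "\<dots> = g s" unfolding g_def \<Delta>_def by (simp add: algebra_simps)
        finally show ?thesis ..
      qed
      define Y where "Y = (Ex - 1 - \<Delta> *\<^sub>R endo_of_matrix C) \<bullet>\<^sub>E x s"
      define D where "D = integral {s..t} b"
      have xt: "x t - x s = D + (J t - J s)"
        using J(2)[of t] J(2)[of s] st I_diff[OF contb, of s t] by (simp add: D_def algebra_simps)
      have "u t - u s = g t \<bullet>\<^sub>E (x t - Ex \<bullet>\<^sub>E x s)"
        unfolding u_def gE by (simp add: endo_apply_simps endo_apply.diff_right)
      also have "x t - Ex \<bullet>\<^sub>E x s = D + R s t - Y"
      proof -
        have "Y = Ex \<bullet>\<^sub>E x s - x s - \<Delta> *\<^sub>R (C *v x s)"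
          by (simp only: Y_def endo_apply.diff_left endo_apply.scaleR_left endo_apply_simps endo_of_matrix_apply)
        moreover have "x t = x s + D + (J t - J s)" using xt by (simp add: algebra_simps)
        ultimately show ?thesis by (simp add: R_def \<Delta>_def)
      qed
      finally have u: "u t - u s = g t \<bullet>\<^sub>E D + g t \<bullet>\<^sub>E R s t - g t \<bullet>\<^sub>E Y"
        by (simp add: endo_apply.diff_right endo_apply.add_right)
      have cs: "continuous_on {s..t} b" "continuous_on {s..t} g"
        using st by (auto intro: continuous_on_subset[OF contb] continuous_on_subset[OF contg])
      have "g t \<bullet>\<^sub>E D = integral {s..t} (\<lambda>r. g t \<bullet>\<^sub>E b r)"
        unfolding D_def
        by (rule integral_linear[OF integrable_continuous_real[OF cs(1)] endo_apply.bounded_linear_right,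
              symmetric, unfolded o_def])
      moreover have "I t - I s = integral {s..t} (\<lambda>r. g r \<bullet>\<^sub>E b r)"
        unfolding I_def using I_diff[OF contgb] st by auto
      ultimately have "g t \<bullet>\<^sub>E D - (I t - I s) = integral {s..t} (\<lambda>r. (g t - g r) \<bullet>\<^sub>E b r)"
        unfolding endo_apply.diff_left
        by (subst Henstock_Kurzweil_Integration.integral_diff)
           (auto intro!: integrable_continuous_real endo_apply.continuous_on cs)
      moreover have "norm (integral {s..t} (\<lambda>r. (g t - g r) \<bullet>\<^sub>E b r)) \<le> (e * Kb) * (t - s)"
      proof (rule integral_bound[OF st(3)])
        show "continuous_on {s..t} (\<lambda>r. (g t - g r) \<bullet>\<^sub>E b r)"
          by (intro endo_apply.continuous_on continuous_intros cs)
        fix r assume "r \<in> {s..t}"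
        then have "norm (g t - g r) \<le> e" "norm (b r) \<le> Kb"
          using d2(2)[of r t] Kb(2)[of r] st by (auto simp: dist_norm dist_real_def)
        then show "norm ((g t - g r) \<bullet>\<^sub>E b r) \<le> e * Kb"
          using e by (intro order_trans[OF norm_endo_apply] mult_mono) auto
      qed
      ultimately have 1: "norm (g t \<bullet>\<^sub>E D - (I t - I s)) \<le> e * Kb * (t - s)" by simp
      have gt: "norm (g t) \<le> M" using M st by auto
      have 2: "norm (g t \<bullet>\<^sub>E R s t) \<le> M * norm (R s t)"
        by (rule order_trans[OF norm_endo_apply]) (intro mult_right_mono gt norm_ge_zero)
      have "norm Y \<le> norm (Ex - 1 - \<Delta> *\<^sub>R endo_of_matrix C) * norm (x s)"
        unfolding Y_def by (rule norm_endo_apply)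
      also have "\<dots> \<le> (\<Delta>\<^sup>2 * c\<^sup>2 * exp (2 * W * c)) * X"
      proof (intro mult_mono)
        have "norm (Ex - 1 - \<Delta> *\<^sub>R endo_of_matrix C) \<le> (\<bar>\<Delta>\<bar> * c)\<^sup>2 * exp (\<bar>\<Delta>\<bar> * c)"
          unfolding Ex_def c_def using norm_exp_second_order[of "\<Delta> *\<^sub>R endo_of_matrix C"] by simp
        also have "\<dots> \<le> (\<bar>\<Delta>\<bar> * c)\<^sup>2 * exp (2 * W * c)"
        proof -
          have "\<bar>\<Delta>\<bar> \<le> 2 * W" using W(2)[of s] W(2)[of t] st by (auto simp: \<Delta>_def)
          then show ?thesis by (intro mult_left_mono) (auto simp: c_def mult_right_mono)
        qed
        finally show "norm (Ex - 1 - \<Delta> *\<^sub>R endo_of_matrix C) \<le> \<Delta>\<^sup>2 * c\<^sup>2 * exp (2 * W * c)"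
          by (simp add: power_mult_distrib)
      qed (use X st in auto)
      finally have Y: "norm Y \<le> Q * \<Delta>\<^sup>2" by (simp add: Q_def mult_ac)
      have 3: "norm (g t \<bullet>\<^sub>E Y) \<le> M * (Q * \<Delta>\<^sup>2)"
        by (rule order_trans[OF norm_endo_apply]) (intro mult_mono gt Y, use M in auto)
      have "(u t - u s) - (I t - I s) = ((g t \<bullet>\<^sub>E D - (I t - I s)) + g t \<bullet>\<^sub>E R s t) - g t \<bullet>\<^sub>E Y"
        using u by simp
      also have "norm \<dots> \<le> norm ((g t \<bullet>\<^sub>E D - (I t - I s)) + g t \<bullet>\<^sub>E R s t) + norm (g t \<bullet>\<^sub>E Y)"
        by (rule norm_triangle_ineq4)
      also have "\<dots> \<le> norm (g t \<bullet>\<^sub>E D - (I t - I s)) + norm (g t \<bullet>\<^sub>E R s t) + norm (g t \<bullet>\<^sub>E Y)"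
        by (intro add_right_mono norm_triangle_ineq)
      finally have "norm ((u t - u s) - (I t - I s)) \<le>
          norm (g t \<bullet>\<^sub>E D - (I t - I s)) + norm (g t \<bullet>\<^sub>E R s t) + norm (g t \<bullet>\<^sub>E Y)" .
      then show ?thesis using 1 2 3 by (simp add: \<Delta>_def)
    qed
    have u0: "u 0 = x0" "I 0 = 0"
    proof -
      have "J 0 = 0" by (rule has_young_integral_degenerate[OF J(1)[OF order_refl]])
      then show "u 0 = x0" using J(2)[of 0] \<open>\<omega> 0 = 0\<close> by (simp add: u_def g_def endo_apply_simps)
    qed (simp add: I_def)
    have "u T - x0 - I T = (\<Sum>i<n. (u (p (Suc i)) - u (p i)) - (I (p (Suc i)) - I (p i)))"
      using sum_lessThan_telescope[of "\<lambda>i. u (p i) - I (p i)" n] u0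
      by (simp add: p0 pn algebra_simps)
    also have "norm \<dots> \<le> (\<Sum>i<n. M * norm (R (p i) (p (Suc i))) + M * Q * (\<omega> (p (Suc i)) - \<omega> (p i))\<^sup>2 + e * Kb * (p (Suc i) - p i))"
    proof (intro sum_norm_le step)
      fix i assume "i \<in> {..<n}"
      then show "p i \<in> {0..T}" "p (Suc i) \<in> {0..T}" by (auto intro: pT simp del: atLeastAtMost_iff)
      have "T / real n \<ge> 0" using T by simp
      then show "p i \<le> p (Suc i)" "p (Suc i) - p i < d2" using pd[of i] n by auto
    qed
    also have "\<dots> = M * (\<Sum>i<n. norm (R (p i) (p (Suc i)))) + M * Q * (\<Sum>i<n. (\<omega> (p (Suc i)) - \<omega> (p i))\<^sup>2) + e * Kb * T"
      using n by (simp add: sum.distrib sum_distrib_left pd)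
    also have "\<dots> \<le> M * e + M * Q * e + e * Kb * T"
    proof (intro add_mono mult_left_mono order_refl)
      show "(\<Sum>i<n. norm (R (p i) (p (Suc i)))) \<le> e"
        unfolding R_def
      proof (rule d1(2)[of p n, OF p0 pn])
        fix i
        have "T / real n \<ge> 0" using T by simp
        then show "p i \<le> p (Suc i) \<and> p (Suc i) - p i < d1" using pd[of i] n by auto
      qed
      have "(\<Sum>i<n. (\<omega> (p (Suc i)) - \<omega> (p i))\<^sup>2) \<le> (\<Sum>i<n. (K * (T / n) powr \<nu>)\<^sup>2)"
      proof (intro sum_mono)
        fix i assume i: "i \<in> {..<n}"
        have "\<bar>\<omega> (p (Suc i)) - \<omega> (p i)\<bar> \<le> K * \<bar>p (Suc i) - p i\<bar> powr \<nu>"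
          using i by (intro K pT) auto
        then have "\<bar>\<omega> (p (Suc i)) - \<omega> (p i)\<bar> \<le> K * (T / n) powr \<nu>"
          using pd[of i] T by simp
        then show "(\<omega> (p (Suc i)) - \<omega> (p i))\<^sup>2 \<le> (K * (T / n) powr \<nu>)\<^sup>2"
          by (metis abs_ge_zero power2_abs power_mono)
      qed
      also have "\<dots> = K\<^sup>2 * T powr (2 * \<nu>) * real n powr (1 - 2 * \<nu>)"
      proof -
        have "((T / n) powr \<nu>)\<^sup>2 = (T / n) powr (2 * \<nu>)"
          by (simp add: power2_eq_square powr_add[symmetric])
        also have "\<dots> = T powr (2 * \<nu>) / real n powr (2 * \<nu>)"
          using T by (simp add: powr_divide)
        finally show ?thesis using n by (simp add: power_mult_distrib powr_diff)
      qed
      finally show "(\<Sum>i<n. (\<omega> (p (Suc i)) - \<omega> (p i))\<^sup>2) \<le> e" using n by simp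
    qed (use M Q Kb e in auto)
    finally show ?thesis by (simp add: algebra_simps)
  qed
  define N where "N = M + M * Q + Kb * T"
  have N: "N > 0" using M Q Kb T by (auto simp: N_def intro!: add_pos_nonneg)
  \<comment> \<open>The constant \<open>N\<close> in front of \<open>e\<close> does not depend on
    \<open>e\<close>, so the defect is zero.\<close>
  have "norm (u T - x0 - I T) \<le> 0"
  proof (rule field_le_epsilon)
    fix e :: real assume "e > 0"
    with key[of "e / N"] N show "norm (u T - x0 - I T) \<le> 0 + e" by (simp add: N_def[symmetric])
  qed
  then show ?thesis by (simp add: u_def I_def algebra_simps)
qed

section \<open>Dissipative estimates for the transformed equation\<close>

lemma dissipative_ode_bound:
  fixes v d :: "real \<Rightarrow> 'a::real_inner"
  assumes der: "\<And>r. r \<in> {0..T} \<Longrightarrow> (v has_vector_derivative d r) (at r within {0..T})"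
    and dis: "\<And>r. r \<in> {0..T} \<Longrightarrow> v r \<bullet> d r \<le> - \<kappa> * (norm (v r))\<^sup>2 + \<beta>"
    and "\<kappa> \<ge> 0" "\<beta> \<ge> 0" "T \<ge> 0"
  shows "(norm (v T))\<^sup>2 \<le> exp (- 2 * \<kappa> * T) * (norm (v 0))\<^sup>2 + 2 * \<beta> * T"
proof -
  \<comment> \<open>The term \<open>2 * \<beta> * r\<close> is multiplied by the integrating factor
    as well. The derivative stays nonpositive, and no division by \<open>\<kappa>\<close> occurs, so
    that \<open>\<kappa> = 0\<close> is covered.\<close>
  define w where "w r = exp (2 * \<kappa> * r) * (v r \<bullet> v r - 2 * \<beta> * r)" for r
  have contv: "continuous_on {0..T} v"
    by (rule continuous_on_vector_derivative[OF der])
  have "w T \<le> w 0"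
  proof (rule DERIV_nonpos_imp_decreasing_open[of 0 T w])
    show "continuous_on {0..T} w" unfolding w_def by (intro continuous_intros contv)
    fix r assume r: "0 < r" "r < T"
    have dv: "(v has_vector_derivative d r) (at r)"
      using der[of r] r by (simp add: at_within_Icc_at)
    have "((\<lambda>r. v r \<bullet> v r) has_vector_derivative (v r \<bullet> d r + d r \<bullet> v r)) (at r)"
      by (rule bounded_bilinear.has_vector_derivative[OF bounded_bilinear_inner dv dv])
    then have "((\<lambda>r. v r \<bullet> v r) has_real_derivative 2 * (v r \<bullet> d r)) (at r)"
      by (simp add: has_real_derivative_iff_has_vector_derivative inner_commute)
    then have "(w has_real_derivative
        exp (2 * \<kappa> * r) * (2 * \<kappa>) * (v r \<bullet> v r - 2 * \<beta> * r) + exp (2 * \<kappa> * r) * (2 * (v r \<bullet> d r) - 2 * \<beta>)) (at r)"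
      unfolding w_def by (auto intro!: derivative_eq_intros)
    moreover have "exp (2 * \<kappa> * r) * (2 * \<kappa>) * (v r \<bullet> v r - 2 * \<beta> * r) + exp (2 * \<kappa> * r) * (2 * (v r \<bullet> d r) - 2 * \<beta>)
      = 2 * exp (2 * \<kappa> * r) * ((v r \<bullet> d r + \<kappa> * (norm (v r))\<^sup>2 - \<beta>) - 2 * \<kappa> * \<beta> * r)"
      by (simp add: power2_norm_eq_inner algebra_simps)
    moreover have "\<dots> \<le> 0"
    proof (rule mult_nonneg_nonpos)
      have "0 \<le> 2 * \<kappa> * \<beta> * r" using assms r by (intro mult_nonneg_nonneg) auto
      moreover have "v r \<bullet> d r \<le> - \<kappa> * (norm (v r))\<^sup>2 + \<beta>" using dis r by simp
      ultimately show "v r \<bullet> d r + \<kappa> * (norm (v r))\<^sup>2 - \<beta> - 2 * \<kappa> * \<beta> * r \<le> 0"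
        by linarith
    qed simp
    ultimately show "\<exists>y. (w has_real_derivative y) (at r) \<and> y \<le> 0" by metis
  qed (use \<open>T \<ge> 0\<close> in simp)
  then have "exp (2 * \<kappa> * T) * (v T \<bullet> v T - 2 * \<beta> * T) \<le> (norm (v 0))\<^sup>2"
    by (simp add: w_def power2_norm_eq_inner)
  then have "exp (- 2 * \<kappa> * T) * (exp (2 * \<kappa> * T) * (v T \<bullet> v T - 2 * \<beta> * T)) \<le> exp (- 2 * \<kappa> * T) * (norm (v 0))\<^sup>2"
    by (intro mult_left_mono) auto
  then show ?thesis by (simp add: power2_norm_eq_inner mult.assoc[symmetric] exp_add[symmetric])
qed

text \<open>Conjugation perturbs \<open>A\<close> by \<open>(g - 1) * A' * E + A' * (E - 1)\<close>,
  whose norm is at most that of \<open>A\<close> times \<open>exp (2 * c) - 1\<close>, and raises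
  the Lipschitz constant of the nonlinearity to \<open>cf * exp (2 * c)\<close>. Both amounts are
  subtracted from \<open>hA\<close>.\<close>

lemma conjugated_drift_dissipative:
  fixes A :: "real^'n^'n" and f :: "real^'n \<Rightarrow> real^'n" and g E :: "(real^'n) endo"
  assumes A: "\<And>x. x \<bullet> (A *v x) \<le> - hA * (norm x)\<^sup>2"
    and f: "\<And>x y. norm (f x - f y) \<le> cf * norm (x - y)" and cf: "cf \<ge> 0"
    and gE: "norm g \<le> exp c" "norm E \<le> exp c" "norm (g - 1) \<le> exp c - 1" "norm (E - 1) \<le> exp c - 1"
  defines "\<kappa> \<equiv> hA - cf * exp (2 * c) - onorm ((*v) A) * (exp (2 * c) - 1)"
  shows "(a - b) \<bullet> (g \<bullet>\<^sub>E (A *v (E \<bullet>\<^sub>E a) + f (E \<bullet>\<^sub>E a)) - g \<bullet>\<^sub>E (A *v (E \<bullet>\<^sub>E b) + f (E \<bullet>\<^sub>E b)))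
    \<le> - \<kappa> * (norm (a - b))\<^sup>2"
proof -
  define A' where "A' = endo_of_matrix A"
  define v where "v = a - b"
  define F where "F = f (E \<bullet>\<^sub>E a) - f (E \<bullet>\<^sub>E b)"
  have ec: "exp c * exp c = exp (2 * c)" by (simp flip: exp_add)
  then have ec2: "exp (c * 2) = exp c * exp c" by (simp add: mult.commute)
  have ec0: "exp c \<ge> 1" using gE(3) norm_ge_zero[of "g - 1"] by linarith
  have split: "g \<bullet>\<^sub>E (A *v (E \<bullet>\<^sub>E a) + f (E \<bullet>\<^sub>E a)) - g \<bullet>\<^sub>E (A *v (E \<bullet>\<^sub>E b) + f (E \<bullet>\<^sub>E b))
     = A *v v + ((g - 1) * A' * E + A' * (E - 1)) \<bullet>\<^sub>E v + g \<bullet>\<^sub>E F"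
    unfolding v_def F_def A'_def
    by (simp add: endo_apply_simps endo_apply.diff_left endo_apply.diff_right endo_apply.add_left
        endo_apply.add_right endo_of_matrix_apply matrix_vector_mult_diff_distrib)
  have "norm ((g - 1) * A' * E + A' * (E - 1)) \<le> (exp c - 1) * norm A' * exp c + norm A' * (exp c - 1)"
    by (rule order_trans[OF norm_triangle_ineq])
       (intro add_mono order_trans[OF norm_mult_ineq] mult_mono gE order_refl mult_nonneg_nonneg norm_ge_zero,
        use ec0 in auto)
  also have "\<dots> = onorm ((*v) A) * (exp (2 * c) - 1)"
    unfolding ec[symmetric] by (simp add: A'_def norm_endo_of_matrix algebra_simps)
  finally have 1: "norm ((g - 1) * A' * E + A' * (E - 1)) \<le> onorm ((*v) A) * (exp (2 * c) - 1)" .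
  have "v \<bullet> (((g - 1) * A' * E + A' * (E - 1)) \<bullet>\<^sub>E v) \<le> norm v * (onorm ((*v) A) * (exp (2 * c) - 1) * norm v)"
    by (rule order_trans[OF norm_cauchy_schwarz])
       (intro mult_left_mono order_trans[OF norm_endo_apply] mult_right_mono 1 norm_ge_zero)
  moreover have "v \<bullet> (g \<bullet>\<^sub>E F) \<le> norm v * (exp c * (cf * (exp c * norm v)))"
  proof (rule order_trans[OF norm_cauchy_schwarz])
    have "norm F \<le> cf * norm (E \<bullet>\<^sub>E v)"
      unfolding F_def v_def endo_apply.diff_right by (rule f)
    also have "\<dots> \<le> cf * (exp c * norm v)"
      by (intro mult_left_mono order_trans[OF norm_endo_apply] mult_right_mono gE cf norm_ge_zero)
    finally show "norm v * norm (g \<bullet>\<^sub>E F) \<le> norm v * (exp c * (cf * (exp c * norm v)))"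
      by (intro mult_left_mono order_trans[OF norm_endo_apply] mult_mono gE) auto
  qed
  moreover have "v \<bullet> (A *v v) \<le> - hA * (norm v)\<^sup>2" by (rule A)
  ultimately show ?thesis unfolding split v_def[symmetric] \<kappa>_def
    by (simp add: inner_add_right power2_eq_square ec2 algebra_simps)
qed

section \<open>Estimates over one piece, on which the path stays in [-1, 1]\<close>

context
  fixes A C :: "real^'n^'n" and f :: "real^'n \<Rightarrow> real^'n" and hA cf c \<kappa> \<nu> T :: real and \<omega> :: "real \<Rightarrow> real"
  assumes A: "\<And>x. x \<bullet> (A *v x) \<le> - hA * (norm x)\<^sup>2"
    and f: "\<And>x y. norm (f x - f y) \<le> cf * norm (x - y)" and cf: "cf \<ge> 0"
    and hoelder: "locally_Hoelder \<nu> \<omega>" and \<nu>: "\<nu> > 1/2" and cont: "continuous_on UNIV \<omega>" and \<omega>0: "\<omega> 0 = 0"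
    and T: "T \<ge> 0" and small: "\<And>r. r \<in> {0..T} \<Longrightarrow> \<bar>\<omega> r\<bar> \<le> 1"
    and c: "onorm ((*v) C) = c"
    and \<kappa>: "\<kappa> \<le> hA - cf * exp (2 * c) - onorm ((*v) A) * (exp (2 * c) - 1)" "\<kappa> > 0"
begin

lemma lipschitz_continuous: "continuous_on UNIV f"
proof -
  have "cf-lipschitz_on UNIV f"
    by (rule lipschitz_onI) (auto simp: dist_norm f cf)
  then show ?thesis by (rule lipschitz_on_continuous_on)
qed

definition exp_noise :: "real \<Rightarrow> (real^'n) endo" where
  "exp_noise r = exp (\<omega> r *\<^sub>R endo_of_matrix C)"
definition exp_noise_inv :: "real \<Rightarrow> (real^'n) endo" where
  "exp_noise_inv r = exp ((- \<omega> r) *\<^sub>R endo_of_matrix C)"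

lemma exp_noise_inverse: "exp_noise r * exp_noise_inv r = 1"
  unfolding exp_noise_def exp_noise_inv_def using exp_minus_inverse[of "\<omega> r *\<^sub>R endo_of_matrix C"] by simp

lemma exp_noise_bounds:
  assumes "r \<in> {0..T}"
  shows "norm (exp_noise r) \<le> exp c" "norm (exp_noise_inv r) \<le> exp c"
    "norm (exp_noise r - 1) \<le> exp c - 1" "norm (exp_noise_inv r - 1) \<le> exp c - 1"
proof -
  have "c \<ge> 0" using c norm_endo_of_matrix[of C] by (metis norm_ge_zero)
  then have "\<bar>\<omega> r\<bar> * c \<le> c" using small[OF assms] mult_right_mono by fastforce
  then have n: "norm (\<omega> r *\<^sub>R endo_of_matrix C) \<le> c" "norm ((- \<omega> r) *\<^sub>R endo_of_matrix C) \<le> c"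
    using norm_endo_of_matrix[of C] c by auto
  show "norm (exp_noise r) \<le> exp c" "norm (exp_noise_inv r) \<le> exp c"
    unfolding exp_noise_def exp_noise_inv_def
    by (rule order_trans[OF norm_exp], use n in simp)+
  show "norm (exp_noise r - 1) \<le> exp c - 1" "norm (exp_noise_inv r - 1) \<le> exp c - 1"
    unfolding exp_noise_def exp_noise_inv_def
    by (rule order_trans[OF norm_exp_diff_one], use n in simp)+
qed

lemma transformed_solution:
  assumes sol: "young_solution A f C \<omega> x0 x"
  defines "u \<equiv> \<lambda>r. exp_noise_inv r \<bullet>\<^sub>E x r"
  shows "u 0 = x0" "x r = exp_noise r \<bullet>\<^sub>E u r"
    "r \<in> {0..T} \<Longrightarrow> (u has_vector_derivative
      exp_noise_inv r \<bullet>\<^sub>E (A *v (exp_noise r \<bullet>\<^sub>E u r) + f (exp_noise r \<bullet>\<^sub>E u r))) (at r within {0..T})"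
proof -
  show x: "x r = exp_noise r \<bullet>\<^sub>E u r" for r
    by (simp add: u_def exp_noise_inverse endo_apply_simps flip: endo_apply_simps(1))
  define h where "h r = exp_noise_inv r \<bullet>\<^sub>E (A *v x r + f (x r))" for r
  have u: "u t = x0 + integral {0..t} h" if "t \<ge> 0" for t
    using Doss_Sussmann_transform[OF sol hoelder \<nu> cont \<omega>0 lipschitz_continuous that]
    unfolding u_def h_def[abs_def] exp_noise_inv_def .
  show "u 0 = x0" using u[of 0] by simp
  have contx: "continuous_on {0..T} x"
    using sol unfolding young_solution_def by (auto intro: continuous_on_subset)
  have conth: "continuous_on {0..T} h"
    unfolding h_def exp_noise_inv_def
    by (intro endo_apply.continuous_on continuous_on_exp_scaleR continuous_intros continuous_on_subset[OF cont]
        contx continuous_on_compose2[OF lipschitz_continuous contx]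
        linear_continuous_on_compose[OF contx]) (auto simp: matrix_vector_mul_linear)
  assume r: "r \<in> {0..T}"
  have "((\<lambda>t. x0 + integral {0..t} h) has_vector_derivative h r) (at r within {0..T})"
    using has_vector_derivative_add[OF has_vector_derivative_const integral_has_vector_derivative[OF conth r]]
    by simp
  then have "(u has_vector_derivative h r) (at r within {0..T})"
    by (rule has_vector_derivative_transform[OF r, rotated]) (simp add: u)
  then show "(u has_vector_derivative
      exp_noise_inv r \<bullet>\<^sub>E (A *v (exp_noise r \<bullet>\<^sub>E u r) + f (exp_noise r \<bullet>\<^sub>E u r))) (at r within {0..T})"
    unfolding h_def x .
qed

text \<open>Since \<omega> vanishes at 0, the transform does not change the initial values; the
  factor \<open>exp c\<close> is paid only once, when the solutions are recovered at time
  \<open>T\<close>.\<close>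

lemma young_solution_contraction:
  assumes sol: "young_solution A f C \<omega> x0 x" "young_solution A f C \<omega> y0 y"
  shows "norm (x T - y T) \<le> exp (c - \<kappa> * T) * norm (x0 - y0)"
proof -
  define u where "u r = exp_noise_inv r \<bullet>\<^sub>E x r" for r
  define w where "w r = exp_noise_inv r \<bullet>\<^sub>E y r" for r
  note X = transformed_solution[OF sol(1), folded u_def] and Y = transformed_solution[OF sol(2), folded w_def]
  have "(norm (u T - w T))\<^sup>2 \<le> exp (- 2 * \<kappa> * T) * (norm (u 0 - w 0))\<^sup>2 + 2 * 0 * T"
  proof (rule dissipative_ode_bound)
    fix r assume r: "r \<in> {0..T}"
    show "((\<lambda>r. u r - w r) has_vector_derivative
      exp_noise_inv r \<bullet>\<^sub>E (A *v (exp_noise r \<bullet>\<^sub>E u r) + f (exp_noise r \<bullet>\<^sub>E u r)) -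
      exp_noise_inv r \<bullet>\<^sub>E (A *v (exp_noise r \<bullet>\<^sub>E w r) + f (exp_noise r \<bullet>\<^sub>E w r))) (at r within {0..T})"
      by (intro has_vector_derivative_diff X Y r)
    have "\<kappa> * (norm (u r - w r))\<^sup>2 \<le>
      (hA - cf * exp (2 * c) - onorm ((*v) A) * (exp (2 * c) - 1)) * (norm (u r - w r))\<^sup>2"
      by (intro mult_right_mono \<kappa>) simp
    then show "(u r - w r) \<bullet> (exp_noise_inv r \<bullet>\<^sub>E (A *v (exp_noise r \<bullet>\<^sub>E u r) + f (exp_noise r \<bullet>\<^sub>E u r)) -
      exp_noise_inv r \<bullet>\<^sub>E (A *v (exp_noise r \<bullet>\<^sub>E w r) + f (exp_noise r \<bullet>\<^sub>E w r))) \<le> - \<kappa> * (norm (u r - w r))\<^sup>2 + 0"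
      using conjugated_drift_dissipative[where f=f and c=c and g="exp_noise_inv r" and E="exp_noise r" and a="u r" and b="w r",
        OF A f cf exp_noise_bounds(2,1,4,3)[OF r]] by linarith
  qed (use \<kappa> T in auto)
  also have "\<dots> = (exp (- \<kappa> * T) * norm (x0 - y0))\<^sup>2"
    using X(1) Y(1) by (simp add: power_mult_distrib power2_eq_square flip: exp_add)
  finally have *: "norm (u T - w T) \<le> exp (- \<kappa> * T) * norm (x0 - y0)"
    by (rule power2_le_imp_le) simp
  have "norm (x T - y T) \<le> norm (exp_noise T) * norm (u T - w T)"
    unfolding X(2) Y(2) endo_apply.diff_right[symmetric] by (rule norm_endo_apply)
  also have "\<dots> \<le> exp c * (exp (- \<kappa> * T) * norm (x0 - y0))"
    by (intro mult_mono exp_noise_bounds *) (use T in auto)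
  finally show ?thesis by (simp add: exp_diff exp_minus field_simps)
qed

text \<open>All of the dissipation is spent, through Young's inequality for products, on the
  inhomogeneity \<open>f 0\<close>. This is why \<open>dissipative_ode_bound\<close> is applied with
  rate 0, and why a term of order \<open>sqrt T\<close> is added in place of exponential
  growth.\<close>

lemma young_solution_growth:
  assumes sol: "young_solution A f C \<omega> x0 x"
  shows "norm (x T) \<le> exp c * (norm x0 + exp c * norm (f 0) * sqrt (T / (2 * \<kappa>)))"
proof -
  define u where "u r = exp_noise_inv r \<bullet>\<^sub>E x r" for r
  note X = transformed_solution[OF sol, folded u_def]
  define b where "b = exp c * norm (f 0)"
  have "(norm (u T))\<^sup>2 \<le> exp (- 2 * 0 * T) * (norm (u 0))\<^sup>2 + 2 * (b\<^sup>2 / (4 * \<kappa>)) * T"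
  proof (rule dissipative_ode_bound[OF X(3)])
    fix r assume r: "r \<in> {0..T}"
    let ?d = "exp_noise_inv r \<bullet>\<^sub>E (A *v (exp_noise r \<bullet>\<^sub>E u r) + f (exp_noise r \<bullet>\<^sub>E u r))"
    have "\<kappa> * (norm (u r))\<^sup>2 \<le>
      (hA - cf * exp (2 * c) - onorm ((*v) A) * (exp (2 * c) - 1)) * (norm (u r))\<^sup>2"
      by (intro mult_right_mono \<kappa>) simp
    then have "u r \<bullet> (?d - exp_noise_inv r \<bullet>\<^sub>E f 0) \<le> - \<kappa> * (norm (u r))\<^sup>2"
      using conjugated_drift_dissipative[where f=f and c=c and g="exp_noise_inv r" and E="exp_noise r" and a="u r" and b=0,
        OF A f cf exp_noise_bounds(2,1,4,3)[OF r]]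
      unfolding endo_apply.zero_right matrix_vector_mult_0_right diff_zero add_0_left by linarith
    moreover have "u r \<bullet> (exp_noise_inv r \<bullet>\<^sub>E f 0) \<le> norm (u r) * b"
      unfolding b_def
      by (rule order_trans[OF norm_cauchy_schwarz])
         (intro mult_left_mono order_trans[OF norm_endo_apply] mult_right_mono exp_noise_bounds r norm_ge_zero)
    moreover have "norm (u r) * b \<le> \<kappa> * (norm (u r))\<^sup>2 + b\<^sup>2 / (4 * \<kappa>)"
    proof -
      have "0 \<le> (2 * \<kappa> * norm (u r) - b)\<^sup>2 / (4 * \<kappa>)" using \<kappa> by simp
      also have "\<dots> = \<kappa> * (norm (u r))\<^sup>2 + b\<^sup>2 / (4 * \<kappa>) - norm (u r) * b"
        using \<kappa> by (simp add: power2_eq_square field_simps)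
      finally show ?thesis by simp
    qed
    ultimately show "u r \<bullet> ?d \<le> - 0 * (norm (u r))\<^sup>2 + b\<^sup>2 / (4 * \<kappa>)"
      by (simp add: inner_diff_right)
  qed (use \<kappa> T in auto)
  also have "\<dots> = (norm x0)\<^sup>2 + (b * sqrt (T / (2 * \<kappa>)))\<^sup>2"
    using X(1) T \<kappa> by (simp add: power_mult_distrib real_sqrt_pow2)
  also have "\<dots> \<le> (norm x0 + b * sqrt (T / (2 * \<kappa>)))\<^sup>2"
    using T \<kappa> by (simp add: power2_sum b_def)
  finally have *: "norm (u T) \<le> norm x0 + b * sqrt (T / (2 * \<kappa>))"
    by (rule power2_le_imp_le) (use T \<kappa> in \<open>simp add: b_def\<close>)
  have "norm (x T) \<le> norm (exp_noise T) * norm (u T)"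
    unfolding X(2) by (rule norm_endo_apply)
  also have "\<dots> \<le> exp c * (norm x0 + b * sqrt (T / (2 * \<kappa>)))"
    by (intro mult_mono exp_noise_bounds *) (use T in auto)
  finally show ?thesis by (simp add: b_def)
qed

end

section \<open>Oscillation counts\<close>

text \<open>Admitting any sufficient number of pieces, and not just the least, makes concatenation
  additive in \<open>n\<close>. The length of a piece is limited as well, which keeps the growth
  over one piece bounded.\<close>

inductive osc_cover :: "(real \<Rightarrow> real) \<Rightarrow> real \<Rightarrow> real \<Rightarrow> nat \<Rightarrow> bool" for \<omega> where
  one: "a \<le> b \<Longrightarrow> b - a \<le> 1 \<Longrightarrow> (\<And>s t. s \<in> {a..b} \<Longrightarrow> t \<in> {a..b} \<Longrightarrow> \<bar>\<omega> s - \<omega> t\<bar> \<le> 1) \<Longrightarrow> osc_cover \<omega> a b 1"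
| snoc: "osc_cover \<omega> a b n \<Longrightarrow> osc_cover \<omega> b c 1 \<Longrightarrow> osc_cover \<omega> a c (Suc n)"

lemma osc_cover_le: "osc_cover \<omega> a b n \<Longrightarrow> a \<le> b"
  by (induction rule: osc_cover.induct) auto

lemma osc_cover_pos: "osc_cover \<omega> a b n \<Longrightarrow> n > 0"
  by (induction rule: osc_cover.induct) auto

lemma osc_cover_1D:
  assumes "osc_cover \<omega> a b 1"
  shows "b - a \<le> 1" "s \<in> {a..b} \<Longrightarrow> t \<in> {a..b} \<Longrightarrow> \<bar>\<omega> s - \<omega> t\<bar> \<le> 1"
  using assms by (cases rule: osc_cover.cases; use osc_cover_pos in fastforce)+

lemma osc_cover_append:
  "osc_cover \<omega> b c m \<Longrightarrow> osc_cover \<omega> a b n \<Longrightarrow> osc_cover \<omega> a c (n + m)"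
proof (induction arbitrary: n rule: osc_cover.induct)
  case (one b c)
  then show ?case using osc_cover.snoc[OF one(4) osc_cover.one[OF one(1-3)]] by simp
next
  case (snoc b c m d)
  then show ?case using osc_cover.snoc[of \<omega> a c "n + m" d] by simp
qed

text \<open>For passing from integer end points to arbitrary ones: the pieces before
  \<open>s\<close> are dropped and the one containing \<open>s\<close> is cut.\<close>

lemma osc_cover_sub_left:
  "osc_cover \<omega> a b n \<Longrightarrow> a \<le> s \<Longrightarrow> s \<le> b \<Longrightarrow> \<exists>m\<le>n. osc_cover \<omega> s b m"
proof (induction rule: osc_cover.induct)
  case (one a b)
  then have "osc_cover \<omega> s b 1" by (intro osc_cover.one) auto
  then show ?case by auto
next
  case (snoc a b n c)
  show ?case
  proof (cases "s \<le> b")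
    case True
    with snoc obtain m where "m \<le> n" "osc_cover \<omega> s b m" by auto
    then show ?thesis using osc_cover.snoc[OF _ snoc.hyps(2)] by (intro exI[of _ "Suc m"]) auto
  next
    case False
    then have "osc_cover \<omega> s c 1" using snoc.prems osc_cover_1D[OF snoc.hyps(2)] by (intro osc_cover.one) auto
    then show ?thesis by auto
  qed
qed

lemma osc_cover_sub_right:
  "osc_cover \<omega> a b n \<Longrightarrow> a \<le> t \<Longrightarrow> t \<le> b \<Longrightarrow> \<exists>m\<le>n. osc_cover \<omega> a t m"
proof (induction arbitrary: t rule: osc_cover.induct)
  case (one a b)
  then have "osc_cover \<omega> a t 1" by (intro osc_cover.one) auto
  then show ?case by auto
next
  case (snoc a b n c)
  show ?case
  proof (cases "t \<le> b")
    case True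
    with snoc obtain m where "m \<le> n" "osc_cover \<omega> a t m" by blast
    then show ?thesis by (intro exI[of _ m]) auto
  next
    case False
    then have "osc_cover \<omega> b t 1" using snoc.prems osc_cover_1D[OF snoc.hyps(2)] by (intro osc_cover.one) auto
    then show ?thesis using osc_cover.snoc[OF snoc.hyps(1)] by auto
  qed
qed

lemma osc_cover_shift:
  "osc_cover \<omega> a b n \<Longrightarrow> osc_cover (wiener_shift r \<omega>) (a - r) (b - r) n"
proof (induction rule: osc_cover.induct)
  case (one a b)
  show ?case using one(1,2) one(3)[of "r + _" "r + _"]
    by (intro osc_cover.one) (auto simp: wiener_shift_def)
qed (rule osc_cover.snoc)

text \<open>The error may grow, at any small rate \<open>e\<close>, with the distance of the
  interval from the origin. This is what a law of averages yields for intervals far away; it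
  survives shifts of \<omega>, and it later turns into temperedness of the equilibrium.\<close>

definition cover_rate :: "real \<Rightarrow> (real \<Rightarrow> real) \<Rightarrow> bool" where
  "cover_rate \<mu> \<omega> \<longleftrightarrow> (\<forall>e>0. \<exists>K. \<forall>s t. s \<le> t \<longrightarrow>
     (\<exists>n. osc_cover \<omega> s t n \<and> real n \<le> \<mu> * (t - s) + e * (\<bar>s\<bar> + \<bar>t\<bar>) + K))"

lemma cover_rate_shift:
  assumes "cover_rate \<mu> \<omega>"
  shows "cover_rate \<mu> (wiener_shift r \<omega>)"
  unfolding cover_rate_def
proof (intro allI impI)
  fix e :: real assume e: "e > 0"
  then obtain K where K: "\<And>s t. s \<le> t \<Longrightarrow>
     (\<exists>n. osc_cover \<omega> s t n \<and> real n \<le> \<mu> * (t - s) + e * (\<bar>s\<bar> + \<bar>t\<bar>) + K)"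
    using assms unfolding cover_rate_def by blast
  show "\<exists>K. \<forall>s t. s \<le> t \<longrightarrow>
     (\<exists>n. osc_cover (wiener_shift r \<omega>) s t n \<and> real n \<le> \<mu> * (t - s) + e * (\<bar>s\<bar> + \<bar>t\<bar>) + K)"
  \<comment> \<open>Each of the two moduli changes by at most \<open>\<bar>r\<bar>\<close>, a
    constant for fixed \<open>r\<close>.\<close>
  proof (intro exI[of _ "K + e * (2 * \<bar>r\<bar>)"] allI impI)
    fix s t :: real assume "s \<le> t"
    then obtain n where n: "osc_cover \<omega> (s + r) (t + r) n"
      "real n \<le> \<mu> * ((t + r) - (s + r)) + e * (\<bar>s + r\<bar> + \<bar>t + r\<bar>) + K"
      using K[of "s + r" "t + r"] by auto
    have "e * (\<bar>s + r\<bar> + \<bar>t + r\<bar>) \<le> e * (\<bar>s\<bar> + \<bar>t\<bar> + 2 * \<bar>r\<bar>)"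
      using e by (intro mult_left_mono) auto
    then show "\<exists>n. osc_cover (wiener_shift r \<omega>) s t n \<and>
        real n \<le> \<mu> * (t - s) + e * (\<bar>s\<bar> + \<bar>t\<bar>) + (K + e * (2 * \<bar>r\<bar>))"
      using osc_cover_shift[OF n(1), of r] n(2) by (intro exI[of _ n]) (auto simp: algebra_simps)
  qed
qed

lemma cover_rate_mono:
  assumes "cover_rate \<mu> \<omega>" "\<mu> \<le> \<mu>'"
  shows "cover_rate \<mu>' \<omega>"
  unfolding cover_rate_def
proof (intro allI impI)
  fix e :: real assume "e > 0"
  then obtain K where K: "\<And>s t. s \<le> t \<Longrightarrow>
     (\<exists>n. osc_cover \<omega> s t n \<and> real n \<le> \<mu> * (t - s) + e * (\<bar>s\<bar> + \<bar>t\<bar>) + K)"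
    using assms(1) unfolding cover_rate_def by blast
  show "\<exists>K. \<forall>s t. s \<le> t \<longrightarrow>
     (\<exists>n. osc_cover \<omega> s t n \<and> real n \<le> \<mu>' * (t - s) + e * (\<bar>s\<bar> + \<bar>t\<bar>) + K)"
  proof (intro exI[of _ K] allI impI)
    fix s t :: real assume st: "s \<le> t"
    have "\<mu> * (t - s) \<le> \<mu>' * (t - s)" using assms(2) st by (intro mult_right_mono) auto
    then show "\<exists>n. osc_cover \<omega> s t n \<and> real n \<le> \<mu>' * (t - s) + e * (\<bar>s\<bar> + \<bar>t\<bar>) + K"
      using K[OF st] by fastforce
  qed
qed

section \<open>Dyadic seminorms and chaining\<close>

definition dyadic_var :: "(real \<Rightarrow> real) \<Rightarrow> real \<Rightarrow> real \<Rightarrow> nat \<Rightarrow> real" where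
  "dyadic_var \<omega> a b l = (\<Sum>j<2^l. (\<omega> (a + (real j + 1) * ((b - a) / 2^l)) - \<omega> (a + real j * ((b - a) / 2^l)))\<^sup>2)"

text \<open>The dyadic form of the squared Sobolev-Slobodeckij seminorm of order \<open>(1 + \<gamma>) / 2\<close>.\<close>

definition sobolev :: "real \<Rightarrow> (real \<Rightarrow> real) \<Rightarrow> real \<Rightarrow> real \<Rightarrow> real" where
  "sobolev \<gamma> \<omega> a b = (\<Sum>l. 2 powr (\<gamma> * real l) * dyadic_var \<omega> a b l)"

lemma dyadic_var_nonneg: "dyadic_var \<omega> a b l \<ge> 0"
  unfolding dyadic_var_def by (intro sum_nonneg) auto

lemma dyadic_var_0: "dyadic_var \<omega> a b 0 = (\<omega> b - \<omega> a)\<^sup>2"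
  by (simp add: dyadic_var_def)

lemma dyadic_var_Suc:
  "dyadic_var \<omega> a b (Suc l) = dyadic_var \<omega> a ((a + b) / 2) l + dyadic_var \<omega> ((a + b) / 2) b l"
proof -
  define h where "h = (b - a) / 2 ^ Suc l"
  have h: "((a + b) / 2 - a) / 2 ^ l = h" "(b - (a + b) / 2) / 2 ^ l = h" "(b - a) / 2 ^ Suc l = h"
    by (simp_all add: h_def field_simps)
  define F where "F j = (\<omega> (a + (real j + 1) * h) - \<omega> (a + real j * h))\<^sup>2" for j
  have m: "(a + b) / 2 = a + 2 ^ l * h" by (simp add: h_def field_simps)
  have "{..<(2::nat) ^ Suc l} = {..<2 ^ l} \<union> {2 ^ l..<2 ^ l + 2 ^ l}" by auto
  then have "(\<Sum>j<2 ^ Suc l. F j) = (\<Sum>j<2 ^ l. F j) + (\<Sum>j\<in>{2 ^ l..<2 ^ l + 2 ^ l}. F j)"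
    by (simp add: sum.union_disjoint ivl_disj_int del: power_Suc)
  also have "(\<Sum>j\<in>{2 ^ l..<2 ^ l + 2 ^ l}. F j) = (\<Sum>j<2 ^ l. F (j + 2 ^ l))"
    using sum.shift_bounds_nat_ivl[of F 0 "2 ^ l" "2 ^ l"] by (simp add: atLeast0LessThan)
  also have "\<dots> = dyadic_var \<omega> ((a + b) / 2) b l"
    unfolding dyadic_var_def h F_def by (intro sum.cong refl) (simp add: m algebra_simps)
  also have "(\<Sum>j<2 ^ l. F j) = dyadic_var \<omega> a ((a + b) / 2) l"
    unfolding dyadic_var_def h F_def ..
  finally show ?thesis unfolding dyadic_var_def h F_def .
qed

context
  fixes \<omega> :: "real \<Rightarrow> real" and \<nu> \<gamma> :: real
  assumes hoelder: "locally_Hoelder \<nu> \<omega>" and cont: "continuous_on UNIV \<omega>"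
    and \<gamma>: "0 < \<gamma>" "\<gamma> < 2 * \<nu> - 1"
begin

text \<open>Level \<open>l\<close> consists of \<open>2 ^ l\<close> squared increments of order
  \<open>2 powr (- 2 * \<nu> * l)\<close>. With the weight, the terms are dominated by a geometric
  series of ratio \<open>2 powr (\<gamma> + 1 - 2 * \<nu>)\<close>, which is below 1.\<close>

lemma summable_sobolev:
  assumes "a \<le> b"
  shows "summable (\<lambda>l. 2 powr (\<gamma> * real l) * dyadic_var \<omega> a b l)"
proof -
  obtain K0 where K0: "\<forall>s\<in>{a..b}. \<forall>t\<in>{a..b}. \<bar>\<omega> s - \<omega> t\<bar> \<le> K0 * \<bar>s - t\<bar> powr \<nu>"
    using hoelder unfolding locally_Hoelder_def by blast
  define q where "q = 2 powr (\<gamma> + 1 - 2 * \<nu>)"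
  have q: "0 < q" "q < 1"
    using \<gamma> powr_less_mono[of "\<gamma> + 1 - 2 * \<nu>" 0 2] by (auto simp: q_def)
  have bound: "2 powr (\<gamma> * real l) * dyadic_var \<omega> a b l \<le> K0\<^sup>2 * (b - a) powr (2 * \<nu>) * q ^ l" for l
  proof -
    define h where "h = (b - a) / 2 ^ l"
    have h: "h \<ge> 0" using assms by (simp add: h_def)
    have "dyadic_var \<omega> a b l \<le> (\<Sum>j<(2::nat)^l. (K0 * h powr \<nu>)\<^sup>2)"
      unfolding dyadic_var_def h_def[symmetric]
    proof (rule sum_mono)
      fix j assume j: "j \<in> {..<(2::nat)^l}"
      then have "real j + 1 \<le> 2 ^ l"
        by (metis Suc_leI add.commute lessThan_iff of_nat_Suc of_nat_le_iff of_nat_numeral of_nat_power)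
      then have "(real j + 1) * h \<le> 2 ^ l * h" by (intro mult_right_mono h)
      then have le: "(real j + 1) * h \<le> b - a" by (simp add: h_def)
      have "real j * h \<le> (real j + 1) * h" by (intro mult_right_mono h) simp
      moreover have "0 \<le> real j * h" using h by simp
      ultimately have "a + (real j + 1) * h \<in> {a..b}" "a + real j * h \<in> {a..b}"
        using le by auto
      then have "\<bar>\<omega> (a + (real j + 1) * h) - \<omega> (a + real j * h)\<bar> \<le>
          K0 * \<bar>(a + (real j + 1) * h) - (a + real j * h)\<bar> powr \<nu>"
        using K0 by blast
      also have "(a + (real j + 1) * h) - (a + real j * h) = h" by (simp add: algebra_simps)
      finally have "\<bar>\<omega> (a + (real j + 1) * h) - \<omega> (a + real j * h)\<bar> \<le> K0 * h powr \<nu>" using h by simp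
      then show "(\<omega> (a + (real j + 1) * h) - \<omega> (a + real j * h))\<^sup>2 \<le> (K0 * h powr \<nu>)\<^sup>2"
        by (metis abs_ge_zero power2_abs power_mono)
    qed
    also have "\<dots> = 2 ^ l * K0\<^sup>2 * h powr (2 * \<nu>)"
      using h by (simp add: power_mult_distrib power2_eq_square powr_add[symmetric])
    also have "h powr (2 * \<nu>) = (b - a) powr (2 * \<nu>) / 2 powr (real l * (2 * \<nu>))"
      unfolding h_def using assms by (simp add: powr_divide powr_powr flip: powr_realpow)
    finally have "2 powr (\<gamma> * real l) * dyadic_var \<omega> a b l \<le>
       2 powr (\<gamma> * real l) * (2 ^ l * K0\<^sup>2 * ((b - a) powr (2 * \<nu>) / 2 powr (real l * (2 * \<nu>))))"
      by (intro mult_left_mono) auto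
    also have "\<dots> = K0\<^sup>2 * (b - a) powr (2 * \<nu>) * (2 powr (\<gamma> * real l) * 2 powr real l / 2 powr (real l * (2 * \<nu>)))"
      by (simp add: powr_realpow)
    also have "2 powr (\<gamma> * real l) * 2 powr real l / 2 powr (real l * (2 * \<nu>)) = q ^ l"
      using q by (simp add: q_def powr_powr flip: powr_add powr_diff powr_realpow)
        (simp add: algebra_simps)
    finally show ?thesis .
  qed
  show ?thesis
    by (rule summable_comparison_test'[where N=0, OF summable_mult[OF summable_geometric[of q]]])
       (use bound q dyadic_var_nonneg in auto)
qed

lemma sobolev_nonneg: "sobolev \<gamma> \<omega> a b \<ge> 0" if "a \<le> b"
  unfolding sobolev_def using summable_sobolev[OF that] by (intro suminf_nonneg) (auto simp: dyadic_var_nonneg)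

text \<open>By \<open>dyadic_var_Suc\<close> the positive levels of an interval are the levels of
  its halves moved up by one; moving the weight along gives the factor
  \<open>2 powr \<gamma>\<close>.\<close>

lemma sobolev_halves:
  assumes "a \<le> b"
  shows "sobolev \<gamma> \<omega> a b = (\<omega> b - \<omega> a)\<^sup>2 +
    2 powr \<gamma> * (sobolev \<gamma> \<omega> a ((a + b) / 2) + sobolev \<gamma> \<omega> ((a + b) / 2) b)"
proof -
  let ?m = "(a + b) / 2"
  have m: "a \<le> ?m" "?m \<le> b" using assms by auto
  note s = summable_sobolev[OF assms] summable_sobolev[OF m(1)] summable_sobolev[OF m(2)]
  have "sobolev \<gamma> \<omega> a b = (\<omega> b - \<omega> a)\<^sup>2 + (\<Sum>l. 2 powr (\<gamma> * real (Suc l)) * dyadic_var \<omega> a b (Suc l))"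
    unfolding sobolev_def using suminf_split_head[OF s(1)] by (simp add: dyadic_var_0)
  also have "(\<lambda>l. 2 powr (\<gamma> * real (Suc l)) * dyadic_var \<omega> a b (Suc l)) =
      (\<lambda>l. 2 powr \<gamma> * (2 powr (\<gamma> * real l) * dyadic_var \<omega> a ?m l + 2 powr (\<gamma> * real l) * dyadic_var \<omega> ?m b l))"
    by (simp add: dyadic_var_Suc powr_add algebra_simps)
  also have "suminf \<dots> = 2 powr \<gamma> * (sobolev \<gamma> \<omega> a ?m + sobolev \<gamma> \<omega> ?m b)"
    unfolding sobolev_def using s by (simp only: suminf_mult suminf_add summable_add)
  finally show ?thesis .
qed

lemma sobolev_halves_le:
  assumes "a \<le> b"
  shows "sobolev \<gamma> \<omega> a ((a + b) / 2) + sobolev \<gamma> \<omega> ((a + b) / 2) b \<le> 2 powr (- \<gamma>) * sobolev \<gamma> \<omega> a b"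
proof -
  have "2 powr (- \<gamma>) * sobolev \<gamma> \<omega> a b = 2 powr (- \<gamma>) * (\<omega> b - \<omega> a)\<^sup>2 +
    (sobolev \<gamma> \<omega> a ((a + b) / 2) + sobolev \<gamma> \<omega> ((a + b) / 2) b)"
    unfolding sobolev_halves[OF assms] by (simp add: distrib_left mult.assoc[symmetric] powr_add[symmetric])
  then show ?thesis by simp
qed

lemma sobolev_increment: "(\<omega> b - \<omega> a)\<^sup>2 \<le> sobolev \<gamma> \<omega> a b" if "a \<le> b"
  using sobolev_halves[OF that] sobolev_nonneg[of a "(a + b) / 2"] sobolev_nonneg[of "(a + b) / 2" b] that
  by auto

text \<open>Chaining: \<open>t\<close> is followed through nested halves, and the base point moves
  by one increment whenever \<open>t\<close> lies in the right half. Each level shrinks the root of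
  the seminorm by \<open>q\<close>; the constant \<open>c\<close> is the sum of the positive powers
  of \<open>q\<close>, whence \<open>(c + 1) * q = c\<close>. Continuity leads from dyadic points to
  \<open>t\<close>.\<close>

lemma sobolev_osc:
  defines "q \<equiv> 2 powr (- \<gamma> / 2)"
  defines "c \<equiv> q / (1 - q)"
  assumes "a \<le> b" "t \<in> {a..b}"
  shows "\<bar>\<omega> t - \<omega> a\<bar> \<le> c * sqrt (sobolev \<gamma> \<omega> a b)"
proof -
  have q: "0 < q" "q < 1"
    using \<gamma> powr_less_mono[of "- \<gamma> / 2" 0 2] by (auto simp: q_def)
  have q2: "sqrt (2 powr (- \<gamma>)) = q" by (simp add: q_def powr_half_sqrt[symmetric] powr_powr)
  have c: "c > 0" "(c + 1) * q = c" using q by (auto simp: c_def field_simps)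
  have approx: "\<exists>s\<in>{a..b}. \<bar>t - s\<bar> \<le> (b - a) / 2 ^ l \<and> \<bar>\<omega> s - \<omega> a\<bar> \<le> c * sqrt (sobolev \<gamma> \<omega> a b)"
    if "a \<le> b" "t \<in> {a..b}" for a b t l
    using that
  proof (induction l arbitrary: a b)
    case 0
    then show ?case using c sobolev_nonneg[of a b] by (intro bexI[of _ a]) auto
  next
    case (Suc l)
    define m where "m = (a + b) / 2"
    have m: "a \<le> m" "m \<le> b" "(m - a) / 2 ^ l = (b - a) / 2 ^ Suc l" "(b - m) / 2 ^ l = (b - a) / 2 ^ Suc l"
      using Suc.prems by (auto simp: m_def field_simps)
    have le: "sqrt (sobolev \<gamma> \<omega> a m) \<le> q * sqrt (sobolev \<gamma> \<omega> a b)" "sqrt (sobolev \<gamma> \<omega> m b) \<le> q * sqrt (sobolev \<gamma> \<omega> a b)"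
      unfolding q2[symmetric] real_sqrt_mult[symmetric]
      using sobolev_halves_le[OF Suc.prems(1)] sobolev_nonneg[OF m(1)] sobolev_nonneg[OF m(2)]
      by (auto simp: m_def intro!: real_sqrt_le_mono)
    have S: "0 \<le> q * sqrt (sobolev \<gamma> \<omega> a b)" using q sobolev_nonneg[OF Suc.prems(1)] by simp
    show ?case
    proof (cases "t \<le> m")
      case True
      then obtain s where s: "s \<in> {a..m}" "\<bar>t - s\<bar> \<le> (m - a) / 2 ^ l" "\<bar>\<omega> s - \<omega> a\<bar> \<le> c * sqrt (sobolev \<gamma> \<omega> a m)"
        using Suc.IH[of a m] Suc.prems m by auto
      have "c * sqrt (sobolev \<gamma> \<omega> a m) \<le> c * (q * sqrt (sobolev \<gamma> \<omega> a b))" using le c by (intro mult_left_mono) auto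
      also have "\<dots> \<le> (c + 1) * (q * sqrt (sobolev \<gamma> \<omega> a b))" using S by (intro mult_right_mono) auto
      also have "\<dots> = c * sqrt (sobolev \<gamma> \<omega> a b)" using c(2) by (simp only: mult.assoc[symmetric])
      finally show ?thesis using s m by (intro bexI[of _ s]) auto
    next
      case False
      then obtain s where s: "s \<in> {m..b}" "\<bar>t - s\<bar> \<le> (b - m) / 2 ^ l" "\<bar>\<omega> s - \<omega> m\<bar> \<le> c * sqrt (sobolev \<gamma> \<omega> m b)"
        using Suc.IH[of m b] Suc.prems m by auto
      have "\<bar>\<omega> m - \<omega> a\<bar> \<le> sqrt (sobolev \<gamma> \<omega> a m)"
        using sobolev_increment[OF m(1)] by (intro real_le_rsqrt) auto
      then have "\<bar>\<omega> s - \<omega> a\<bar> \<le> c * sqrt (sobolev \<gamma> \<omega> m b) + sqrt (sobolev \<gamma> \<omega> a m)" using s by linarith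
      also have "\<dots> \<le> c * (q * sqrt (sobolev \<gamma> \<omega> a b)) + q * sqrt (sobolev \<gamma> \<omega> a b)"
        using le c by (intro add_mono mult_left_mono) auto
      also have "\<dots> = (c + 1) * q * sqrt (sobolev \<gamma> \<omega> a b)" by (simp add: algebra_simps)
      finally show ?thesis using s m c(2) by (intro bexI[of _ s]) auto
    qed
  qed
  show ?thesis
  proof -
    obtain s where s: "\<And>l. s l \<in> {a..b}" "\<And>l. \<bar>t - s l\<bar> \<le> (b - a) / 2 ^ l"
      "\<And>l. \<bar>\<omega> (s l) - \<omega> a\<bar> \<le> c * sqrt (sobolev \<gamma> \<omega> a b)"
      using approx[OF assms(3,4)] by metis
    have "(\<lambda>l. (b - a) / 2 ^ l) \<longlonglongrightarrow> 0" by real_asymp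
    then have "(\<lambda>l. t - s l) \<longlonglongrightarrow> 0"
      by (rule Lim_null_comparison[rotated]) (use s(2) in auto)
    then have "s \<longlonglongrightarrow> t" using tendsto_diff[OF tendsto_const[of t], of "\<lambda>l. t - s l" 0 sequentially] by simp
    moreover have "isCont \<omega> t" using cont by (simp add: continuous_on_eq_continuous_at)
    ultimately have "(\<lambda>l. \<omega> (s l)) \<longlonglongrightarrow> \<omega> t" by (rule isCont_tendsto_compose[rotated])
    then have "(\<lambda>l. \<bar>\<omega> (s l) - \<omega> a\<bar>) \<longlonglongrightarrow> \<bar>\<omega> t - \<omega> a\<bar>" by (intro tendsto_intros)
    then show "\<bar>\<omega> t - \<omega> a\<bar> \<le> c * sqrt (sobolev \<gamma> \<omega> a b)"
      by (rule LIMSEQ_le_const2) (use s(3) in auto)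
  qed
qed

text \<open>Bisect until the local seminorm is below a threshold. The seminorms of the two halves add up
  to at most \<open>2 powr (- \<gamma>)\<close> times that of the whole, which pays for the additional piece.\<close>

lemma osc_cover_sobolev:
  defines "q \<equiv> 2 powr (- \<gamma> / 2)"
  defines "c \<equiv> q / (1 - q)"
  defines "K \<equiv> 4 * c\<^sup>2 / (1 - q\<^sup>2)"
  assumes "a \<le> b" "b - a \<le> 1"
  shows "\<exists>n. osc_cover \<omega> a b n \<and> real n \<le> 1 + K * sobolev \<gamma> \<omega> a b"
proof -
  have q: "0 < q" "q < 1"
    using \<gamma> powr_less_mono[of "- \<gamma> / 2" 0 2] by (auto simp: q_def)
  have q2: "2 powr (- \<gamma>) = q\<^sup>2" by (simp add: q_def power2_eq_square powr_add[symmetric])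
  have q2': "0 < q\<^sup>2" "q\<^sup>2 < 1" using q by (simp_all add: power_less_one_iff)
  have c: "c > 0" using q by (auto simp: c_def)
  have K: "K \<ge> 0" using c q2' by (simp add: K_def)
  \<comment> \<open>At this threshold the path stays within 1/2 of its value at \<open>a\<close>, so
    any two values differ by at most 1.\<close>
  have small: "\<exists>n. osc_cover \<omega> a b n \<and> real n \<le> 1 + K * sobolev \<gamma> \<omega> a b"
    if V: "sobolev \<gamma> \<omega> a b \<le> 1 / (4 * c\<^sup>2)" and ab: "a \<le> b" "b - a \<le> 1" for a b
  proof -
    have "c * sqrt (sobolev \<gamma> \<omega> a b) \<le> c * sqrt (1 / (4 * c\<^sup>2))"
      using V c by (intro mult_left_mono) auto
    also have "\<dots> = 1 / 2" using c by (simp add: real_sqrt_divide real_sqrt_mult)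
    finally have half: "c * sqrt (sobolev \<gamma> \<omega> a b) \<le> 1 / 2" .
    have near: "\<bar>\<omega> t - \<omega> a\<bar> \<le> 1 / 2" if "t \<in> {a..b}" for t
      using sobolev_osc[OF ab(1) that] half unfolding c_def q_def by linarith
    have "\<bar>\<omega> s - \<omega> t\<bar> \<le> 1" if "s \<in> {a..b}" "t \<in> {a..b}" for s t
      using near[OF that(1)] near[OF that(2)] by linarith
    then have "osc_cover \<omega> a b 1" using ab by (intro osc_cover.one) auto
    moreover have "0 \<le> K * sobolev \<gamma> \<omega> a b" using K sobolev_nonneg[OF ab(1)] by simp
    ultimately show ?thesis by (intro exI[of _ 1]) auto
  qed
  \<comment> \<open>Induction on a number \<open>m\<close> of bisections that suffices to bring
    every part below the threshold.\<close>
  have main: "\<exists>n. osc_cover \<omega> a b n \<and> real n \<le> 1 + K * sobolev \<gamma> \<omega> a b"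
    if "(q\<^sup>2) ^ m * sobolev \<gamma> \<omega> a b \<le> 1 / (4 * c\<^sup>2)" "a \<le> b" "b - a \<le> 1" for m a b
    using that
  proof (induction m arbitrary: a b)
    case (0 a b)
    then show ?case by (intro small) auto
  next
    case (Suc m)
    show ?case
    proof (cases "sobolev \<gamma> \<omega> a b \<le> 1 / (4 * c\<^sup>2)")
      case True
      then show ?thesis by (intro small Suc.prems)
    next
      case large: False
      let ?d = "(a + b) / 2"
      let ?V = "sobolev \<gamma> \<omega> a b" and ?V1 = "sobolev \<gamma> \<omega> a ?d" and ?V2 = "sobolev \<gamma> \<omega> ?d b"
      have d: "a \<le> ?d" "?d \<le> b" "?d - a \<le> 1" "b - ?d \<le> 1" using Suc.prems(2,3) by (simp_all add: field_simps)
      have halves: "?V1 + ?V2 \<le> q\<^sup>2 * ?V" using sobolev_halves_le[OF Suc.prems(2)] by (simp add: q2)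
      have pos: "?V1 \<ge> 0" "?V2 \<ge> 0" using sobolev_nonneg d by auto
      have "(q\<^sup>2) ^ m * (q\<^sup>2 * ?V) \<le> 1 / (4 * c\<^sup>2)" using Suc.prems(1) by (simp add: mult_ac)
      moreover have "?V1 \<le> q\<^sup>2 * ?V" "?V2 \<le> q\<^sup>2 * ?V" using halves pos by linarith+
      ultimately have "(q\<^sup>2) ^ m * ?V1 \<le> 1 / (4 * c\<^sup>2)" "(q\<^sup>2) ^ m * ?V2 \<le> 1 / (4 * c\<^sup>2)"
        by (meson mult_left_mono order_trans zero_le_power zero_le_power2)+
      then obtain n1 n2 where n: "osc_cover \<omega> a ?d n1" "real n1 \<le> 1 + K * ?V1"
        "osc_cover \<omega> ?d b n2" "real n2 \<le> 1 + K * ?V2"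
        using Suc.IH[of a ?d] Suc.IH[of ?d b] d by auto
      \<comment> \<open>Above the threshold, bisection removes at least the share
        \<open>1 - q\<^sup>2\<close> of the seminorm; \<open>K\<close> is chosen so that this is
        worth one piece.\<close>
      have "1 \<le> K * (1 - q\<^sup>2) * ?V"
      proof -
        have "4 * c\<^sup>2 * (1 / (4 * c\<^sup>2)) \<le> 4 * c\<^sup>2 * ?V" using large by (intro mult_left_mono) auto
        then show ?thesis using c q2' by (simp add: K_def)
      qed
      moreover have "K * (?V1 + ?V2) \<le> K * (q\<^sup>2 * ?V)" using halves K by (rule mult_left_mono)
      ultimately have "real (n1 + n2) \<le> 1 + K * ?V" using n by (simp add: algebra_simps)
      then show ?thesis using osc_cover_append[OF n(3,1)] by blast
    qed
  qed
  have "(\<lambda>m. (q\<^sup>2) ^ m * sobolev \<gamma> \<omega> a b) \<longlonglongrightarrow> 0"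
    using q2' by (intro tendsto_mult_left_zero LIMSEQ_power_zero) auto
  then have "\<forall>\<^sub>F m in sequentially. (q\<^sup>2) ^ m * sobolev \<gamma> \<omega> a b < 1 / (4 * c\<^sup>2)"
    using c by (intro order_tendstoD) auto
  then obtain m where "(q\<^sup>2) ^ m * sobolev \<gamma> \<omega> a b < 1 / (4 * c\<^sup>2)"
    by (auto dest: eventually_happens)
  from main[OF less_imp_le[OF this] assms(4,5)] show ?thesis .
qed

end

section \<open>Gaussian functionals of fractional Brownian motion\<close>

text \<open>Normality of the process enters only through these facts. The vanishing mean forces
  \<open>\<mu> = 0\<close> for both kinds of law, and for the point mass all moments in question are
  then 0.\<close>

lemma gaussian_moments:
  assumes "prob_space P" and X[measurable]: "X \<in> borel_measurable P"
    and g: "gaussian_law (distr P borel X)" and EX: "(\<integral>\<omega>. X \<omega> \<partial>P) = 0"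
  shows "integrable P (\<lambda>\<omega>. (X \<omega>)\<^sup>2)" "integrable P (\<lambda>\<omega>. (X \<omega>)^4)"
    "(\<integral>\<omega>. (X \<omega>)^4 \<partial>P) = 3 * (\<integral>\<omega>. (X \<omega>)\<^sup>2 \<partial>P)\<^sup>2"
proof -
  interpret prob_space P by fact
  have ex: "(\<integral>\<omega>. (X \<omega>)^k \<partial>P) = (\<integral>x. x^k \<partial>distr P borel X)" for k
    by (subst integral_distr) auto
  have ix: "integrable P (\<lambda>\<omega>. (X \<omega>)^k) \<longleftrightarrow> integrable (distr P borel X) (\<lambda>x. x^k)" for k
    by (subst integrable_distr_eq) auto
  have mean: "(\<integral>x. x \<partial>distr P borel X) = 0" using ex[of 1] EX by simp
  from g consider (point) \<mu> where "distr P borel X = return borel \<mu>"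
    | (normal) \<mu> \<sigma> where "\<sigma> > 0" "distr P borel X = density lborel (\<lambda>x. ennreal (normal_density \<mu> \<sigma> x))"
    unfolding gaussian_law_def by blast
  then have "integrable (distr P borel X) (\<lambda>x. x\<^sup>2) \<and> integrable (distr P borel X) (\<lambda>x. x^4) \<and>
     (\<integral>x. x^4 \<partial>distr P borel X) = 3 * (\<integral>x. x\<^sup>2 \<partial>distr P borel X)\<^sup>2"
  proof cases
    case point
    have "\<mu> = 0" using mean unfolding point by (subst (asm) integral_return) auto
    have "AE x in return borel \<mu>. x = 0" using \<open>\<mu> = 0\<close> by (subst AE_return) auto
    then have ae: "AE x in return borel \<mu>. x^Suc k = 0" for k by (auto elim: eventually_mono)
    have "integrable (return borel \<mu>) (\<lambda>x. x ^ Suc k)" for k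
      by (rule iffD2[OF integrable_cong_AE[OF _ _ ae]]) auto
    from this[of 1] this[of 3] show ?thesis unfolding point
      by (subst integral_return, simp, simp, simp)+ (simp add: \<open>\<mu> = 0\<close> numeral_eq_Suc)
  next
    case normal
    have "\<mu> = 0" using mean normal(1) unfolding normal(2)
      by (subst (asm) integral_density) (auto simp: integral_normal_moment_nz_1)
    have i: "integrable (density lborel (\<lambda>x. ennreal (normal_density 0 \<sigma> x))) (\<lambda>x. x^k)" for k
      using integrable_normal_moment[OF normal(1), of 0 k]
      by (subst integrable_density) auto
    have e: "(\<integral>x. x^(2*k) \<partial>density lborel (\<lambda>x. ennreal (normal_density 0 \<sigma> x))) = fact (2 * k) / ((2 / \<sigma>\<^sup>2)^k * fact k)" for k
      using integral_normal_moment_even[OF normal(1), of 0 k]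
      by (subst integral_density) auto
    show ?thesis unfolding normal(2) \<open>\<mu> = 0\<close> using i[of 2] i[of 4] e[of 1] e[of 2] normal(1)
      by (simp add: fact_numeral power2_eq_square field_simps power4_eq_xxxx)
  qed
  then show "integrable P (\<lambda>\<omega>. (X \<omega>)\<^sup>2)" "integrable P (\<lambda>\<omega>. (X \<omega>)^4)"
    "(\<integral>\<omega>. (X \<omega>)^4 \<partial>P) = 3 * (\<integral>\<omega>. (X \<omega>)\<^sup>2 \<partial>P)\<^sup>2"
    unfolding ex ix by auto
qed

text \<open>Convexity of the power on the closed half line; if one argument is 0, it amounts to
  \<open>2 \<le> 2 powr p\<close>. With \<open>p = 2 * H\<close> it is the reason why increments of
  fractional Brownian motion over a grid are nonnegatively correlated for
  \<open>H > 1/2\<close>.\<close>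

lemma midpoint_powr_le:
  fixes u v p :: real
  assumes "u \<ge> 0" "v \<ge> 0" "p \<ge> 1"
  shows "((u + v) / 2) powr p \<le> (u powr p + v powr p) / 2"
proof -
  have half: "(w / 2) powr p \<le> w powr p / 2" if "w \<ge> 0" for w :: real
  proof -
    have "(2::real) powr 1 \<le> 2 powr p" using assms by (intro powr_mono) auto
    then have "w powr p / 2 powr p \<le> w powr p / 2" by (intro divide_left_mono) auto
    then show ?thesis using that by (simp add: powr_divide)
  qed
  consider "u = 0" | "v = 0" | "u > 0" "v > 0" using assms by fastforce
  then show ?thesis
  proof cases
    case 3
    have "((1 - 1/2) *\<^sub>R u + (1/2) *\<^sub>R v) powr p \<le> (1 - 1/2) * u powr p + (1/2) * v powr p"
      using powr_convex[OF assms(3)] 3 by (intro convex_onD) auto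
    then show ?thesis by (simp add: field_simps)
  qed (use half assms in auto)
qed

section \<open>Evaluations on path space and their linear span\<close>

lemma topspace_C0_topology: "topspace C0_topology \<subseteq> C0_paths"
  unfolding C0_topology_def topology_generated_by_topspace by auto

lemma space_borel_C0: "space borel_C0 = C0_paths"
  unfolding borel_C0_def by (rule space_measure_of) (use openin_subset topspace_C0_topology in blast)

lemma sets_borel_C0_openin: "openin C0_topology U \<Longrightarrow> U \<in> sets borel_C0"
  unfolding borel_C0_def
  by (subst sets_measure_of) (use openin_subset topspace_C0_topology in blast, auto intro: sigma_sets.Basic)

lemma openin_C0_subbasic:
  assumes "compact K" "open U"
  shows "openin C0_topology {\<omega> \<in> C0_paths. \<omega> ` K \<subseteq> U}"
  unfolding C0_topology_def by (rule topology_generated_by_Basis) (use assms in blast)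

text \<open>The preimage of an open set under evaluation at \<open>t\<close> is a subbasic set, with
  \<open>{t}\<close> as the compact set.\<close>

lemma evaluation_measurable:
  assumes "sets P = sets borel_C0"
  shows "(\<lambda>\<omega>. \<omega> t) \<in> borel_measurable P"
proof (rule borel_measurableI)
  fix S :: "real set" assume "open S"
  have "(\<lambda>\<omega>. \<omega> t) -` S \<inter> space P = {\<omega> \<in> C0_paths. \<omega> ` {t} \<subseteq> S}"
    using sets_eq_imp_space_eq[OF assms] by (auto simp: space_borel_C0)
  then show "(\<lambda>\<omega>. \<omega> t) -` S \<inter> space P \<in> sets P"
    using sets_borel_C0_openin[OF openin_C0_subbasic[of "{t}" S]] \<open>open S\<close> assms by simp
qed

text \<open>The linear span of the evaluations, which is the class of variables that
  \<open>fbm_law\<close> declares Gaussian. Its closure under sums and differences makes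
  polarization possible.\<close>

definition path_functionals :: "((real \<Rightarrow> real) \<Rightarrow> real) set" where
  "path_functionals = {X. \<exists>T c. finite T \<and> X = (\<lambda>\<omega>. \<Sum>t\<in>T. c t * \<omega> t)}"

lemma path_functionals_add:
  assumes "X \<in> path_functionals" "Y \<in> path_functionals"
  shows "(\<lambda>\<omega>. X \<omega> + Y \<omega>) \<in> path_functionals"
proof -
  obtain S c T d where "finite S" "X = (\<lambda>\<omega>. \<Sum>t\<in>S. c t * \<omega> t)" "finite T" "Y = (\<lambda>\<omega>. \<Sum>t\<in>T. d t * \<omega> t)"
    using assms unfolding path_functionals_def by blast
  moreover have "(\<Sum>t\<in>S. c t * \<omega> t) + (\<Sum>t\<in>T. d t * \<omega> t) =
      (\<Sum>t\<in>S \<union> T. ((if t \<in> S then c t else 0) + (if t \<in> T then d t else 0)) * \<omega> t)"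
    if "finite S" "finite T" for \<omega>
  proof -
    have "(\<Sum>t\<in>S. c t * \<omega> t) = (\<Sum>t\<in>S \<union> T. (if t \<in> S then c t else 0) * \<omega> t)"
      using that by (intro sum.mono_neutral_cong_left) auto
    moreover have "(\<Sum>t\<in>T. d t * \<omega> t) = (\<Sum>t\<in>S \<union> T. (if t \<in> T then d t else 0) * \<omega> t)"
      using that by (intro sum.mono_neutral_cong_left) auto
    ultimately show ?thesis by (simp add: distrib_right sum.distrib)
  qed
  ultimately show ?thesis unfolding path_functionals_def
    by (intro CollectI exI[of _ "S \<union> T"] exI[of _ "\<lambda>t. (if t \<in> S then c t else 0) + (if t \<in> T then d t else 0)"]) auto
qed

lemma path_functionals_scale:
  assumes "X \<in> path_functionals"
  shows "(\<lambda>\<omega>. k * X \<omega>) \<in> path_functionals"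
proof -
  obtain S c where "finite S" "X = (\<lambda>\<omega>. \<Sum>t\<in>S. c t * \<omega> t)"
    using assms unfolding path_functionals_def by blast
  then show ?thesis unfolding path_functionals_def
    by (intro CollectI exI[of _ S] exI[of _ "\<lambda>t. k * c t"]) (auto simp: sum_distrib_left mult.assoc)
qed

lemma path_functionals_diff:
  assumes "X \<in> path_functionals" "Y \<in> path_functionals"
  shows "(\<lambda>\<omega>. X \<omega> - Y \<omega>) \<in> path_functionals"
  using path_functionals_add[OF assms(1) path_functionals_scale[OF assms(2), of "-1"]] by simp

lemma path_functionals_eval: "(\<lambda>\<omega>. \<omega> t) \<in> path_functionals"
  unfolding path_functionals_def by (intro CollectI exI[of _ "{t}"] exI[of _ "\<lambda>_. 1"]) auto

locale fbm =
  fixes H :: real and P :: "(real \<Rightarrow> real) measure"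
  assumes H: "1/2 < H" "H < 1" and law: "fbm_law H P"
begin

sublocale prob_space P using law unfolding fbm_law_def by blast

lemma eval_measurable [measurable]: "(\<lambda>\<omega>. \<omega> t) \<in> borel_measurable P"
proof (rule evaluation_measurable)
  show "sets P = sets borel_C0" using law unfolding fbm_law_def by blast
qed

lemma functional_measurable: "X \<in> path_functionals \<Longrightarrow> X \<in> borel_measurable P"
  unfolding path_functionals_def by (elim CollectE exE conjE) simp

lemma functional_gaussian: "X \<in> path_functionals \<Longrightarrow> gaussian_law (distr P borel X)"
  using law unfolding path_functionals_def fbm_law_def by blast

lemma eval_mean: "(\<integral>\<omega>. \<omega> t \<partial>P) = 0"
  using law unfolding fbm_law_def by blast

lemma eval_square_integrable: "integrable P (\<lambda>\<omega>. (\<omega> t)\<^sup>2)"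
  by (rule gaussian_moments(1)[OF prob_space_axioms eval_measurable functional_gaussian[OF path_functionals_eval]
        eval_mean])

lemma functional_mean: "X \<in> path_functionals \<Longrightarrow> (\<integral>\<omega>. X \<omega> \<partial>P) = 0"
proof -
  assume "X \<in> path_functionals"
  then obtain T c where X: "finite T" "X = (\<lambda>\<omega>. \<Sum>t\<in>T. c t * \<omega> t)" unfolding path_functionals_def by blast
  have "integrable P (\<lambda>\<omega>. c t * \<omega> t)" for t
    by (rule integrable_mult_right) (rule square_integrable_imp_integrable[OF eval_measurable eval_square_integrable])
  then show ?thesis unfolding X by (simp add: Bochner_Integration.integral_sum eval_mean)
qed

lemma functional_moments:
  assumes "X \<in> path_functionals"
  shows "integrable P (\<lambda>\<omega>. (X \<omega>)\<^sup>2)" "integrable P (\<lambda>\<omega>. (X \<omega>)^4)"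
    "(\<integral>\<omega>. (X \<omega>)^4 \<partial>P) = 3 * (\<integral>\<omega>. (X \<omega>)\<^sup>2 \<partial>P)\<^sup>2"
  using gaussian_moments[OF prob_space_axioms functional_measurable[OF assms] functional_gaussian[OF assms]
      functional_mean[OF assms]] by auto

lemma functional_mult_integrable:
  assumes "X \<in> path_functionals" "Y \<in> path_functionals"
  shows "integrable P (\<lambda>\<omega>. X \<omega> * Y \<omega>)"
proof -
  have eq: "X \<omega> * Y \<omega> = ((X \<omega> + Y \<omega>)\<^sup>2 - (X \<omega>)\<^sup>2 - (Y \<omega>)\<^sup>2) / 2" for \<omega>
    by (simp add: power2_eq_square algebra_simps)
  show ?thesis
    unfolding eq using functional_moments(1)[OF path_functionals_add[OF assms]] functional_moments(1)[OF assms(1)]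
      functional_moments(1)[OF assms(2)] by simp
qed

text \<open>The fourth mixed moments follow from those of \<open>X + Y\<close> and \<open>X - Y\<close> by polarization.\<close>

lemma functional_square_mult:
  assumes X: "X \<in> path_functionals" and Y: "Y \<in> path_functionals"
  shows "integrable P (\<lambda>\<omega>. (X \<omega>)\<^sup>2 * (Y \<omega>)\<^sup>2)"
    "(\<integral>\<omega>. (X \<omega>)\<^sup>2 * (Y \<omega>)\<^sup>2 \<partial>P) =
       (\<integral>\<omega>. (X \<omega>)\<^sup>2 \<partial>P) * (\<integral>\<omega>. (Y \<omega>)\<^sup>2 \<partial>P) + 2 * (\<integral>\<omega>. X \<omega> * Y \<omega> \<partial>P)\<^sup>2"
proof -
  note XY = path_functionals_add[OF X Y] path_functionals_diff[OF X Y]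
  note i4 = functional_moments(2)[OF X] functional_moments(2)[OF Y] functional_moments(2)[OF XY(1)] functional_moments(2)[OF XY(2)]
  note i2 = functional_moments(1)[OF X] functional_moments(1)[OF Y] functional_mult_integrable[OF X Y]
  have eq: "(X \<omega>)\<^sup>2 * (Y \<omega>)\<^sup>2 = ((X \<omega> + Y \<omega>)^4 + (X \<omega> - Y \<omega>)^4 - 2 * (X \<omega>)^4 - 2 * (Y \<omega>)^4) / 12" for \<omega>
    by (simp add: power2_eq_square power4_eq_xxxx algebra_simps)
  show "integrable P (\<lambda>\<omega>. (X \<omega>)\<^sup>2 * (Y \<omega>)\<^sup>2)" unfolding eq using i4 by simp
  have s: "(\<integral>\<omega>. (X \<omega> + Y \<omega>)\<^sup>2 \<partial>P) = (\<integral>\<omega>. (X \<omega>)\<^sup>2 \<partial>P) + 2 * (\<integral>\<omega>. X \<omega> * Y \<omega> \<partial>P) + (\<integral>\<omega>. (Y \<omega>)\<^sup>2 \<partial>P)"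
    unfolding power2_sum using i2 by (simp add: mult.assoc)
  have d: "(\<integral>\<omega>. (X \<omega> - Y \<omega>)\<^sup>2 \<partial>P) = (\<integral>\<omega>. (X \<omega>)\<^sup>2 \<partial>P) - 2 * (\<integral>\<omega>. X \<omega> * Y \<omega> \<partial>P) + (\<integral>\<omega>. (Y \<omega>)\<^sup>2 \<partial>P)"
    unfolding power2_diff using i2 by (simp add: mult.assoc)
  have "(\<integral>\<omega>. (X \<omega>)\<^sup>2 * (Y \<omega>)\<^sup>2 \<partial>P) = ((\<integral>\<omega>. (X \<omega> + Y \<omega>)^4 \<partial>P) + (\<integral>\<omega>. (X \<omega> - Y \<omega>)^4 \<partial>P)
      - 2 * (\<integral>\<omega>. (X \<omega>)^4 \<partial>P) - 2 * (\<integral>\<omega>. (Y \<omega>)^4 \<partial>P)) / 12"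
    unfolding eq using i4 by simp
  then show "(\<integral>\<omega>. (X \<omega>)\<^sup>2 * (Y \<omega>)\<^sup>2 \<partial>P) =
       (\<integral>\<omega>. (X \<omega>)\<^sup>2 \<partial>P) * (\<integral>\<omega>. (Y \<omega>)\<^sup>2 \<partial>P) + 2 * (\<integral>\<omega>. X \<omega> * Y \<omega> \<partial>P)\<^sup>2"
    unfolding functional_moments(3)[OF X] functional_moments(3)[OF Y] functional_moments(3)[OF XY(1)]
      functional_moments(3)[OF XY(2)] s d by (simp add: power2_eq_square algebra_simps)
qed

text \<open>As \<open>0 \<le> cov \<le> v\<close>, the sum of the squared covariances, which is half the second moment of the
  fluctuation, is at most \<open>v\<close> times the variance of the sum. For increments of fractional Brownian
  motion the latter is explicit, so that no decay of correlations has to be estimated.\<close>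

lemma square_fluctuation:
  fixes Y :: "'i \<Rightarrow> (real \<Rightarrow> real) \<Rightarrow> real"
  assumes I: "finite I" and Y: "\<And>i. i \<in> I \<Longrightarrow> Y i \<in> path_functionals"
    and var: "\<And>i. i \<in> I \<Longrightarrow> (\<integral>\<omega>. (Y i \<omega>)\<^sup>2 \<partial>P) = v"
    and cov: "\<And>i j. i \<in> I \<Longrightarrow> j \<in> I \<Longrightarrow> (\<integral>\<omega>. Y i \<omega> * Y j \<omega> \<partial>P) \<ge> 0"
  shows "integrable P (\<lambda>\<omega>. (\<Sum>i\<in>I. (Y i \<omega>)\<^sup>2 - v)\<^sup>2)"
    "(\<integral>\<omega>. (\<Sum>i\<in>I. (Y i \<omega>)\<^sup>2 - v)\<^sup>2 \<partial>P) \<le> 2 * v * (\<integral>\<omega>. (\<Sum>i\<in>I. Y i \<omega>)\<^sup>2 \<partial>P)"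
proof -
  define r where "r i j = (\<integral>\<omega>. Y i \<omega> * Y j \<omega> \<partial>P)" for i j
  have i2: "integrable P (\<lambda>\<omega>. (Y i \<omega>)\<^sup>2)" if "i \<in> I" for i using functional_moments(1)[OF Y[OF that]] .
  have i11: "integrable P (\<lambda>\<omega>. Y i \<omega> * Y j \<omega>)" if "i \<in> I" "j \<in> I" for i j
    using functional_mult_integrable[OF Y[OF that(1)] Y[OF that(2)]] .
  note sq = functional_square_mult[OF Y Y]
  have prod: "((Y i \<omega>)\<^sup>2 - v) * ((Y j \<omega>)\<^sup>2 - v) = (Y i \<omega>)\<^sup>2 * (Y j \<omega>)\<^sup>2 - v * (Y i \<omega>)\<^sup>2 - v * (Y j \<omega>)\<^sup>2 + v * v" for i j \<omega>
    by (simp add: algebra_simps)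
  have ip: "integrable P (\<lambda>\<omega>. ((Y i \<omega>)\<^sup>2 - v) * ((Y j \<omega>)\<^sup>2 - v))" if "i \<in> I" "j \<in> I" for i j
    unfolding prod using i2 sq(1) that by simp
  have ep: "(\<integral>\<omega>. ((Y i \<omega>)\<^sup>2 - v) * ((Y j \<omega>)\<^sup>2 - v) \<partial>P) = 2 * (r i j)\<^sup>2" if "i \<in> I" "j \<in> I" for i j
    unfolding prod using i2 sq that var by (simp add: r_def prob_space)
  have expand: "(\<Sum>i\<in>I. (Y i \<omega>)\<^sup>2 - v)\<^sup>2 = (\<Sum>i\<in>I. \<Sum>j\<in>I. ((Y i \<omega>)\<^sup>2 - v) * ((Y j \<omega>)\<^sup>2 - v))" for \<omega>
    by (simp add: power2_eq_square sum_product)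
  have expand': "(\<Sum>i\<in>I. Y i \<omega>)\<^sup>2 = (\<Sum>i\<in>I. \<Sum>j\<in>I. Y i \<omega> * Y j \<omega>)" for \<omega>
    by (simp add: power2_eq_square sum_product)
  show "integrable P (\<lambda>\<omega>. (\<Sum>i\<in>I. (Y i \<omega>)\<^sup>2 - v)\<^sup>2)"
    unfolding expand by (intro Bochner_Integration.integrable_sum ip)
  have rv: "r i j \<le> v" if "i \<in> I" "j \<in> I" for i j
  proof -
    have "0 \<le> (\<integral>\<omega>. (Y i \<omega> - Y j \<omega>)\<^sup>2 \<partial>P)" by simp
    also have "\<dots> = v + v - 2 * r i j"
      unfolding power2_diff using i2 i11 that var by (simp add: r_def mult.assoc)
    finally show ?thesis by simp
  qed
  have "(\<integral>\<omega>. (\<Sum>i\<in>I. (Y i \<omega>)\<^sup>2 - v)\<^sup>2 \<partial>P) = (\<Sum>i\<in>I. \<Sum>j\<in>I. 2 * (r i j)\<^sup>2)"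
    unfolding expand using ip ep by (simp add: Bochner_Integration.integral_sum)
  also have "\<dots> \<le> (\<Sum>i\<in>I. \<Sum>j\<in>I. 2 * (v * r i j))"
    unfolding power2_eq_square using cov rv by (intro sum_mono mult_left_mono mult_right_mono) (auto simp: r_def)
  also have "\<dots> = 2 * v * (\<Sum>i\<in>I. \<Sum>j\<in>I. r i j)"
    by (simp add: sum_distrib_left mult.assoc)
  also have "(\<Sum>i\<in>I. \<Sum>j\<in>I. r i j) = (\<integral>\<omega>. (\<Sum>i\<in>I. Y i \<omega>)\<^sup>2 \<partial>P)"
    unfolding expand' r_def using i11 by (simp add: Bochner_Integration.integral_sum)
  finally show "(\<integral>\<omega>. (\<Sum>i\<in>I. (Y i \<omega>)\<^sup>2 - v)\<^sup>2 \<partial>P) \<le> 2 * v * (\<integral>\<omega>. (\<Sum>i\<in>I. Y i \<omega>)\<^sup>2 \<partial>P)" .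
qed

text \<open>The terms of \<open>fbm_cov\<close> in a single time cancel and only differences of
  times remain, which expresses that the increments are stationary.\<close>

lemma increment_covariance:
  "(\<integral>\<omega>. (\<omega> s' - \<omega> s) * (\<omega> t' - \<omega> t) \<partial>P) =
    (\<bar>t' - s\<bar> powr (2 * H) + \<bar>t - s'\<bar> powr (2 * H) - \<bar>t' - s'\<bar> powr (2 * H) - \<bar>t - s\<bar> powr (2 * H)) / 2"
proof -
  have i: "integrable P (\<lambda>\<omega>. \<omega> s * \<omega> t)" for s t
    using functional_mult_integrable[OF path_functionals_eval path_functionals_eval] .
  have e: "(\<integral>\<omega>. \<omega> s * \<omega> t \<partial>P) = fbm_cov H s t" for s t using law unfolding fbm_law_def by blast
  have "(\<omega> s' - \<omega> s) * (\<omega> t' - \<omega> t) = \<omega> s' * \<omega> t' - \<omega> s' * \<omega> t - \<omega> s * \<omega> t' + \<omega> s * \<omega> t" for \<omega> :: "real \<Rightarrow> real"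
    by (simp add: algebra_simps)
  then show ?thesis using i by (simp add: e fbm_cov_def field_simps)
qed

lemma increment_functional: "(\<lambda>\<omega>. \<omega> t - \<omega> s) \<in> path_functionals"
  by (intro path_functionals_diff path_functionals_eval)

text \<open>The covariance of two increments is half the second difference of
  \<open>\<bar>d\<bar> powr (2 * H)\<close> at their distance \<open>d\<close>, hence nonnegative by
  convexity. The increments telescope, so the variance of their sum is that of one increment over
  the length \<open>m * h\<close>.\<close>

lemma grid_increments_fluctuation:
  fixes a h :: real
  assumes h: "h \<ge> 0"
  defines "Y \<equiv> \<lambda>i \<omega>. \<omega> (a + (real i + 1) * h) - \<omega> (a + real i * h)"
  shows "integrable P (\<lambda>\<omega>. (\<Sum>i<m. (Y i \<omega>)\<^sup>2 - h powr (2 * H))\<^sup>2)"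
    "(\<integral>\<omega>. (\<Sum>i<m. (Y i \<omega>)\<^sup>2 - h powr (2 * H))\<^sup>2 \<partial>P) \<le> 2 * h powr (2 * H) * (real m * h) powr (2 * H)"
proof -
  have Y: "Y i \<in> path_functionals" for i unfolding Y_def by (rule increment_functional)
  have var: "(\<integral>\<omega>. (Y i \<omega>)\<^sup>2 \<partial>P) = h powr (2 * H)" for i
    unfolding power2_eq_square Y_def increment_covariance using h by (simp add: algebra_simps)
  have cov: "(\<integral>\<omega>. Y i \<omega> * Y j \<omega> \<partial>P) \<ge> 0" for i j
  proof -
    define d where "d = (real j - real i) * h"
    have "\<bar>d\<bar> powr (2 * H) \<le> ((\<bar>d + h\<bar> + \<bar>d - h\<bar>) / 2) powr (2 * H)"
      using H by (intro powr_mono2) auto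
    also have "\<dots> \<le> (\<bar>d + h\<bar> powr (2 * H) + \<bar>d - h\<bar> powr (2 * H)) / 2"
      using H by (intro midpoint_powr_le) auto
    finally show ?thesis
      unfolding Y_def increment_covariance by (simp add: d_def algebra_simps)
  qed
  note F = square_fluctuation[of "{..<m}" Y "h powr (2 * H)", OF finite_lessThan Y var cov]
  show "integrable P (\<lambda>\<omega>. (\<Sum>i<m. (Y i \<omega>)\<^sup>2 - h powr (2 * H))\<^sup>2)" by (rule F(1))
  have "(\<Sum>i<m. Y i \<omega>) = \<omega> (a + real m * h) - \<omega> a" for \<omega>
    using sum_lessThan_telescope[of "\<lambda>i. \<omega> (a + real i * h)" m] by (simp add: Y_def add.commute)
  then have "(\<integral>\<omega>. (\<Sum>i<m. Y i \<omega>)\<^sup>2 \<partial>P) = (real m * h) powr (2 * H)"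
    unfolding power2_eq_square increment_covariance using h by (simp add: increment_covariance)
  with F(2) show "(\<integral>\<omega>. (\<Sum>i<m. (Y i \<omega>)\<^sup>2 - h powr (2 * H))\<^sup>2 \<partial>P) \<le> 2 * h powr (2 * H) * (real m * h) powr (2 * H)"
    by simp
qed

end

section \<open>Almost sure growth of the oscillation count\<close>

context fbm begin

lemma dyadic_var_measurable [measurable]: "(\<lambda>\<omega>. dyadic_var \<omega> a b l) \<in> borel_measurable P"
  unfolding dyadic_var_def by measurable

lemma sobolev_measurable [measurable]: "(\<lambda>\<omega>. sobolev \<gamma> \<omega> a b) \<in> borel_measurable P"
  unfolding sobolev_def by measurable

text \<open>The expectation of \<open>sobolev \<gamma>\<close> over a unit interval: level
  \<open>l\<close> has \<open>2 ^ l\<close> increments of variance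
  \<open>2 powr (- 2 * H * l)\<close>, weighted by \<open>2 powr (\<gamma> * l)\<close>.\<close>

definition sobolev_mean :: "real \<Rightarrow> real" where
  "sobolev_mean \<gamma> = (\<Sum>l. 2 powr ((\<gamma> + 1 - 2 * H) * real l))"

lemma summable_sobolev_mean:
  assumes "\<gamma> < 2 * H - 1"
  shows "summable (\<lambda>l. 2 powr ((\<gamma> + 1 - 2 * H) * real l))"
proof -
  have "2 powr ((\<gamma> + 1 - 2 * H) * real l) = (2 powr (\<gamma> + 1 - 2 * H)) ^ l" for l
    by (simp add: powr_powr flip: powr_realpow)
  moreover have "2 powr (\<gamma> + 1 - 2 * H) < 1"
    using assms powr_less_mono[of "\<gamma> + 1 - 2 * H" 0 2] by simp
  ultimately show ?thesis by (simp add: summable_geometric)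
qed

text \<open>The subtracted term is the mean, as there are \<open>n * 2 ^ l\<close> increments of
  variance \<open>2 powr (- 2 * H * l)\<close>.\<close>

definition level_fluctuation :: "real \<Rightarrow> nat \<Rightarrow> nat \<Rightarrow> (real \<Rightarrow> real) \<Rightarrow> real" where
  "level_fluctuation a n l \<omega> =
     (\<Sum>k<n. dyadic_var \<omega> (a + real k) (a + real k + 1) l) - real n * 2 powr ((1 - 2 * H) * real l)"

lemma level_fluctuation_measurable [measurable]: "level_fluctuation a n l \<in> borel_measurable P"
  unfolding level_fluctuation_def by measurable

text \<open>Consecutive unit intervals at level \<open>l\<close> form one uniform grid, to which
  \<open>grid_increments_fluctuation\<close> applies. The bound is a product of decay in
  \<open>l\<close> and growth in \<open>n\<close>, so the levels can be summed separately.\<close>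

lemma level_fluctuation_second_moment:
  "(\<integral>\<^sup>+\<omega>. ennreal ((level_fluctuation a n l \<omega>)\<^sup>2) \<partial>P) \<le> ennreal (2 * 2 powr (- 2 * H * real l) * real n powr (2 * H))"
proof -
  define h :: real where "h = 1 / 2 ^ l"
  have h: "h \<ge> 0" by (simp add: h_def)
  define Y where "Y i \<omega> = \<omega> (a + (real i + 1) * h) - \<omega> (a + real i * h)" for i :: nat and \<omega> :: "real \<Rightarrow> real"
  have hl: "h = 2 powr (- real l)" by (simp add: h_def powr_minus_divide powr_realpow)
  have h2H: "h powr (2 * H) = 2 powr (- 2 * H * real l)" unfolding hl powr_powr by (simp add: mult_ac)
  have "level_fluctuation a n l \<omega> = (\<Sum>i<n * 2 ^ l. (Y i \<omega>)\<^sup>2 - h powr (2 * H))" for \<omega>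
  proof -
    have "(\<Sum>k<n. dyadic_var \<omega> (a + real k) (a + real k + 1) l) = (\<Sum>k<n. sum (\<lambda>i. (Y i \<omega>)\<^sup>2) {k * 2 ^ l..<k * 2 ^ l + 2 ^ l})"
    proof (rule sum.cong[OF refl])
      fix k
      have one: "h * 2 ^ l = 1" by (simp add: h_def)
      have "sum (\<lambda>i. (Y i \<omega>)\<^sup>2) {k * 2 ^ l..<k * 2 ^ l + 2 ^ l} = (\<Sum>j<2 ^ l. (Y (j + k * 2 ^ l) \<omega>)\<^sup>2)"
        using sum.shift_bounds_nat_ivl[of "\<lambda>i. (Y i \<omega>)\<^sup>2" 0 "k * 2 ^ l" "2 ^ l"]
        by (simp add: atLeast0LessThan add.commute)
      also have "\<dots> = dyadic_var \<omega> (a + real k) (a + real k + 1) l"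
      proof -
        have e: "(real j + real k * 2 ^ l) * h = real k + real j * h" for j
          using one by (simp add: algebra_simps)
        have e': "(real j + (real k * 2 ^ l + 1)) * h = real k + (real j + 1) * h" for j
          using e[of j] by (simp add: algebra_simps)
        show ?thesis unfolding dyadic_var_def Y_def
          by (intro sum.cong refl) (simp add: e e' h_def[symmetric] add.assoc)
      qed
      finally show "dyadic_var \<omega> (a + real k) (a + real k + 1) l = sum (\<lambda>i. (Y i \<omega>)\<^sup>2) {k * 2 ^ l..<k * 2 ^ l + 2 ^ l}" ..
    qed
    also have "\<dots> = (\<Sum>i<n * 2 ^ l. (Y i \<omega>)\<^sup>2)" by (rule sum.nat_group)
    finally have "(\<Sum>k<n. dyadic_var \<omega> (a + real k) (a + real k + 1) l) = (\<Sum>i<n * 2 ^ l. (Y i \<omega>)\<^sup>2)" .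
    moreover have "real n * 2 powr ((1 - 2 * H) * real l) = real (n * 2 ^ l) * h powr (2 * H)"
      unfolding h2H by (simp add: powr_realpow[symmetric] powr_add[symmetric] algebra_simps)
    ultimately show ?thesis unfolding level_fluctuation_def by (simp add: sum_subtractf)
  qed
  moreover have nh: "real (n * 2 ^ l) * h = real n" by (simp add: h_def)
  moreover note grid_increments_fluctuation[where m = "n * 2 ^ l" and a = a, OF h, folded Y_def, unfolded nh h2H]
  ultimately show ?thesis
    by (simp add: nn_integral_eq_integral h2H)
qed

end

text \<open>The weighted Cauchy-Schwarz inequality for partial sums, followed by a limit. The last
  series has values in \<open>ennreal\<close> so that it can be integrated before its finiteness is
  known.\<close>

lemma suminf_square_le:
  fixes z :: "nat \<Rightarrow> real"
  assumes z: "summable z" and w: "summable w" "\<And>l. w l > 0"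
  shows "ennreal ((\<Sum>l. z l)\<^sup>2) \<le> ennreal (\<Sum>l. w l) * (\<Sum>l. ennreal ((z l)\<^sup>2 / w l))"
proof (rule LIMSEQ_le_const2)
  show "(\<lambda>N. ennreal ((\<Sum>l<N. z l)\<^sup>2)) \<longlonglongrightarrow> ennreal ((\<Sum>l. z l)\<^sup>2)"
    by (intro tendsto_ennrealI tendsto_power summable_LIMSEQ z)
  show "\<exists>N0. \<forall>N\<ge>N0. ennreal ((\<Sum>l<N. z l)\<^sup>2) \<le> ennreal (\<Sum>l. w l) * (\<Sum>l. ennreal ((z l)\<^sup>2 / w l))"
  proof (intro exI allI impI)
    fix N
    have "(\<Sum>l<N. z l) = (\<Sum>l<N. sqrt (w l) * (z l / sqrt (w l)))"
      using w(2) by (intro sum.cong) (auto simp: less_imp_neq[symmetric])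
    also have "\<dots>\<^sup>2 \<le> (\<Sum>l<N. (sqrt (w l))\<^sup>2) * (\<Sum>l<N. (z l / sqrt (w l))\<^sup>2)"
      by (rule Cauchy_Schwarz_ineq_sum)
    also have "\<dots> = (\<Sum>l<N. w l) * (\<Sum>l<N. (z l)\<^sup>2 / w l)"
      using w(2) by (simp add: power_divide less_imp_le)
    finally have "ennreal ((\<Sum>l<N. z l)\<^sup>2) \<le> ennreal ((\<Sum>l<N. w l) * (\<Sum>l<N. (z l)\<^sup>2 / w l))"
      by (rule ennreal_leI)
    also have "\<dots> = ennreal (\<Sum>l<N. w l) * (\<Sum>l<N. ennreal ((z l)\<^sup>2 / w l))"
      using w(2) by (subst ennreal_mult) (auto intro!: sum_nonneg simp: less_imp_le sum_ennreal)
    also have "\<dots> \<le> ennreal (\<Sum>l. w l) * (\<Sum>l. ennreal ((z l)\<^sup>2 / w l))"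
      using w by (intro mult_mono ennreal_leI sum_le_suminf) (auto simp: less_imp_le)
    finally show "ennreal ((\<Sum>l<N. z l)\<^sup>2) \<le> ennreal (\<Sum>l. w l) * (\<Sum>l. ennreal ((z l)\<^sup>2 / w l))" .
  qed
qed

text \<open>A strong law without independence: the second moments yield convergence along the
  polynomial times \<open>j ^ p\<close>, and monotonicity fills the gaps because \<open>(j + 1) ^ p / j ^ p \<longlongrightarrow> 1\<close>.\<close>

lemma monotone_strong_law:
  fixes U :: "nat \<Rightarrow> 'w \<Rightarrow> real"
  assumes [measurable]: "\<And>n. U n \<in> borel_measurable M"
    and mono: "AE w in M. mono (\<lambda>n. U n w)"
    and var: "\<And>n. (\<integral>\<^sup>+w. ennreal ((U n w - \<mu> * real n)\<^sup>2) \<partial>M) \<le> ennreal (B * real n powr \<beta>)"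
    and \<beta>: "\<beta> < 2" and \<mu>: "\<mu> \<ge> 0" and B: "B \<ge> 0"
  shows "AE w in M. \<forall>e>0. \<exists>K. \<forall>n. \<bar>U n w - \<mu> * real n\<bar> \<le> e * real n + K"
proof -
  \<comment> \<open>At times \<open>N = Suc j ^ p\<close> the normalized second moments are of order
    \<open>N powr (\<beta> - 2)\<close>; this \<open>p\<close> makes them at most of order
    \<open>1 / real (Suc j) ^ 2\<close>, hence summable.\<close>
  obtain p :: nat where p: "2 / (2 - \<beta>) < real p" using reals_Archimedean2 by blast
  have p2: "real p * (2 - \<beta>) \<ge> 2" using p \<beta> by (simp add: field_simps)
  have p0: "p > 0" using p2 by (cases p) auto
  define Z where "Z j w = ((U (Suc j ^ p) w - \<mu> * real (Suc j ^ p)) / real (Suc j ^ p))\<^sup>2" for j w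
  have [measurable]: "Z j \<in> borel_measurable M" for j unfolding Z_def by measurable
  have "(\<integral>\<^sup>+w. (\<Sum>j. ennreal (Z j w)) \<partial>M) = (\<Sum>j. \<integral>\<^sup>+w. ennreal (Z j w) \<partial>M)"
    by (rule nn_integral_suminf) measurable
  also have "\<dots> \<le> (\<Sum>j. ennreal (B * (1 / real (Suc j) ^ 2)))"
  proof (intro suminf_le summableI)
    fix j
    define N where "N = Suc j ^ p"
    have N: "real N > 0" by (simp add: N_def)
    have "(\<integral>\<^sup>+w. ennreal (Z j w) \<partial>M) = (\<integral>\<^sup>+w. ennreal (1 / (real N)\<^sup>2) * ennreal ((U N w - \<mu> * real N)\<^sup>2) \<partial>M)"
      unfolding Z_def N_def[symmetric] by (intro nn_integral_cong) (simp add: power_divide flip: ennreal_mult)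
    also have "\<dots> = ennreal (1 / (real N)\<^sup>2) * (\<integral>\<^sup>+w. ennreal ((U N w - \<mu> * real N)\<^sup>2) \<partial>M)"
      by (rule nn_integral_cmult) measurable
    also have "\<dots> \<le> ennreal (1 / (real N)\<^sup>2) * ennreal (B * real N powr \<beta>)"
      by (intro mult_left_mono var) simp
    also have "\<dots> = ennreal (B * (real N powr (\<beta> - 2)))"
    proof -
      have "real N powr (\<beta> - 2) = real N powr \<beta> / (real N)\<^sup>2" using N by (simp add: powr_diff)
      then show ?thesis using B by (simp flip: ennreal_mult)
    qed
    also have "real N powr (\<beta> - 2) = real (Suc j) powr (- (real p * (2 - \<beta>)))"
    proof -
      have "real N = real (Suc j) powr real p" unfolding N_def by (subst powr_realpow) simp_all
      then show ?thesis by (simp only: powr_powr) (simp add: algebra_simps)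
    qed
    also have "\<dots> \<le> real (Suc j) powr (- 2)" using p2 by (intro powr_mono) auto
    also have "\<dots> = 1 / real (Suc j) ^ 2"
      by (simp add: powr_minus_divide del: of_nat_Suc)
    finally show "(\<integral>\<^sup>+w. ennreal (Z j w) \<partial>M) \<le> ennreal (B * (1 / real (Suc j) ^ 2))"
      using B by (simp add: mult_left_mono ennreal_leI)
  qed
  also have "\<dots> < \<infinity>"
  proof -
    have "summable (\<lambda>j. B * (1 / real (Suc j) ^ 2))"
      using inverse_squares_sums by (intro summable_mult) (auto simp: sums_iff)
    then show ?thesis using B by (subst suminf_ennreal2) auto
  qed
  finally have "AE w in M. (\<Sum>j. ennreal (Z j w)) \<noteq> \<infinity>"
    by (intro nn_integral_PInf_AE) auto
  with mono show ?thesis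
  proof eventually_elim
    case (elim w)
    have "summable (\<lambda>j. Z j w)"
      using elim(2) by (intro summable_suminf_not_top) (auto simp: Z_def)
    then have "(\<lambda>j. Z j w) \<longlonglongrightarrow> 0" by (rule summable_LIMSEQ_zero)
    then have "(\<lambda>j. sqrt (Z j w)) \<longlonglongrightarrow> sqrt 0" by (intro tendsto_intros)
    then have lim: "(\<lambda>j. \<bar>(U (Suc j ^ p) w - \<mu> * real (Suc j ^ p)) / real (Suc j ^ p)\<bar>) \<longlonglongrightarrow> 0"
      by (simp add: Z_def)
    show ?case
    proof (intro allI impI)
      fix e0 :: real assume e0: "e0 > 0"
      \<comment> \<open>The gap between sampling times costs a factor \<open>1 + e\<close> in
        addition to the error \<open>e\<close> at those times; the choice keeps
        \<open>e * (\<mu> + 1 + e)\<close> below \<open>e0\<close>.\<close>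
      define e where "e = min 1 (e0 / (\<mu> + 2))"
      have e: "0 < e" "e \<le> 1" "e \<le> e0 / (\<mu> + 2)" using e0 \<mu> by (auto simp: e_def)
      then have e: "0 < e" "e \<le> 1" "e * (\<mu> + 2) \<le> e0" using \<mu> by (simp_all add: pos_le_divide_eq)
      have "(\<lambda>j. (real (Suc (Suc j)) / real (Suc j)) ^ p) \<longlonglongrightarrow> 1 ^ p"
      proof (rule tendsto_power)
        show "(\<lambda>j. real (Suc (Suc j)) / real (Suc j)) \<longlonglongrightarrow> 1" by real_asymp
      qed
      then have "\<forall>\<^sub>F j in sequentially. (real (Suc (Suc j)) / real (Suc j)) ^ p < 1 + e"
        using e by (intro order_tendstoD) auto
      moreover have "\<forall>\<^sub>F j in sequentially. \<bar>(U (Suc j ^ p) w - \<mu> * real (Suc j ^ p)) / real (Suc j ^ p)\<bar> < e"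
        using lim e by (intro order_tendstoD) auto
      ultimately have "\<forall>\<^sub>F j in sequentially. (real (Suc (Suc j)) / real (Suc j)) ^ p < 1 + e \<and>
         \<bar>(U (Suc j ^ p) w - \<mu> * real (Suc j ^ p)) / real (Suc j ^ p)\<bar> < e" by eventually_elim auto
      then obtain J where J: "\<And>j. j \<ge> J \<Longrightarrow> (real (Suc (Suc j)) / real (Suc j)) ^ p < 1 + e"
        "\<And>j. j \<ge> J \<Longrightarrow> \<bar>(U (Suc j ^ p) w - \<mu> * real (Suc j ^ p)) / real (Suc j ^ p)\<bar> < e"
        unfolding eventually_sequentially by blast
      have near: "\<bar>U (Suc j ^ p) w - \<mu> * real (Suc j ^ p)\<bar> \<le> e * real (Suc j ^ p)" if "j \<ge> J" for j
        using J(2)[OF that] by (simp add: abs_divide divide_less_eq del: of_nat_Suc of_nat_power)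
      have large: "\<bar>U n w - \<mu> * real n\<bar> \<le> e0 * real n" if n: "n \<ge> Suc J ^ p" for n
      proof -
        have "\<exists>j\<ge>J. Suc j ^ p \<le> n \<and> n < Suc (Suc j) ^ p"
        proof -
          define j where "j = (LEAST j. n < Suc (Suc j) ^ p)"
          have "n < Suc (Suc n) ^ p" using p0 self_le_power[of "Suc (Suc n)" p] by linarith
          then have j1: "n < Suc (Suc j) ^ p" unfolding j_def by (rule LeastI)
          have j2: "Suc j ^ p \<le> n" if "j > J"
          proof -
            have "\<not> n < Suc (Suc (j - 1)) ^ p" using that unfolding j_def by (intro not_less_Least) auto
            then show ?thesis using that by simp
          qed
          have "j \<ge> J"
          proof (rule ccontr)
            assume "\<not> j \<ge> J"
            then have "Suc (Suc j) ^ p \<le> Suc J ^ p" by (intro power_mono) auto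
            then show False using j1 n by simp
          qed
          then show ?thesis using j1 j2 n by (cases "j = J") auto
        qed
        then obtain j where j: "j \<ge> J" "Suc j ^ p \<le> n" "n < Suc (Suc j) ^ p" by blast
        define a where "a = real (Suc j ^ p)"
        define b where "b = real (Suc (Suc j) ^ p)"
        have ab: "0 < a" "a \<le> real n" "real n \<le> b"
          using j(2,3) unfolding a_def b_def by (auto simp del: of_nat_power of_nat_Suc)
        have "(real (Suc (Suc j)) / real (Suc j)) ^ p = b / a" by (simp add: a_def b_def power_divide)
        then have "b / a < 1 + e" using J(1)[OF j(1)] by (simp only:)
        then have ba: "b \<le> (1 + e) * a" using ab by (simp add: pos_divide_less_eq)
        have "U n w \<le> U (Suc (Suc j) ^ p) w" "U (Suc j ^ p) w \<le> U n w"
          using elim(1) j by (auto simp: mono_def)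
        moreover have "U (Suc (Suc j) ^ p) w \<le> (\<mu> + e) * b" "U (Suc j ^ p) w \<ge> (\<mu> - e) * a"
          using near[of "Suc j"] near[of j] j(1) by (auto simp: a_def b_def algebra_simps abs_le_iff simp del: of_nat_power of_nat_Suc)
        ultimately have U: "U n w \<le> (\<mu> + e) * b" "U n w \<ge> (\<mu> - e) * a" by auto
        have "(\<mu> + e) * b \<le> (\<mu> + e) * ((1 + e) * real n)"
          using ba ab \<mu> e by (intro mult_left_mono order_trans[OF ba]) auto
        also have "\<dots> = \<mu> * real n + (e * (\<mu> + 1 + e)) * real n" by (simp add: algebra_simps)
        also have "\<dots> \<le> \<mu> * real n + e0 * real n"
        proof -
          have "e * (\<mu> + 1 + e) \<le> e * (\<mu> + 2)" using e by (intro mult_left_mono) auto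
          then have "e * (\<mu> + 1 + e) \<le> e0" using e by linarith
          then show ?thesis by (intro add_mono mult_right_mono) auto
        qed
        finally have up: "U n w \<le> \<mu> * real n + e0 * real n" using U(1) by simp
        have "\<mu> * real n \<le> \<mu> * ((1 + e) * a)" using ba ab \<mu> by (intro mult_left_mono) auto
        then have "\<mu> * real n - (e * (\<mu> + 1)) * a \<le> (\<mu> - e) * a" by (simp add: algebra_simps)
        moreover have "(e * (\<mu> + 1)) * a \<le> e0 * real n"
        proof (rule mult_mono)
          have "e * (\<mu> + 1) \<le> e * (\<mu> + 2)" using e by (intro mult_left_mono) auto
          then show "e * (\<mu> + 1) \<le> e0" using e by linarith
        qed (use ab e0 in auto)
        ultimately show ?thesis using up U(2) by (simp add: abs_le_iff)
      qed
      \<comment> \<open>The finitely many \<open>n\<close> before the asymptotic regime are absorbed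
        in the constant.\<close>
      define K where "K = (\<Sum>n<Suc J ^ p. \<bar>U n w - \<mu> * real n\<bar>)"
      show "\<exists>K. \<forall>n. \<bar>U n w - \<mu> * real n\<bar> \<le> e0 * real n + K"
      proof (intro exI[of _ K] allI)
        fix n
        show "\<bar>U n w - \<mu> * real n\<bar> \<le> e0 * real n + K"
        proof (cases "n \<ge> Suc J ^ p")
          case True
          then show ?thesis using large[OF True] by (simp add: K_def sum_nonneg add_increasing2)
        next
          case False
          then have "\<bar>U n w - \<mu> * real n\<bar> \<le> K"
            unfolding K_def by (intro member_le_sum) auto
          then show ?thesis using e0 by (simp add: add_increasing)
        qed
      qed
    qed
  qed
qed

section \<open>Averages of the seminorm over unit blocks\<close>

definition block_sum :: "real \<Rightarrow> real \<Rightarrow> nat \<Rightarrow> (real \<Rightarrow> real) \<Rightarrow> real" where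
  "block_sum \<gamma> a n \<omega> = (\<Sum>k<n. sobolev \<gamma> \<omega> (a + real k) (a + real k + 1))"

context fbm begin

lemma block_sum_measurable [measurable]: "block_sum \<gamma> a n \<in> borel_measurable P"
  unfolding block_sum_def by measurable

text \<open>The blocks are finite in number, so their sum may be exchanged with the series over the
  levels.\<close>

lemma block_sum_deviation:
  assumes "locally_Hoelder \<nu> \<omega>" "continuous_on UNIV \<omega>" "0 < \<gamma>" "\<gamma> < 2 * \<nu> - 1" "\<gamma> < 2 * H - 1"
  shows "summable (\<lambda>l. 2 powr (\<gamma> * real l) * level_fluctuation a n l \<omega>)"
    "block_sum \<gamma> a n \<omega> - sobolev_mean \<gamma> * real n = (\<Sum>l. 2 powr (\<gamma> * real l) * level_fluctuation a n l \<omega>)"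
proof -
  have split: "2 powr (\<gamma> * real l) * level_fluctuation a n l \<omega> =
      (\<Sum>k<n. 2 powr (\<gamma> * real l) * dyadic_var \<omega> (a + real k) (a + real k + 1) l) -
      real n * 2 powr ((\<gamma> + 1 - 2 * H) * real l)" for l
  proof -
    have "2 powr (\<gamma> * real l) * 2 powr ((1 - 2 * H) * real l) = 2 powr ((\<gamma> + 1 - 2 * H) * real l)"
      by (simp add: powr_add[symmetric] algebra_simps)
    then show ?thesis
      by (simp add: level_fluctuation_def right_diff_distrib sum_distrib_left mult.left_commute)
  qed
  have s: "summable (\<lambda>l. 2 powr (\<gamma> * real l) * dyadic_var \<omega> (a + real k) (a + real k + 1) l)" for k
    by (rule summable_sobolev[OF assms(1-4)]) simp
  have s1: "summable (\<lambda>l. \<Sum>k<n. 2 powr (\<gamma> * real l) * dyadic_var \<omega> (a + real k) (a + real k + 1) l)"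
    by (intro summable_sum s)
  have s2: "summable (\<lambda>l. real n * 2 powr ((\<gamma> + 1 - 2 * H) * real l))"
    by (intro summable_mult summable_sobolev_mean assms)
  show "summable (\<lambda>l. 2 powr (\<gamma> * real l) * level_fluctuation a n l \<omega>)"
    unfolding split by (intro summable_diff s1 s2)
  show "block_sum \<gamma> a n \<omega> - sobolev_mean \<gamma> * real n = (\<Sum>l. 2 powr (\<gamma> * real l) * level_fluctuation a n l \<omega>)"
    unfolding split suminf_diff[OF s1 s2, symmetric] suminf_sum[OF s]
      suminf_mult[OF summable_sobolev_mean[OF assms(5)]]
    by (simp add: block_sum_def sobolev_def sobolev_mean_def)
qed

text \<open>\<open>B\<close> serves every starting point \<open>a\<close>, so that the window may
  begin at \<open>- n\<close> when the past is treated.\<close>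

lemma block_sum_second_moment:
  assumes paths: "AE \<omega> in P. locally_Hoelder \<nu> \<omega> \<and> continuous_on UNIV \<omega>"
    and \<gamma>: "0 < \<gamma>" "\<gamma> < 2 * \<nu> - 1" "\<gamma> < 2 * H - 1"
  obtains B where "B \<ge> 0" "\<And>a n. (\<integral>\<^sup>+\<omega>. ennreal ((block_sum \<gamma> a n \<omega> - sobolev_mean \<gamma> * real n)\<^sup>2) \<partial>P)
    \<le> ennreal (B * real n powr (2 * H))"
proof -
  \<comment> \<open>With weights \<open>2 powr (- \<eta> * l)\<close> in
    \<open>suminf_square_le\<close>, level \<open>l\<close> contributes the order
    \<open>2 powr ((2 * \<gamma> + \<eta> - 2 * H) * l)\<close>. This \<open>\<eta>\<close> turns
    the exponent into \<open>- \<eta> * l\<close> again, so one series \<open>S\<close> serves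
    twice. It is positive since \<open>\<gamma> < 2 * H - 1 < H\<close>.\<close>
  define \<eta> where "\<eta> = H - \<gamma>"
  have \<eta>: "\<eta> > 0" using \<gamma> H by (simp add: \<eta>_def)
  have geo: "summable (\<lambda>l. 2 powr (- \<eta> * real l))"
  proof -
    have "(\<lambda>l. 2 powr (- \<eta> * real l)) = (\<lambda>l. (2 powr (- \<eta>)) ^ l)"
      by (rule ext) (subst powr_realpow[symmetric], simp, simp only: powr_powr)
    moreover have "summable (\<lambda>l. (2 powr (- \<eta>)) ^ l)"
      using \<eta> powr_less_mono[of "- \<eta>" 0 2] by (intro summable_geometric) simp
    ultimately show ?thesis by (simp only:)
  qed
  define S where "S = (\<Sum>l. 2 powr (- \<eta> * real l))"
  have S: "S \<ge> 0" unfolding S_def by (intro suminf_nonneg geo) simp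
  show thesis
  proof (rule that[of "S * (2 * S)"])
    fix a n
    define z where "z \<omega> l = 2 powr (\<gamma> * real l) * level_fluctuation a n l \<omega>" for \<omega> l
    have [measurable]: "(\<lambda>\<omega>. z \<omega> l) \<in> borel_measurable P" for l unfolding z_def by measurable
    have "(\<integral>\<^sup>+\<omega>. ennreal ((block_sum \<gamma> a n \<omega> - sobolev_mean \<gamma> * real n)\<^sup>2) \<partial>P)
      \<le> (\<integral>\<^sup>+\<omega>. ennreal S * (\<Sum>l. ennreal ((z \<omega> l)\<^sup>2 / 2 powr (- \<eta> * real l))) \<partial>P)"
      using paths
    proof (intro nn_integral_mono_AE, eventually_elim)
      case (elim \<omega>)
      have "block_sum \<gamma> a n \<omega> - sobolev_mean \<gamma> * real n = (\<Sum>l. z \<omega> l)" "summable (z \<omega>)"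
        using block_sum_deviation[OF conjunct1[OF elim(2)] conjunct2[OF elim(2)] \<gamma>] unfolding z_def[abs_def] by blast+
      then show ?case unfolding S_def by (simp only:) (rule suminf_square_le[OF _ geo], simp_all)
    qed
    also have "\<dots> = ennreal S * (\<Sum>l. \<integral>\<^sup>+\<omega>. ennreal ((z \<omega> l)\<^sup>2 / 2 powr (- \<eta> * real l)) \<partial>P)"
      by (simp add: nn_integral_cmult nn_integral_suminf)
    also have "\<dots> \<le> ennreal S * (\<Sum>l. ennreal (2 * real n powr (2 * H) * 2 powr (- \<eta> * real l)))"
    proof (intro mult_left_mono suminf_le summableI)
      fix l
      have "(z \<omega> l)\<^sup>2 / 2 powr (- \<eta> * real l) = 2 powr ((2 * \<gamma> + \<eta>) * real l) * (level_fluctuation a n l \<omega>)\<^sup>2" for \<omega>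
      proof -
        have "2 powr ((2 * \<gamma> + \<eta>) * real l) = 2 powr (\<gamma> * real l) * 2 powr (\<gamma> * real l) / 2 powr (- \<eta> * real l)"
          unfolding powr_add[symmetric] powr_diff[symmetric] by (simp add: algebra_simps)
        then show ?thesis by (simp add: z_def power2_eq_square mult_ac)
      qed
      then have "(\<integral>\<^sup>+\<omega>. ennreal ((z \<omega> l)\<^sup>2 / 2 powr (- \<eta> * real l)) \<partial>P) =
          ennreal (2 powr ((2 * \<gamma> + \<eta>) * real l)) * (\<integral>\<^sup>+\<omega>. ennreal ((level_fluctuation a n l \<omega>)\<^sup>2) \<partial>P)"
        by (subst nn_integral_cmult[symmetric], measurable) (simp only: ennreal_mult[symmetric] powr_ge_zero zero_le_power2)
      also have "\<dots> \<le> ennreal (2 powr ((2 * \<gamma> + \<eta>) * real l)) * ennreal (2 * 2 powr (- 2 * H * real l) * real n powr (2 * H))"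
        by (intro mult_left_mono level_fluctuation_second_moment) simp
      also have "\<dots> = ennreal (2 * real n powr (2 * H) * 2 powr (- \<eta> * real l))"
      proof -
        have "2 powr ((2 * \<gamma> + \<eta>) * real l) * 2 powr (- 2 * H * real l) = 2 powr (- \<eta> * real l)"
          unfolding powr_add[symmetric] by (simp add: \<eta>_def algebra_simps)
        then have "2 powr ((2 * \<gamma> + \<eta>) * real l) * (2 * 2 powr (- 2 * H * real l) * real n powr (2 * H)) =
           2 * real n powr (2 * H) * 2 powr (- \<eta> * real l)"
          by (simp add: mult.left_commute mult.commute)
        then show ?thesis by (subst ennreal_mult[symmetric]) simp_all
      qed
      finally show "(\<integral>\<^sup>+\<omega>. ennreal ((z \<omega> l)\<^sup>2 / 2 powr (- \<eta> * real l)) \<partial>P) \<le>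
        ennreal (2 * real n powr (2 * H) * 2 powr (- \<eta> * real l))" .
    qed auto
    also have "(\<Sum>l. ennreal (2 * real n powr (2 * H) * 2 powr (- \<eta> * real l))) = ennreal (2 * real n powr (2 * H) * S)"
      unfolding S_def suminf_mult[OF geo, symmetric]
      by (rule suminf_ennreal2) (simp, rule summable_mult[OF geo])
    also have "ennreal S * ennreal (2 * real n powr (2 * H) * S) = ennreal (S * (2 * S) * real n powr (2 * H))"
      using S by (simp add: mult_ac flip: ennreal_mult)
    finally show "(\<integral>\<^sup>+\<omega>. ennreal ((block_sum \<gamma> a n \<omega> - sobolev_mean \<gamma> * real n)\<^sup>2) \<partial>P)
      \<le> ennreal (S * (2 * S) * real n powr (2 * H))" .
  qed (use S in simp)
qed

end

text \<open>A discrete primitive with the sign convention of an integral from 0 to \<open>n\<close>;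
  its increments are the block seminorms on both sides of the origin.\<close>

definition block_primitive :: "real \<Rightarrow> (real \<Rightarrow> real) \<Rightarrow> int \<Rightarrow> real" where
  "block_primitive \<gamma> \<omega> n = (if n \<ge> 0 then block_sum \<gamma> 0 (nat n) \<omega> else - block_sum \<gamma> (real_of_int n) (nat (- n)) \<omega>)"

lemma block_sum_Suc_left:
  "block_sum \<gamma> (a - 1) (Suc n) \<omega> = sobolev \<gamma> \<omega> (a - 1) a + block_sum \<gamma> a n \<omega>"
  unfolding block_sum_def sum.lessThan_Suc_shift by (simp add: algebra_simps)

lemma block_primitive_Suc:
  "block_primitive \<gamma> \<omega> (n + 1) = block_primitive \<gamma> \<omega> n + sobolev \<gamma> \<omega> (real_of_int n) (real_of_int n + 1)"
proof (cases "n \<ge> 0")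
  case True
  then have "nat (n + 1) = Suc (nat n)" by simp
  then show ?thesis using True by (simp add: block_primitive_def block_sum_def)
next
  case False
  define m where "m = nat (- n - 1)"
  have m: "nat (- n) = Suc m" "real_of_int n + 1 = - real m" "n + 1 = - int m"
    using False by (auto simp: m_def)
  have "block_primitive \<gamma> \<omega> n = - block_sum \<gamma> (real_of_int n) (Suc m) \<omega>"
    using False m by (simp add: block_primitive_def)
  moreover have "block_primitive \<gamma> \<omega> (n + 1) = - block_sum \<gamma> (real_of_int n + 1) m \<omega>"
    unfolding m(2,3) by (cases "m = 0") (auto simp: block_primitive_def block_sum_def[of _ _ 0])
  ultimately show ?thesis
    using block_sum_Suc_left[of \<gamma> "real_of_int n + 1" m \<omega>] by simp
qed

text \<open>By \<open>osc_cover_sobolev\<close> a unit block costs one piece plus \<open>K\<close>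
  times its seminorm. Between two integers this adds up to a difference of values of
  \<open>block_primitive\<close>, each of which is \<open>m\<close> times its argument up to a
  sublinear error.\<close>

lemma cover_rate_of_block_sums:
  assumes path: "locally_Hoelder \<nu> \<omega>" "continuous_on UNIV \<omega>" and \<gamma>: "0 < \<gamma>" "\<gamma> < 2 * \<nu> - 1"
    and pos: "\<And>e. e > 0 \<Longrightarrow> \<exists>C. \<forall>n. \<bar>block_sum \<gamma> 0 n \<omega> - m * real n\<bar> \<le> e * real n + C"
    and neg: "\<And>e. e > 0 \<Longrightarrow> \<exists>C. \<forall>n. \<bar>block_sum \<gamma> (- real n) n \<omega> - m * real n\<bar> \<le> e * real n + C"
    and m: "m \<ge> 0"
  defines "q \<equiv> 2 powr (- \<gamma> / 2)"
  defines "K \<equiv> 4 * (q / (1 - q))\<^sup>2 / (1 - q\<^sup>2)"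
  shows "cover_rate (1 + K * m) \<omega>"
  unfolding cover_rate_def
proof (intro allI impI)
  fix e :: real assume e: "e > 0"
  have q: "0 < q" "q < 1"
    using \<gamma> powr_less_mono[of "- \<gamma> / 2" 0 2] by (auto simp: q_def)
  then have "q\<^sup>2 < 1" by (simp add: power_less_one_iff)
  then have K: "K \<ge> 0" by (simp add: K_def)
  define e' where "e' = e / (K + 1)"
  have e': "e' > 0" "K * e' \<le> e" using e K by (auto simp: e'_def field_simps)
  let ?\<Phi> = "block_primitive \<gamma> \<omega>"
  obtain C1 C2 where C1: "\<And>n. \<bar>block_sum \<gamma> 0 n \<omega> - m * real n\<bar> \<le> e' * real n + C1"
    and C2: "\<And>n. \<bar>block_sum \<gamma> (- real n) n \<omega> - m * real n\<bar> \<le> e' * real n + C2"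
    using pos[OF e'(1)] neg[OF e'(1)] by blast
  define C where "C = max C1 C2"
  have \<Phi>: "\<bar>?\<Phi> n - m * real_of_int n\<bar> \<le> e' * \<bar>real_of_int n\<bar> + C" for n
  proof (cases "n \<ge> 0")
    case True
    then show ?thesis using C1[of "nat n"] by (simp add: block_primitive_def C_def)
  next
    case False
    then show ?thesis using C2[of "nat (- n)"] by (simp add: block_primitive_def C_def abs_minus_commute algebra_simps)
  qed
  have cover: "\<exists>n. osc_cover \<omega> (real_of_int a) (real_of_int b) n \<and>
      real n \<le> 1 + real_of_int (b - a) + K * (?\<Phi> b - ?\<Phi> a)" if "a \<le> b" for a b
    using that
  proof (induction b rule: int_ge_induct)
    case base
    \<comment> \<open>An interval of length 0 still counts as one piece, which explains the leading
      1.\<close>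
    show ?case by (intro exI[of _ 1] conjI osc_cover.one) auto
  next
    case (step b)
    then obtain n where n: "osc_cover \<omega> (real_of_int a) (real_of_int b) n"
      "real n \<le> 1 + real_of_int (b - a) + K * (?\<Phi> b - ?\<Phi> a)" by blast
    obtain n' where n': "osc_cover \<omega> (real_of_int b) (real_of_int b + 1) n'"
      "real n' \<le> 1 + K * sobolev \<gamma> \<omega> (real_of_int b) (real_of_int b + 1)"
      using osc_cover_sobolev[OF path \<gamma>, of "real_of_int b" "real_of_int b + 1"]
      unfolding K_def q_def by auto
    have "real (n + n') \<le> 1 + real_of_int (b + 1 - a) + K * (?\<Phi> (b + 1) - ?\<Phi> a)"
    proof -
      have "K * (?\<Phi> (b + 1) - ?\<Phi> a) = K * (?\<Phi> b - ?\<Phi> a) + K * sobolev \<gamma> \<omega> (real_of_int b) (real_of_int b + 1)"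
        by (simp add: block_primitive_Suc flip: distrib_left)
      then show ?thesis using n(2) n'(2) by simp
    qed
    then show ?case using osc_cover_append[OF n'(1) n(1)] by (intro exI[of _ "n + n'"]) simp
  qed
  \<comment> \<open>Rounding \<open>s\<close> down and \<open>t\<close> up adds at most 2 to the
    length and at most 2 to the sum of the moduli; together with the leading 1 this gives the
    3.\<close>
  define L where "L = 3 + K * (2 * m + 2 * e' + 2 * C)"
  show "\<exists>L. \<forall>s t. s \<le> t \<longrightarrow> (\<exists>n. osc_cover \<omega> s t n \<and> real n \<le> (1 + K * m) * (t - s) + e * (\<bar>s\<bar> + \<bar>t\<bar>) + L)"
  proof (intro exI[of _ L] allI impI)
    fix s t :: real assume st: "s \<le> t"
    define a where "a = \<lfloor>s\<rfloor>"
    define b where "b = \<lceil>t\<rceil>"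
    have ab: "real_of_int a \<le> s" "s \<le> real_of_int a + 1" "t \<le> real_of_int b" "real_of_int b \<le> t + 1"
      unfolding a_def b_def by linarith+
    then have "a \<le> b" using st by linarith
    from cover[OF this] obtain n where n: "osc_cover \<omega> (real_of_int a) (real_of_int b) n"
      "real n \<le> 1 + real_of_int (b - a) + K * (?\<Phi> b - ?\<Phi> a)" by blast
    obtain n1 where n1: "n1 \<le> n" "osc_cover \<omega> s (real_of_int b) n1"
      using osc_cover_sub_left[OF n(1), of s] ab st by auto
    obtain n2 where n2: "n2 \<le> n1" "osc_cover \<omega> s t n2"
      using osc_cover_sub_right[OF n1(2), of t] ab st by auto
    have "?\<Phi> b - ?\<Phi> a \<le> m * (real_of_int b - real_of_int a) + e' * (\<bar>real_of_int a\<bar> + \<bar>real_of_int b\<bar>) + 2 * C"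
      using \<Phi>[of a] \<Phi>[of b] by (simp add: algebra_simps abs_le_iff)
    also have "\<dots> \<le> m * (t - s + 2) + e' * (\<bar>s\<bar> + \<bar>t\<bar> + 2) + 2 * C"
    proof -
      have "m * (real_of_int b - real_of_int a) \<le> m * (t - s + 2)"
        using ab m by (intro mult_left_mono) auto
      moreover have "e' * (\<bar>real_of_int a\<bar> + \<bar>real_of_int b\<bar>) \<le> e' * (\<bar>s\<bar> + \<bar>t\<bar> + 2)"
        by (rule mult_left_mono) (use ab e' in linarith)+
      ultimately show ?thesis by linarith
    qed
    finally have "K * (?\<Phi> b - ?\<Phi> a) \<le> K * (m * (t - s + 2) + e' * (\<bar>s\<bar> + \<bar>t\<bar> + 2) + 2 * C)"
      using K by (rule mult_left_mono)
    also have "\<dots> = K * m * (t - s) + (K * e') * (\<bar>s\<bar> + \<bar>t\<bar>) + K * (2 * m + 2 * e' + 2 * C)"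
      by (simp add: algebra_simps)
    also have "\<dots> \<le> K * m * (t - s) + e * (\<bar>s\<bar> + \<bar>t\<bar>) + K * (2 * m + 2 * e' + 2 * C)"
    proof -
      have "(K * e') * (\<bar>s\<bar> + \<bar>t\<bar>) \<le> e * (\<bar>s\<bar> + \<bar>t\<bar>)" using e' by (intro mult_right_mono) auto
      then show ?thesis by linarith
    qed
    finally have "K * (?\<Phi> b - ?\<Phi> a) \<le> K * m * (t - s) + e * (\<bar>s\<bar> + \<bar>t\<bar>) + K * (2 * m + 2 * e' + 2 * C)" .
    moreover have "real n2 \<le> real n" "real_of_int (b - a) \<le> t - s + 2" using n1 n2 ab by auto
    ultimately have "real n2 \<le> (1 + K * m) * (t - s) + e * (\<bar>s\<bar> + \<bar>t\<bar>) + L"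
      using n(2) unfolding L_def by (simp add: algebra_simps)
    then show "\<exists>n. osc_cover \<omega> s t n \<and> real n \<le> (1 + K * m) * (t - s) + e * (\<bar>s\<bar> + \<bar>t\<bar>) + L"
      using n2 by blast
  qed
qed

context fbm begin

lemma AE_cover_rate:
  assumes paths: "AE \<omega> in P. locally_Hoelder \<nu> \<omega> \<and> continuous_on UNIV \<omega>" and \<nu>: "1/2 < \<nu>" "\<nu> < H"
  shows "\<exists>\<mu>\<ge>0. AE \<omega> in P. cover_rate \<mu> \<omega>"
proof -
  \<comment> \<open>Half of \<open>2 * \<nu> - 1\<close>, hence positive and strictly below both
    upper bounds required of \<open>\<gamma>\<close>.\<close>
  define \<gamma> where "\<gamma> = \<nu> - 1/2"
  have \<gamma>: "0 < \<gamma>" "\<gamma> < 2 * \<nu> - 1" "\<gamma> < 2 * H - 1" using \<nu> by (auto simp: \<gamma>_def)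
  define q where "q = 2 powr (- \<gamma> / 2)"
  define K where "K = 4 * (q / (1 - q))\<^sup>2 / (1 - q\<^sup>2)"
  define m where "m = sobolev_mean \<gamma>"
  have m: "m \<ge> 0" unfolding m_def sobolev_mean_def
    by (intro suminf_nonneg summable_sobolev_mean \<gamma>) simp
  obtain B where B: "B \<ge> 0" "\<And>a n. (\<integral>\<^sup>+\<omega>. ennreal ((block_sum \<gamma> a n \<omega> - m * real n)\<^sup>2) \<partial>P)
    \<le> ennreal (B * real n powr (2 * H))"
    using block_sum_second_moment[OF paths \<gamma>] unfolding m_def by blast
  have "AE \<omega> in P. \<forall>e>0. \<exists>C. \<forall>n. \<bar>block_sum \<gamma> 0 n \<omega> - m * real n\<bar> \<le> e * real n + C"
  proof (rule monotone_strong_law[OF _ _ B(2) _ m B(1)])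
    show "AE \<omega> in P. mono (\<lambda>n. block_sum \<gamma> 0 n \<omega>)"
      using paths
    proof eventually_elim
      case (elim \<omega>)
      then show ?case
        by (intro incseq_SucI) (simp add: block_sum_def sobolev_nonneg[OF _ _ \<gamma>(1,2)])
    qed
  qed (use H in auto)
  \<comment> \<open>The window of length \<open>n\<close> that ends at 0 grows to the left, so these
    sums are increasing in \<open>n\<close> too.\<close>
  moreover have "AE \<omega> in P. \<forall>e>0. \<exists>C. \<forall>n. \<bar>block_sum \<gamma> (- real n) n \<omega> - m * real n\<bar> \<le> e * real n + C"
  proof (rule monotone_strong_law[OF _ _ B(2) _ m B(1)])
    show "AE \<omega> in P. mono (\<lambda>n. block_sum \<gamma> (- real n) n \<omega>)"
      using paths
    proof eventually_elim
      case (elim \<omega>)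
      show ?case
      proof (rule incseq_SucI)
        fix n
        have "0 \<le> sobolev \<gamma> \<omega> (- real n - 1) (- real n)"
          by (rule sobolev_nonneg[OF _ _ \<gamma>(1,2)]) (use elim in auto)
        moreover have e: "- real (Suc n) = - real n - 1" by simp
        ultimately show "block_sum \<gamma> (- real n) n \<omega> \<le> block_sum \<gamma> (- real (Suc n)) (Suc n) \<omega>"
          using block_sum_Suc_left[of \<gamma> "- real n" n \<omega>]
          unfolding e by simp
      qed
    qed
  qed (use H in auto)
  ultimately have "AE \<omega> in P. cover_rate (1 + K * m) \<omega>"
    using paths
  proof eventually_elim
    case (elim \<omega>)
    then show ?case unfolding K_def q_def by (intro cover_rate_of_block_sums[of \<nu>] \<gamma> m) auto
  qed
  then have "AE \<omega> in P. cover_rate (max 0 (1 + K * m)) \<omega>"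
    by eventually_elim (erule cover_rate_mono, simp)
  then show ?thesis by (intro exI[of _ "max 0 (1 + K * m)"]) auto
qed

end

section \<open>Pullback attraction\<close>

lemma wiener_shift_shift: "wiener_shift s (wiener_shift t \<omega>) = wiener_shift (t + s) \<omega>"
  by (simp add: wiener_shift_def fun_eq_iff add.assoc)

lemma tendsto_sublinear:
  assumes "\<And>\<delta>. \<delta> > 0 \<Longrightarrow> \<exists>L. \<forall>t. \<bar>g t\<bar> \<le> \<delta> * \<bar>t\<bar> + L"
  shows "((\<lambda>t::real. 1 / t * g t) \<longlongrightarrow> 0) at_infinity"
proof (rule tendstoI)
  fix e :: real assume e: "e > 0"
  obtain L where L: "\<And>t. \<bar>g t\<bar> \<le> e / 2 * \<bar>t\<bar> + L" using assms[of "e / 2"] e by auto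
  show "\<forall>\<^sub>F t in at_infinity. dist (1 / t * g t) 0 < e"
    unfolding eventually_at_infinity
  proof (intro exI[of _ "2 * \<bar>L\<bar> / e + 1"] allI impI)
    fix t :: real assume t: "2 * \<bar>L\<bar> / e + 1 \<le> norm t"
    have "0 \<le> 2 * \<bar>L\<bar> / e" using e by simp
    then have t0: "\<bar>t\<bar> > 0" and "2 * \<bar>L\<bar> / e < \<bar>t\<bar>" using t by auto
    then have "L < e / 2 * \<bar>t\<bar>" using e by (simp add: field_simps abs_if split: if_splits)
    then have "\<bar>g t\<bar> < e * \<bar>t\<bar>" using L[of t] by simp
    then show "dist (1 / t * g t) 0 < e" using t0 by (simp add: abs_mult field_simps)
  qed
qed

text \<open>What remains of the equation is a cocycle with estimates over single pieces. By
  \<open>small\<close>, at \<open>\<mu>\<close> pieces per unit of time the factors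
  \<open>exp c\<close> use up at most half of the dissipation.\<close>

locale contracting_cocycle =
  fixes \<phi> :: "real \<Rightarrow> (real \<Rightarrow> real) \<Rightarrow> 'a::euclidean_space \<Rightarrow> 'a" and \<Omega> :: "(real \<Rightarrow> real) set"
    and c \<kappa> B \<mu> :: real
  assumes shift: "\<omega> \<in> \<Omega> \<Longrightarrow> wiener_shift t \<omega> \<in> \<Omega>"
    and shift_0: "\<omega> \<in> \<Omega> \<Longrightarrow> wiener_shift 0 \<omega> = \<omega>"
    and cocycle: "\<omega> \<in> \<Omega> \<Longrightarrow> s \<ge> 0 \<Longrightarrow> t \<ge> 0 \<Longrightarrow> \<phi> (t + s) \<omega> x = \<phi> t (wiener_shift s \<omega>) (\<phi> s \<omega> x)"
    and cont: "\<omega> \<in> \<Omega> \<Longrightarrow> t \<ge> 0 \<Longrightarrow> continuous_on UNIV (\<phi> t \<omega>)"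
    and contraction1: "\<omega> \<in> \<Omega> \<Longrightarrow> osc_cover \<omega> a b 1 \<Longrightarrow>
      norm (\<phi> (b - a) (wiener_shift a \<omega>) x - \<phi> (b - a) (wiener_shift a \<omega>) y) \<le> exp (c - \<kappa> * (b - a)) * norm (x - y)"
    and growth1: "\<omega> \<in> \<Omega> \<Longrightarrow> osc_cover \<omega> a b 1 \<Longrightarrow>
      norm (\<phi> (b - a) (wiener_shift a \<omega>) x) \<le> exp c * (norm x + B)"
    and c: "c \<ge> 0" and \<kappa>: "\<kappa> > 0" and B: "B \<ge> 0" and \<mu>: "\<mu> \<ge> 0" and small: "c * \<mu> \<le> \<kappa> / 2"
begin

lemma cocycle_between:
  assumes "\<omega> \<in> \<Omega>" "r \<le> s" "s \<le> t"
  shows "\<phi> (t - r) (wiener_shift r \<omega>) x = \<phi> (t - s) (wiener_shift s \<omega>) (\<phi> (s - r) (wiener_shift r \<omega>) x)"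
  using cocycle[OF shift[OF assms(1), of r], of "s - r" "t - s" x] assms
  by (simp add: wiener_shift_shift)

lemma contraction:
  assumes \<omega>: "\<omega> \<in> \<Omega>" and "osc_cover \<omega> a b n"
  shows "norm (\<phi> (b - a) (wiener_shift a \<omega>) x - \<phi> (b - a) (wiener_shift a \<omega>) y) \<le>
    exp (c * real n - \<kappa> * (b - a)) * norm (x - y)"
  using assms(2)
proof (induction rule: osc_cover.induct)
  case (one a b)
  then show ?case using contraction1[OF \<omega> osc_cover.one[OF one]] by simp
next
  case (snoc a b n d)
  note le = osc_cover_le[OF snoc.hyps(1)] osc_cover_le[OF snoc.hyps(2)]
  let ?x = "\<phi> (b - a) (wiener_shift a \<omega>) x" and ?y = "\<phi> (b - a) (wiener_shift a \<omega>) y"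
  have "norm (\<phi> (d - a) (wiener_shift a \<omega>) x - \<phi> (d - a) (wiener_shift a \<omega>) y) \<le>
      exp (c - \<kappa> * (d - b)) * norm (?x - ?y)"
    unfolding cocycle_between[OF \<omega> le] by (rule contraction1[OF \<omega> snoc.hyps(2)])
  also have "\<dots> \<le> exp (c - \<kappa> * (d - b)) * (exp (c * real n - \<kappa> * (b - a)) * norm (x - y))"
    by (intro mult_left_mono snoc.IH) simp
  also have "\<dots> = exp (c * real (Suc n) - \<kappa> * (d - a)) * norm (x - y)"
    unfolding mult.assoc[symmetric] exp_add[symmetric] by (simp add: algebra_simps)
  finally show ?case .
qed

lemma growth:
  assumes \<omega>: "\<omega> \<in> \<Omega>" and "osc_cover \<omega> a b n"
  shows "norm (\<phi> (b - a) (wiener_shift a \<omega>) x) \<le> exp (c * real n) * (norm x + real n * B)"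
  using assms(2)
proof (induction rule: osc_cover.induct)
  case (one a b)
  then show ?case using growth1[OF \<omega> osc_cover.one[OF one]] by simp
next
  case (snoc a b n d)
  note le = osc_cover_le[OF snoc.hyps(1)] osc_cover_le[OF snoc.hyps(2)]
  have "norm (\<phi> (d - a) (wiener_shift a \<omega>) x) \<le> exp c * (norm (\<phi> (b - a) (wiener_shift a \<omega>) x) + B)"
    unfolding cocycle_between[OF \<omega> le] by (rule growth1[OF \<omega> snoc.hyps(2)])
  also have "\<dots> \<le> exp c * (exp (c * real n) * (norm x + real n * B) + exp (c * real n) * B)"
  proof (intro mult_left_mono add_mono snoc.IH)
    have "1 * B \<le> exp (c * real n) * B" using c B by (intro mult_right_mono) auto
    then show "B \<le> exp (c * real n) * B" by simp
  qed simp
  also have "\<dots> = exp c * exp (c * real n) * (norm x + real (Suc n) * B)" by (simp add: algebra_simps)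
  also have "exp c * exp (c * real n) = exp (c * real (Suc n))" by (simp add: algebra_simps flip: exp_add)
  finally show ?case .
qed

text \<open>Stems from the crude bound of \<open>exp (c * n) * (n * B)\<close> by
  \<open>exp ((c + 1) * n + B)\<close>, with \<open>n\<close> about \<open>\<mu>\<close> times the
  length.\<close>

definition growth_rate :: real where "growth_rate = (c + 1) * \<mu>"

lemma uniform_estimates:
  assumes \<omega>: "\<omega> \<in> \<Omega>" and rate: "cover_rate \<mu> \<omega>" and \<epsilon>: "\<epsilon> > 0"
  obtains L where
    "\<And>s t x y. s \<le> t \<Longrightarrow> norm (\<phi> (t - s) (wiener_shift s \<omega>) x - \<phi> (t - s) (wiener_shift s \<omega>) y) \<le>
       exp (- (\<kappa> / 2) * (t - s) + \<epsilon> * (\<bar>s\<bar> + \<bar>t\<bar>) + L) * norm (x - y)"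
    "\<And>s t. s \<le> t \<Longrightarrow> norm (\<phi> (t - s) (wiener_shift s \<omega>) 0) \<le>
       exp (growth_rate * (t - s) + \<epsilon> * (\<bar>s\<bar> + \<bar>t\<bar>) + L)"
proof -
  \<comment> \<open>The number of pieces enters the exponents with the factor \<open>c\<close> or
    \<open>c + 1\<close>; division by \<open>c + 1\<close> leaves an error rate of at most
    \<open>\<epsilon>\<close> in both estimates.\<close>
  define e where "e = \<epsilon> / (c + 1)"
  have e: "e > 0" "(c + 1) * e = \<epsilon>" using \<epsilon> c by (auto simp: e_def)
  obtain K where K: "\<And>s t. s \<le> t \<Longrightarrow>
     (\<exists>n. osc_cover \<omega> s t n \<and> real n \<le> \<mu> * (t - s) + e * (\<bar>s\<bar> + \<bar>t\<bar>) + K)"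
    using rate e unfolding cover_rate_def by blast
  define L where "L = (c + 1) * \<bar>K\<bar> + B"
  have bound: "k * real n \<le> k * \<mu> * (t - s) + \<epsilon> * (\<bar>s\<bar> + \<bar>t\<bar>) + (c + 1) * \<bar>K\<bar>"
    if n: "real n \<le> \<mu> * (t - s) + e * (\<bar>s\<bar> + \<bar>t\<bar>) + K" and k: "0 \<le> k" "k \<le> c + 1" for k n s t
  proof -
    have "k * real n \<le> k * (\<mu> * (t - s) + e * (\<bar>s\<bar> + \<bar>t\<bar>) + K)" using n k by (intro mult_left_mono)
    also have "\<dots> = k * \<mu> * (t - s) + k * (e * (\<bar>s\<bar> + \<bar>t\<bar>)) + k * K" by (simp add: algebra_simps)
    also have "k * (e * (\<bar>s\<bar> + \<bar>t\<bar>)) \<le> (c + 1) * (e * (\<bar>s\<bar> + \<bar>t\<bar>))"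
      using k e by (intro mult_right_mono) auto
    also have "(c + 1) * (e * (\<bar>s\<bar> + \<bar>t\<bar>)) = \<epsilon> * (\<bar>s\<bar> + \<bar>t\<bar>)" using e(2) by (simp only: mult.assoc[symmetric])
    also have "k * K \<le> (c + 1) * \<bar>K\<bar>"
      by (rule order_trans[OF mult_left_mono[OF abs_ge_self] mult_right_mono]) (use k in auto)
    finally show ?thesis by simp
  qed
  show thesis
  proof (rule that[of L])
    fix s t :: real and x y :: 'a assume st: "s \<le> t"
    then obtain n where n: "osc_cover \<omega> s t n" "real n \<le> \<mu> * (t - s) + e * (\<bar>s\<bar> + \<bar>t\<bar>) + K" using K by blast
    have "c * \<mu> * (t - s) \<le> \<kappa> / 2 * (t - s)" using small st by (intro mult_right_mono) auto
    then have "c * real n - \<kappa> * (t - s) \<le> - (\<kappa> / 2) * (t - s) + \<epsilon> * (\<bar>s\<bar> + \<bar>t\<bar>) + L"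
      using bound[OF n(2), of c] c B by (simp add: L_def field_simps)
    then have "exp (c * real n - \<kappa> * (t - s)) * norm (x - y) \<le>
        exp (- (\<kappa> / 2) * (t - s) + \<epsilon> * (\<bar>s\<bar> + \<bar>t\<bar>) + L) * norm (x - y)"
      by (intro mult_right_mono) auto
    with contraction[OF \<omega> n(1)]
    show "norm (\<phi> (t - s) (wiener_shift s \<omega>) x - \<phi> (t - s) (wiener_shift s \<omega>) y) \<le>
       exp (- (\<kappa> / 2) * (t - s) + \<epsilon> * (\<bar>s\<bar> + \<bar>t\<bar>) + L) * norm (x - y)" by (rule order_trans)
  next
    fix s t :: real assume st: "s \<le> t"
    then obtain n where n: "osc_cover \<omega> s t n" "real n \<le> \<mu> * (t - s) + e * (\<bar>s\<bar> + \<bar>t\<bar>) + K" using K by blast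
    have exp_ge: "u \<le> exp u" for u :: real using exp_ge_add_one_self[of u] by linarith
    have "norm (\<phi> (t - s) (wiener_shift s \<omega>) 0) \<le> exp (c * real n) * (real n * B)"
      using growth[OF \<omega> n(1), of 0] by simp
    also have "\<dots> \<le> exp (c * real n) * (exp (real n) * exp B)"
      using B by (intro mult_left_mono mult_mono exp_ge) auto
    also have "\<dots> = exp ((c + 1) * real n + B)" by (simp add: algebra_simps flip: exp_add)
    also have "\<dots> \<le> exp (growth_rate * (t - s) + \<epsilon> * (\<bar>s\<bar> + \<bar>t\<bar>) + L)"
      using bound[OF n(2), of "c + 1"] c by (simp add: L_def growth_rate_def)
    finally show "norm (\<phi> (t - s) (wiener_shift s \<omega>) 0) \<le>
       exp (growth_rate * (t - s) + \<epsilon> * (\<bar>s\<bar> + \<bar>t\<bar>) + L)" .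
  qed
qed

definition pullback :: "(real \<Rightarrow> real) \<Rightarrow> real \<Rightarrow> 'a" where
  "pullback \<omega> r = \<phi> r (wiener_shift (- r) \<omega>) 0"

text \<open>A limit along integers, so that measurability follows from that of a sequence, also
  where the sequence diverges and \<open>lim\<close> has an unspecified value.\<close>

definition equilibrium :: "(real \<Rightarrow> real) \<Rightarrow> 'a" where
  "equilibrium \<omega> = lim (\<lambda>n. pullback \<omega> (real n))"

text \<open>The solution with the earlier start is at \<open>?z\<close> when the later one sets out
  from 0; growth over time \<open>h\<close> bounds \<open>?z\<close>, and contraction over time
  \<open>r\<close> acts on the difference. That \<open>L\<close> does not depend on
  \<open>\<tau>\<close> is the source of temperedness.\<close>

lemma pullback_estimates:
  assumes \<omega>: "\<omega> \<in> \<Omega>" and rate: "cover_rate \<mu> \<omega>" and \<delta>: "\<delta> > 0"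
  obtains L where
    "\<And>\<tau> r h. r \<ge> 0 \<Longrightarrow> h \<ge> 0 \<Longrightarrow> norm (pullback (wiener_shift \<tau> \<omega>) (r + h) - pullback (wiener_shift \<tau> \<omega>) r) \<le>
       exp (- (\<kappa> / 4) * r + \<delta> * \<bar>\<tau>\<bar> + (growth_rate + \<delta>) * h + L)"
    "\<And>\<tau>. norm (pullback (wiener_shift \<tau> \<omega>) 0) \<le> exp (\<delta> * \<bar>\<tau>\<bar> + L)"
proof -
  \<comment> \<open>The moduli of times in the exponent add up to at most
    \<open>4 * \<bar>\<tau>\<bar> + 3 * r + h\<close>. The part with \<open>r\<close> may consume
    \<open>\<kappa> / 4\<close> of the rate \<open>\<kappa> / 2\<close>.\<close>
  define \<epsilon> where "\<epsilon> = min (\<delta> / 4) (\<kappa> / 12)"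
  have \<epsilon>: "\<epsilon> > 0" "4 * \<epsilon> \<le> \<delta>" "12 * \<epsilon> \<le> \<kappa>" using \<delta> \<kappa> by (auto simp: \<epsilon>_def)
  obtain L0 where L0:
    "\<And>s t x y. s \<le> t \<Longrightarrow> norm (\<phi> (t - s) (wiener_shift s \<omega>) x - \<phi> (t - s) (wiener_shift s \<omega>) y) \<le>
       exp (- (\<kappa> / 2) * (t - s) + \<epsilon> * (\<bar>s\<bar> + \<bar>t\<bar>) + L0) * norm (x - y)"
    "\<And>s t. s \<le> t \<Longrightarrow> norm (\<phi> (t - s) (wiener_shift s \<omega>) 0) \<le>
       exp (growth_rate * (t - s) + \<epsilon> * (\<bar>s\<bar> + \<bar>t\<bar>) + L0)"
    using uniform_estimates[OF \<omega> rate \<epsilon>(1)] by blast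
  have shift': "pullback (wiener_shift \<tau> \<omega>) r = \<phi> (\<tau> - (\<tau> - r)) (wiener_shift (\<tau> - r) \<omega>) 0" for \<tau> r
    by (simp add: pullback_def wiener_shift_shift)
  define L where "L = 2 * \<bar>L0\<bar>"
  show thesis
  proof (rule that[of L])
    fix \<tau> r h :: real assume r: "r \<ge> 0" and h: "h \<ge> 0"
    let ?z = "\<phi> ((\<tau> - r) - (\<tau> - (r + h))) (wiener_shift (\<tau> - (r + h)) \<omega>) 0"
    have "pullback (wiener_shift \<tau> \<omega>) (r + h) = \<phi> (\<tau> - (\<tau> - r)) (wiener_shift (\<tau> - r) \<omega>) ?z"
      unfolding shift' by (rule cocycle_between[OF \<omega>]) (use r h in auto)
    then have "norm (pullback (wiener_shift \<tau> \<omega>) (r + h) - pullback (wiener_shift \<tau> \<omega>) r) \<le>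
        exp (- (\<kappa> / 2) * (\<tau> - (\<tau> - r)) + \<epsilon> * (\<bar>\<tau> - r\<bar> + \<bar>\<tau>\<bar>) + L0) * norm (?z - 0)"
      unfolding shift'[of _ r] using L0(1)[of "\<tau> - r" \<tau> ?z 0] r by simp
    also have "\<dots> \<le> exp (- (\<kappa> / 2) * (\<tau> - (\<tau> - r)) + \<epsilon> * (\<bar>\<tau> - r\<bar> + \<bar>\<tau>\<bar>) + L0) *
        exp (growth_rate * ((\<tau> - r) - (\<tau> - (r + h))) + \<epsilon> * (\<bar>\<tau> - (r + h)\<bar> + \<bar>\<tau> - r\<bar>) + L0)"
      using L0(2)[of "\<tau> - (r + h)" "\<tau> - r"] h by (intro mult_left_mono) auto
    also have "\<dots> = exp (- (\<kappa> / 2) * r + growth_rate * h + \<epsilon> * (\<bar>\<tau> - r\<bar> + \<bar>\<tau>\<bar> + \<bar>\<tau> - (r + h)\<bar> + \<bar>\<tau> - r\<bar>) + 2 * L0)"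
      unfolding exp_add[symmetric] by (simp add: algebra_simps)
    also have "\<dots> \<le> exp (- (\<kappa> / 4) * r + \<delta> * \<bar>\<tau>\<bar> + (growth_rate + \<delta>) * h + L)"
    proof -
      have "\<epsilon> * (\<bar>\<tau> - r\<bar> + \<bar>\<tau>\<bar> + \<bar>\<tau> - (r + h)\<bar> + \<bar>\<tau> - r\<bar>) \<le> \<epsilon> * (4 * \<bar>\<tau>\<bar> + 3 * r + h)"
        by (rule mult_left_mono) (use \<epsilon> r h in linarith)+
      also have "\<dots> = (4 * \<epsilon>) * \<bar>\<tau>\<bar> + (12 * \<epsilon>) * (r / 4) + \<epsilon> * h" by (simp add: algebra_simps)
      also have "\<dots> \<le> \<delta> * \<bar>\<tau>\<bar> + \<kappa> * (r / 4) + \<delta> * h"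
        using \<epsilon> r h by (intro add_mono mult_right_mono) auto
      finally show ?thesis by (simp add: L_def algebra_simps)
    qed
    finally show "norm (pullback (wiener_shift \<tau> \<omega>) (r + h) - pullback (wiener_shift \<tau> \<omega>) r) \<le>
       exp (- (\<kappa> / 4) * r + \<delta> * \<bar>\<tau>\<bar> + (growth_rate + \<delta>) * h + L)" .
  next
    fix \<tau> :: real
    have "norm (pullback (wiener_shift \<tau> \<omega>) 0) \<le> exp (\<epsilon> * (2 * \<bar>\<tau>\<bar>) + L0)"
      unfolding shift' using L0(2)[of \<tau> \<tau>] by simp
    also have "\<dots> \<le> exp (\<delta> * \<bar>\<tau>\<bar> + L)"
    proof -
      have "(2 * \<epsilon>) * \<bar>\<tau>\<bar> \<le> \<delta> * \<bar>\<tau>\<bar>" using \<epsilon> by (intro mult_right_mono) auto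
      then show ?thesis by (simp add: L_def)
    qed
    finally show "norm (pullback (wiener_shift \<tau> \<omega>) 0) \<le> exp (\<delta> * \<bar>\<tau>\<bar> + L)" .
  qed
qed

lemma geometric_tail: "summable (\<lambda>k. exp (- (\<kappa> / 4) * real k + D))"
proof -
  have "(\<lambda>k. exp (- (\<kappa> / 4) * real k + D)) = (\<lambda>k. exp D * exp (- (\<kappa> / 4)) ^ k)"
    by (rule ext) (subst exp_of_nat_mult[symmetric], simp only: exp_add[symmetric] add.commute mult.commute)
  moreover have "summable (\<lambda>k. exp D * exp (- (\<kappa> / 4)) ^ k)"
    using \<kappa> by (intro summable_mult summable_geometric) simp
  ultimately show ?thesis by simp
qed

text \<open>Telescoping with steps \<open>h = 1\<close>: the increments are dominated by one
  geometric series, and \<tau> enters only through the factor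
  \<open>exp (\<delta> * \<bar>\<tau>\<bar>)\<close>.\<close>

lemma equilibrium_limit_bound:
  assumes \<omega>: "\<omega> \<in> \<Omega>" and rate: "cover_rate \<mu> \<omega>" and \<delta>: "\<delta> > 0"
  shows "(\<lambda>n. pullback (wiener_shift \<tau> \<omega>) (real n)) \<longlonglongrightarrow> equilibrium (wiener_shift \<tau> \<omega>)"
    "\<exists>L. \<forall>\<tau>. norm (equilibrium (wiener_shift \<tau> \<omega>)) \<le> exp (\<delta> * \<bar>\<tau>\<bar> + L)"
proof -
  obtain L where L:
    "\<And>\<tau> r h. r \<ge> 0 \<Longrightarrow> h \<ge> 0 \<Longrightarrow> norm (pullback (wiener_shift \<tau> \<omega>) (r + h) - pullback (wiener_shift \<tau> \<omega>) r) \<le>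
       exp (- (\<kappa> / 4) * r + \<delta> * \<bar>\<tau>\<bar> + (growth_rate + \<delta>) * h + L)"
    "\<And>\<tau>. norm (pullback (wiener_shift \<tau> \<omega>) 0) \<le> exp (\<delta> * \<bar>\<tau>\<bar> + L)"
    using pullback_estimates[OF \<omega> rate \<delta>] by blast
  define D where "D \<tau> = \<delta> * \<bar>\<tau>\<bar> + (growth_rate + \<delta>) + L" for \<tau>
  define p where "p \<tau> n = pullback (wiener_shift \<tau> \<omega>) (real n)" for \<tau> and n :: nat
  have step: "norm (p \<tau> (Suc k) - p \<tau> k) \<le> exp (- (\<kappa> / 4) * real k + D \<tau>)" for \<tau> k
    using L(1)[of "real k" 1 \<tau>] by (simp add: p_def D_def algebra_simps)
  have tel: "(\<Sum>k<n. p \<tau> (Suc k) - p \<tau> k) = p \<tau> n - p \<tau> 0" for \<tau> n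
    by (rule sum_lessThan_telescope)
  have "summable (\<lambda>k. p \<tau> (Suc k) - p \<tau> k)" for \<tau>
    by (rule summable_comparison_test'[OF geometric_tail[of "D \<tau>"], where N=0]) (rule step)
  then have sums: "(\<lambda>n. p \<tau> n - p \<tau> 0) \<longlonglongrightarrow> (\<Sum>k. p \<tau> (Suc k) - p \<tau> k)" for \<tau>
    using summable_LIMSEQ[of "\<lambda>k. p \<tau> (Suc k) - p \<tau> k"] by (simp only: tel)
  have "convergent (p \<tau>)" for \<tau>
    by (rule convergentI) (use tendsto_add[OF sums[of \<tau>] tendsto_const[of "p \<tau> 0"]] in simp)
  then have lim: "p \<tau> \<longlonglongrightarrow> equilibrium (wiener_shift \<tau> \<omega>)" for \<tau>
    unfolding equilibrium_def p_def[abs_def] by (simp add: convergent_LIMSEQ_iff)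
  then show "(\<lambda>n. pullback (wiener_shift \<tau> \<omega>) (real n)) \<longlonglongrightarrow> equilibrium (wiener_shift \<tau> \<omega>)"
    by (simp add: p_def[abs_def])
  define S where "S = (\<Sum>k. exp (- (\<kappa> / 4) * real k + 0))"
  have S: "S > 0" unfolding S_def by (intro suminf_pos geometric_tail) simp
  define L' where "L' = ln (exp L + exp (growth_rate + \<delta> + L) * S)"
  have "norm (equilibrium (wiener_shift \<tau> \<omega>)) \<le> exp (\<delta> * \<bar>\<tau>\<bar> + L')" for \<tau>
  proof (rule LIMSEQ_le_const2[OF tendsto_norm[OF lim]], intro exI allI impI)
    fix n
    have "norm (p \<tau> n - p \<tau> 0) \<le> (\<Sum>k<n. exp (- (\<kappa> / 4) * real k + D \<tau>))"
      unfolding tel[symmetric] by (intro sum_norm_le step)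
    also have "\<dots> = exp (D \<tau>) * (\<Sum>k<n. exp (- (\<kappa> / 4) * real k + 0))"
      unfolding sum_distrib_left exp_add[symmetric] by (simp add: add.commute)
    also have "\<dots> \<le> exp (D \<tau>) * S"
      unfolding S_def by (intro mult_left_mono sum_le_suminf geometric_tail) auto
    finally have "norm (p \<tau> n) \<le> exp (\<delta> * \<bar>\<tau>\<bar> + L) + exp (D \<tau>) * S"
      using L(2)[of \<tau>] norm_triangle_sub[of "p \<tau> n" "p \<tau> 0"] by (simp add: p_def)
    also have "\<dots> = exp (\<delta> * \<bar>\<tau>\<bar>) * (exp L + exp (growth_rate + \<delta> + L) * S)"
      by (simp add: D_def exp_add algebra_simps)
    also have "exp L + exp (growth_rate + \<delta> + L) * S = exp L'"
      unfolding L'_def using S by (subst exp_ln) (auto intro: add_pos_pos)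
    finally show "norm (p \<tau> n) \<le> exp (\<delta> * \<bar>\<tau>\<bar> + L')" by (simp add: exp_add)
  qed
  then show "\<exists>L. \<forall>\<tau>. norm (equilibrium (wiener_shift \<tau> \<omega>)) \<le> exp (\<delta> * \<bar>\<tau>\<bar> + L)" by blast
qed

text \<open>The cocycle maps the approximation of age \<open>n\<close> to the approximation of age
  \<open>n + t\<close> for the shifted path, which differs from that of age \<open>n\<close> by an
  exponentially small amount.\<close>

lemma equilibrium_invariant:
  assumes \<omega>: "\<omega> \<in> \<Omega>" and rate: "cover_rate \<mu> \<omega>" and t: "t \<ge> 0"
  shows "\<phi> t \<omega> (equilibrium \<omega>) = equilibrium (wiener_shift t \<omega>)"
proof -
  have lim0: "(\<lambda>n. pullback \<omega> (real n)) \<longlonglongrightarrow> equilibrium \<omega>"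
    using equilibrium_limit_bound(1)[OF \<omega> rate, of 1 0] shift_0[OF \<omega>] by simp
  have limt: "(\<lambda>n. pullback (wiener_shift t \<omega>) (real n)) \<longlonglongrightarrow> equilibrium (wiener_shift t \<omega>)"
    using equilibrium_limit_bound(1)[OF \<omega> rate, of 1 t] by simp
  have "isCont (\<phi> t \<omega>) (equilibrium \<omega>)" using cont[OF \<omega> t] by (simp add: continuous_on_eq_continuous_at)
  then have 1: "(\<lambda>n. \<phi> t \<omega> (pullback \<omega> (real n))) \<longlonglongrightarrow> \<phi> t \<omega> (equilibrium \<omega>)"
    by (rule isCont_tendsto_compose[OF _ lim0])
  have eq: "\<phi> t \<omega> (pullback \<omega> (real n)) = pullback (wiener_shift t \<omega>) (real n + t)" for n
    using cocycle_between[OF \<omega>, of "- real n" 0 t 0] t shift_0[OF \<omega>]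
    by (simp add: pullback_def wiener_shift_shift add.commute)
  obtain L where L:
    "\<And>\<tau> r h. r \<ge> 0 \<Longrightarrow> h \<ge> 0 \<Longrightarrow> norm (pullback (wiener_shift \<tau> \<omega>) (r + h) - pullback (wiener_shift \<tau> \<omega>) r) \<le>
       exp (- (\<kappa> / 4) * r + 1 * \<bar>\<tau>\<bar> + (growth_rate + 1) * h + L)"
    "\<And>\<tau>. norm (pullback (wiener_shift \<tau> \<omega>) 0) \<le> exp (1 * \<bar>\<tau>\<bar> + L)"
    using pullback_estimates[OF \<omega> rate zero_less_one] by blast
  have "(\<lambda>n. pullback (wiener_shift t \<omega>) (real n + t) - pullback (wiener_shift t \<omega>) (real n)) \<longlonglongrightarrow> 0"
  proof (rule Lim_null_comparison)
    show "(\<lambda>n. exp (- (\<kappa> / 4) * real n + (1 * \<bar>t\<bar> + (growth_rate + 1) * t + L))) \<longlonglongrightarrow> 0"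
      by (rule summable_LIMSEQ_zero[OF geometric_tail])
    show "\<forall>\<^sub>F n in sequentially. norm (pullback (wiener_shift t \<omega>) (real n + t) - pullback (wiener_shift t \<omega>) (real n))
      \<le> exp (- (\<kappa> / 4) * real n + (1 * \<bar>t\<bar> + (growth_rate + 1) * t + L))"
    proof (rule always_eventually, rule allI)
      fix n
      show "norm (pullback (wiener_shift t \<omega>) (real n + t) - pullback (wiener_shift t \<omega>) (real n))
        \<le> exp (- (\<kappa> / 4) * real n + (1 * \<bar>t\<bar> + (growth_rate + 1) * t + L))"
        using L(1)[of "real n" t t] t by (simp add: algebra_simps)
    qed
  qed
  from tendsto_add[OF this limt]
  have "(\<lambda>n. \<phi> t \<omega> (pullback \<omega> (real n))) \<longlonglongrightarrow> equilibrium (wiener_shift t \<omega>)" by (simp add: eq)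
  with 1 show ?thesis by (rule LIMSEQ_unique)
qed

text \<open>The comparison solution starts on the equilibrium at time \<open>- t\<close>, which is
  of subexponential size and which invariance carries to \<open>equilibrium \<omega>\<close>. The
  rate is therefore the same for all \<open>\<rho>\<close>; only the time from which the bound holds
  varies.\<close>

lemma equilibrium_attracts:
  assumes \<omega>: "\<omega> \<in> \<Omega>" and rate: "cover_rate \<mu> \<omega>"
    and \<rho>: "\<And>t. \<rho> (wiener_shift t \<omega>) > 0" "((\<lambda>t. 1 / t * ln (\<rho> (wiener_shift t \<omega>))) \<longlongrightarrow> 0) at_bot"
  shows "\<forall>\<^sub>F t in at_top. \<forall>x. norm x < \<rho> (wiener_shift (- t) \<omega>) \<longrightarrow>
    norm (\<phi> t (wiener_shift (- t) \<omega>) x - equilibrium \<omega>) \<le> exp (- (\<kappa> / 4) * t)"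
proof -
  \<comment> \<open>Twice \<open>\<epsilon>\<close> takes \<open>\<kappa> / 8\<close> of the rate
    \<open>\<kappa> / 2\<close>, and for large \<open>t\<close> the constant \<open>D\<close> takes
    another \<open>\<kappa> / 8\<close>.\<close>
  define \<epsilon> where "\<epsilon> = \<kappa> / 16"
  have \<epsilon>: "\<epsilon> > 0" using \<kappa> by (simp add: \<epsilon>_def)
  obtain L where L: "\<And>s t x y. s \<le> t \<Longrightarrow> norm (\<phi> (t - s) (wiener_shift s \<omega>) x - \<phi> (t - s) (wiener_shift s \<omega>) y) \<le>
       exp (- (\<kappa> / 2) * (t - s) + \<epsilon> * (\<bar>s\<bar> + \<bar>t\<bar>) + L) * norm (x - y)"
    "\<And>s t. s \<le> t \<Longrightarrow> norm (\<phi> (t - s) (wiener_shift s \<omega>) 0) \<le>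
       exp (growth_rate * (t - s) + \<epsilon> * (\<bar>s\<bar> + \<bar>t\<bar>) + L)"
    using uniform_estimates[OF \<omega> rate \<epsilon>] by blast
  obtain L' where L': "\<And>\<tau>. norm (equilibrium (wiener_shift \<tau> \<omega>)) \<le> exp (\<epsilon> * \<bar>\<tau>\<bar> + L')"
    using equilibrium_limit_bound(2)[OF \<omega> rate \<epsilon>] by blast
  define D where "D = L + ln (1 + exp L')"
  have "((\<lambda>t. 1 / (- t) * ln (\<rho> (wiener_shift (- t) \<omega>))) \<longlongrightarrow> 0) at_top"
    by (rule filterlim_compose[OF \<rho>(2) filterlim_uminus_at_bot_at_top])
  then have "\<forall>\<^sub>F t in at_top. dist (1 / (- t) * ln (\<rho> (wiener_shift (- t) \<omega>))) 0 < \<epsilon>"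
    using \<epsilon> by (rule tendstoD)
  moreover have "\<forall>\<^sub>F t in at_top. t \<ge> max 1 (8 * D / \<kappa>)" by (rule eventually_ge_at_top)
  ultimately show ?thesis
  proof eventually_elim
    case (elim t)
    then have t: "t \<ge> 1" "D \<le> \<kappa> / 8 * t" using \<kappa> by (auto simp: field_simps)
    have "\<bar>ln (\<rho> (wiener_shift (- t) \<omega>))\<bar> < \<epsilon> * t" using elim t by (simp add: abs_mult field_simps)
    then have ln: "ln (\<rho> (wiener_shift (- t) \<omega>)) < \<epsilon> * t" by simp
    have r: "\<rho> (wiener_shift (- t) \<omega>) \<le> exp (\<epsilon> * t)"
    proof -
      have "\<rho> (wiener_shift (- t) \<omega>) = exp (ln (\<rho> (wiener_shift (- t) \<omega>)))"
        by (rule exp_ln[symmetric, OF \<rho>(1)])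
      also have "\<dots> \<le> exp (\<epsilon> * t)" using ln by simp
      finally show ?thesis .
    qed
    have inv: "equilibrium \<omega> = \<phi> (0 - (- t)) (wiener_shift (- t) \<omega>) (equilibrium (wiener_shift (- t) \<omega>))"
      using equilibrium_invariant[OF shift[OF \<omega>] cover_rate_shift[OF rate], of t "- t"] t shift_0[OF \<omega>]
      by (simp add: wiener_shift_shift)
    show ?case
    proof (intro allI impI)
      fix x :: 'a assume x: "norm x < \<rho> (wiener_shift (- t) \<omega>)"
      have "norm (\<phi> t (wiener_shift (- t) \<omega>) x - equilibrium \<omega>) \<le>
          exp (- (\<kappa> / 2) * t + \<epsilon> * t + L) * norm (x - equilibrium (wiener_shift (- t) \<omega>))"
        unfolding inv using L(1)[of "- t" 0 x "equilibrium (wiener_shift (- t) \<omega>)"] t by simp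
      also have "\<dots> \<le> exp (- (\<kappa> / 2) * t + \<epsilon> * t + L) * (exp (\<epsilon> * t) * (1 + exp L'))"
      proof (rule mult_left_mono)
        have "norm (x - equilibrium (wiener_shift (- t) \<omega>)) \<le> norm x + norm (equilibrium (wiener_shift (- t) \<omega>))"
          by (rule norm_triangle_ineq4)
        also have "\<dots> \<le> exp (\<epsilon> * t) + exp (\<epsilon> * t + L')"
          using x r L'[of "- t"] t by (intro add_mono) auto
        finally show "norm (x - equilibrium (wiener_shift (- t) \<omega>)) \<le> exp (\<epsilon> * t) * (1 + exp L')"
          by (simp add: exp_add algebra_simps)
      qed simp
      also have "1 + exp L' = exp (ln (1 + exp L'))" by (simp add: add_pos_pos)
      also have "exp (- (\<kappa> / 2) * t + \<epsilon> * t + L) * (exp (\<epsilon> * t) * exp (ln (1 + exp L'))) =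
          exp (- (\<kappa> / 2) * t + 2 * \<epsilon> * t + D)"
        unfolding exp_add[symmetric] by (simp add: D_def)
      also have "\<dots> \<le> exp (- (\<kappa> / 4) * t)" using t(2) by (simp add: \<epsilon>_def field_simps)
      finally show "norm (\<phi> t (wiener_shift (- t) \<omega>) x - equilibrium \<omega>) \<le> exp (- (\<kappa> / 4) * t)" .
    qed
  qed
qed

end

section \<open>Semidistance to a point and its logarithm\<close>

lemma semidist_singleton_bounds:
  assumes "E \<noteq> {}" "\<And>x. x \<in> E \<Longrightarrow> dist x a \<le> r"
  shows "0 \<le> semidist E {a}" "semidist E {a} \<le> ereal r"
proof -
  obtain x where "x \<in> E" using assms(1) by blast
  then show "0 \<le> semidist E {a}"
    unfolding semidist_def by (intro SUP_upper2[of x]) (auto simp: infdist_nonneg)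
  show "semidist E {a} \<le> ereal r"
    unfolding semidist_def using assms(2) by (intro SUP_least) simp
qed

lemma scaled_ereal_ln_le:
  assumes "s \<le> ereal (exp (- k * t))" "t > 0"
  shows "ereal (1 / t) * ereal_ln s \<le> ereal (- k)"
proof (cases "s \<le> 0")
  case True
  then show ?thesis using assms(2) by (simp add: ereal_ln_def)
next
  case False
  then obtain r where r: "s = ereal r" "r > 0" using assms(1) by (cases s) auto
  then have "ln r \<le> - k * t" using assms(1) by (metis ereal_less_eq(3) ln_exp ln_le_cancel_iff exp_gt_zero)
  then show ?thesis using r assms(2) by (simp add: ereal_ln_def field_simps)
qed

section \<open>Continuity and measurability of the Wiener shift\<close>

lemma topspace_C0_topology_eq: "topspace C0_topology = C0_paths"
proof -
  have "C0_paths \<in> {{\<omega> \<in> C0_paths. \<omega> ` K \<subseteq> U} | K U. compact K \<and> open U}"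
    by (intro CollectI exI[of _ "{}"]) auto
  then show ?thesis using topspace_C0_topology unfolding C0_topology_def topology_generated_by_topspace by blast
qed

lemma wiener_shift_C0: "\<omega> \<in> C0_paths \<Longrightarrow> wiener_shift t \<omega> \<in> C0_paths"
  unfolding C0_paths_def wiener_shift_def
  by (auto intro!: continuous_intros elim: continuous_on_compose2)

text \<open>Because the shift subtracts the value at \<open>t\<close>, each point of the preimage of
  a subbasic set is given a neighbourhood by hand. The translate of \<open>K\<close> is covered by
  finitely many compact parts on which \<omega> varies little; a path kept close to one value of
  \<omega> on each part, and close to \<omega> at \<open>t\<close>, has a shift close to that of
  \<omega>.\<close>

lemma wiener_shift_continuous: "continuous_map C0_topology C0_topology (wiener_shift t)"
proof -
  have "openin C0_topology (wiener_shift t -` V \<inter> topspace C0_topology)"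
    if "compact K" "open U" and V: "V = {\<omega> \<in> C0_paths. \<omega> ` K \<subseteq> U}" for K U V
  proof (subst openin_subopen, intro ballI)
    fix \<omega> assume "\<omega> \<in> wiener_shift t -` V \<inter> topspace C0_topology"
    then have \<omega>: "\<omega> \<in> C0_paths" and U: "\<And>s. s \<in> K \<Longrightarrow> \<omega> (t + s) - \<omega> t \<in> U"
      by (auto simp: V topspace_C0_topology_eq wiener_shift_def)
    have cont: "continuous_on UNIV \<omega>" using \<omega> by (simp add: C0_paths_def)
    have contg: "continuous_on K (\<lambda>s. \<omega> (t + s))"
      by (rule continuous_on_compose2[OF cont]) (auto intro: continuous_intros)
    have "compact ((\<lambda>s. \<omega> (t + s) - \<omega> t) ` K)"
      by (intro compact_continuous_image continuous_intros contg that)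
    moreover have "(\<lambda>s. \<omega> (t + s) - \<omega> t) ` K \<subseteq> U" using U by blast
    ultimately obtain e where e: "e > 0" "(\<Union>x\<in>(\<lambda>s. \<omega> (t + s) - \<omega> t) ` K. cball x e) \<subseteq> U"
      using compact_subset_open_imp_cball_epsilon_subset[OF _ \<open>open U\<close>] by blast
    obtain d where d: "d > 0" "\<And>s s'. s \<in> K \<Longrightarrow> s' \<in> K \<Longrightarrow> dist s' s < d \<Longrightarrow> dist (\<omega> (t + s')) (\<omega> (t + s)) < e / 4"
      using compact_uniformly_continuous[OF contg \<open>compact K\<close>] e(1)
      unfolding uniformly_continuous_on_def by (elim allE[of _ "e / 4"]) auto
    have "K \<subseteq> (\<Union>x\<in>K. ball x (d / 2))" using d(1) by auto
    then obtain F where F: "F \<subseteq> K" "finite F" "K \<subseteq> (\<Union>x\<in>F. ball x (d / 2))"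
      using compactE_image[OF \<open>compact K\<close>, of K "\<lambda>x. ball x (d / 2)"] open_ball by blast
    \<comment> \<open>Closed balls keep the parts compact, and with radius \<open>d / 2\<close> the
      path \<omega> stays on each part within \<open>e / 4\<close> of its value at the centre. Three
      such errors add up to less than \<open>e\<close>.\<close>
    define N where "N x = {\<omega>' \<in> C0_paths. \<omega>' ` ((+) t ` (K \<inter> cball x (d / 2))) \<subseteq> ball (\<omega> (t + x)) (e / 4)}" for x
    define N0 where "N0 = {\<omega>' \<in> C0_paths. \<omega>' ` {t} \<subseteq> ball (\<omega> t) (e / 4)}"
    have openN: "openin C0_topology (N x)" for x
    proof -
      have "compact ((+) t ` (K \<inter> cball x (d / 2)))"
        using compact_translation[OF compact_Int[OF \<open>compact K\<close> compact_cball]] by simp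
      then show ?thesis unfolding N_def by (rule openin_C0_subbasic) simp
    qed
    have "openin C0_topology N0" unfolding N0_def by (rule openin_C0_subbasic) auto
    moreover have "openin C0_topology (N0 \<inter> (\<Inter>x\<in>F. N x))"
      using F(2) \<open>openin C0_topology N0\<close>
    proof (induction F)
      case (insert x F)
      have "N0 \<inter> (\<Inter>x\<in>insert x F. N x) = N x \<inter> (N0 \<inter> (\<Inter>x\<in>F. N x))" by auto
      then show ?case using insert openN by (simp add: openin_Int)
    qed simp
    moreover have "\<omega> \<in> N0 \<inter> (\<Inter>x\<in>F. N x)"
    proof -
      have "\<omega> \<in> N x" if "x \<in> F" for x
        unfolding N_def using \<omega> d F(1) that by (auto simp: dist_commute)
      then show ?thesis using \<omega> e(1) by (auto simp: N0_def)
    qed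
    moreover have "N0 \<inter> (\<Inter>x\<in>F. N x) \<subseteq> wiener_shift t -` V \<inter> topspace C0_topology"
    proof
      fix \<omega>' assume \<omega>': "\<omega>' \<in> N0 \<inter> (\<Inter>x\<in>F. N x)"
      then have C0: "\<omega>' \<in> C0_paths" by (simp add: N0_def)
      have "\<omega>' (t + s) - \<omega>' t \<in> U" if s: "s \<in> K" for s
      proof -
        obtain x where x: "x \<in> F" "dist x s < d / 2" using F(3) s by auto
        have "\<omega>' \<in> N x" using \<omega>' x by blast
        then have "dist (\<omega> (t + x)) (\<omega>' (t + s)) < e / 4"
          using s x by (auto simp: N_def image_subset_iff)
        moreover have "dist (\<omega> (t + x)) (\<omega> (t + s)) < e / 4"
          using d(2)[of s x] x F(1) s d(1) by auto
        moreover have "dist (\<omega> t) (\<omega>' t) < e / 4" using \<omega>' by (simp add: N0_def)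
        ultimately have "dist (\<omega> (t + s) - \<omega> t) (\<omega>' (t + s) - \<omega>' t) \<le> e"
          unfolding dist_real_def by linarith
        then have "\<omega>' (t + s) - \<omega>' t \<in> cball (\<omega> (t + s) - \<omega> t) e" by simp
        then show ?thesis using e(2) s by blast
      qed
      then show "\<omega>' \<in> wiener_shift t -` V \<inter> topspace C0_topology"
        using C0 wiener_shift_C0[OF C0] by (auto simp: V topspace_C0_topology_eq wiener_shift_def)
    qed
    ultimately show "\<exists>T. openin C0_topology T \<and> \<omega> \<in> T \<and> T \<subseteq> wiener_shift t -` V \<inter> topspace C0_topology"
      by blast
  qed
  note preimage = this
  define S where "S = {{\<omega> \<in> C0_paths. \<omega> ` K \<subseteq> U} | K U. compact K \<and> open U}"
  have S: "topology_generated_by S = C0_topology" by (simp only: C0_topology_def S_def)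
  have "continuous_map C0_topology (topology_generated_by S) (wiener_shift t)"
  proof (rule continuous_on_generated_topo)
    show "openin C0_topology (wiener_shift t -` V \<inter> topspace C0_topology)" if "V \<in> S" for V
      using that preimage unfolding S_def by blast
    have "\<Union> S = C0_paths"
      using topspace_C0_topology_eq unfolding S[symmetric] topology_generated_by_topspace .
    then show "wiener_shift t ` topspace C0_topology \<subseteq> \<Union> S"
      using wiener_shift_C0 by (auto simp: topspace_C0_topology_eq)
  qed
  then show ?thesis unfolding S .
qed

lemma wiener_shift_measurable_borel: "wiener_shift t \<in> measurable borel_C0 borel_C0"
proof -
  have "wiener_shift t \<in> measurable borel_C0 (sigma C0_paths {U. openin C0_topology U})"
  proof (rule measurable_measure_of)
    show "{U. openin C0_topology U} \<subseteq> Pow C0_paths" using openin_subset topspace_C0_topology by blast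
    show "wiener_shift t \<in> space borel_C0 \<rightarrow> C0_paths" by (auto simp: space_borel_C0 wiener_shift_C0)
    fix U assume "U \<in> {U. openin C0_topology U}"
    then have "openin C0_topology {x \<in> topspace C0_topology. wiener_shift t x \<in> U}"
      by (intro openin_continuous_map_preimage[OF wiener_shift_continuous]) auto
    moreover have "{x \<in> topspace C0_topology. wiener_shift t x \<in> U} = wiener_shift t -` U \<inter> space borel_C0"
      by (auto simp: topspace_C0_topology_eq space_borel_C0)
    ultimately show "wiener_shift t -` U \<inter> space borel_C0 \<in> sets borel_C0"
      using sets_borel_C0_openin by metis
  qed
  then show ?thesis by (simp add: borel_C0_def)
qed

lemma admissible_pathsD:
  assumes "fbm_law H P" "admissible_paths \<nu> P \<Omega>" "\<omega> \<in> \<Omega>"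
  shows "locally_Hoelder \<nu> \<omega>" "continuous_on UNIV \<omega>" "\<omega> 0 = 0" "wiener_shift t \<omega> \<in> \<Omega>"
proof -
  have "\<Omega> \<in> sets P" using assms(2) unfolding admissible_paths_def by blast
  moreover have "space P = C0_paths"
    using assms(1) unfolding fbm_law_def by (metis sets_eq_imp_space_eq space_borel_C0)
  ultimately have "\<omega> \<in> C0_paths" using assms(3) sets.sets_into_space by blast
  then show "continuous_on UNIV \<omega>" "\<omega> 0 = 0" by (auto simp: C0_paths_def)
  show "locally_Hoelder \<nu> \<omega>" "wiener_shift t \<omega> \<in> \<Omega>"
    using assms(2,3) unfolding admissible_paths_def by blast+
qed

lemma wiener_shift_measurable:
  assumes "fbm_law H P" "admissible_paths \<nu> P \<Omega>"
  shows "wiener_shift t \<in> measurable (restrict_space P \<Omega>) (restrict_space P \<Omega>)"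
proof (rule measurable_restrict_space3)
  have "sets P = sets borel_C0" using assms(1) unfolding fbm_law_def by blast
  then show "wiener_shift t \<in> measurable P P"
    using wiener_shift_measurable_borel[of t] by (simp cong: measurable_cong_sets)
  show "wiener_shift t \<in> \<Omega> \<rightarrow> \<Omega>" using admissible_pathsD(4)[OF assms] by blast
qed

lemma continuous_rds_measurable:
  assumes "continuous_rds \<theta> M \<phi>" "t \<ge> 0"
  shows "(\<lambda>\<omega>. \<phi> t \<omega> x) \<in> borel_measurable M"
proof -
  have m: "(\<lambda>(t, \<omega>, x). \<phi> t \<omega> x) \<in> borel_measurable (restrict_space borel {0..} \<Otimes>\<^sub>M M \<Otimes>\<^sub>M borel)"
    using assms(1) unfolding continuous_rds_def by blast
  have "(\<lambda>\<omega>. (t, \<omega>, x)) \<in> measurable M (restrict_space borel {0..} \<Otimes>\<^sub>M M \<Otimes>\<^sub>M borel)"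
    using assms(2) by (intro measurable_Pair measurable_const measurable_ident) (auto simp: space_restrict_space)
  from measurable_compose[OF this m] show ?thesis by simp
qed

text \<open>At \<open>c = 0\<close> the rate is \<open>hA - cf\<close>, and by continuity half of it
  survives for small \<open>c\<close>. A right-sided limit does not see \<open>c = 0\<close> itself,
  which is treated apart.\<close>

lemma small_noise_rate:
  fixes hA cf a :: real
  assumes "hA > cf"
  obtains d where "d > 0" "\<And>c. 0 \<le> c \<Longrightarrow> c < d \<Longrightarrow> (hA - cf) / 2 \<le> hA - cf * exp (2 * c) - a * (exp (2 * c) - 1)"
proof -
  have "((\<lambda>c. hA - cf * exp (2 * c) - a * (exp (2 * c) - 1)) \<longlongrightarrow> hA - cf * exp (2 * 0) - a * (exp (2 * 0) - 1)) (at_right 0)"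
    by (intro tendsto_intros)
  then have "\<forall>\<^sub>F c in at_right 0. (hA - cf) / 2 < hA - cf * exp (2 * c) - a * (exp (2 * c) - 1)"
    using assms by (intro order_tendstoD) auto
  then obtain d where d: "d > 0" "\<And>c. 0 < c \<Longrightarrow> c < d \<Longrightarrow> (hA - cf) / 2 < hA - cf * exp (2 * c) - a * (exp (2 * c) - 1)"
    unfolding eventually_at_right_field by auto
  show thesis
  proof (rule that[OF d(1)])
    fix c :: real assume "0 \<le> c" "c < d"
    then show "(hA - cf) / 2 \<le> hA - cf * exp (2 * c) - a * (exp (2 * c) - 1)"
      using d(2)[of c] assms by (cases "c = 0") auto
  qed
qed

text \<open>A piece from \<open>a\<close> to \<open>b\<close> becomes, for the path shifted by
  \<open>a\<close>, the interval from 0 to \<open>b - a\<close>, on which that path is at most 1 in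
  modulus. The 1 under the root bounds the length of a piece.\<close>

lemma young_rds_contracting_cocycle:
  fixes A C :: "real^'n^'n" and f :: "real^'n \<Rightarrow> real^'n"
  assumes law: "fbm_law H P" and adm: "admissible_paths \<nu> P \<Omega>" and \<nu>: "1/2 < \<nu>"
    and A: "\<And>x. x \<bullet> (A *v x) \<le> - hA * (norm x)\<^sup>2"
    and f: "\<And>x y. norm (f x - f y) \<le> cf * norm (x - y)" and cf: "cf \<ge> 0"
    and rds: "young_rds A f C (restrict_space P \<Omega>) \<phi>"
    and \<kappa>: "\<kappa> \<le> hA - cf * exp (2 * onorm ((*v) C)) - onorm ((*v) A) * (exp (2 * onorm ((*v) C)) - 1)" "\<kappa> > 0"
    and \<mu>: "\<mu> \<ge> 0" "onorm ((*v) C) * \<mu> \<le> \<kappa> / 2"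
  shows "contracting_cocycle \<phi> \<Omega> (onorm ((*v) C)) \<kappa> (exp (onorm ((*v) C)) * norm (f 0) * sqrt (1 / (2 * \<kappa>))) \<mu>"
proof
  note D = admissible_pathsD[OF law adm]
  have "\<Omega> \<subseteq> space P"
    using adm sets.sets_into_space unfolding admissible_paths_def by blast
  then have space: "space (restrict_space P \<Omega>) = \<Omega>" by (auto simp: space_restrict_space)
  have crds: "continuous_rds wiener_shift (restrict_space P \<Omega>) \<phi>"
    and sol: "\<And>\<omega> x0. \<omega> \<in> \<Omega> \<Longrightarrow> young_solution A f C \<omega> x0 (\<lambda>t. \<phi> t \<omega> x0)"
    using rds unfolding young_rds_def space by blast+
  show "wiener_shift t \<omega> \<in> \<Omega>" if "\<omega> \<in> \<Omega>" for \<omega> t by (rule D(4)[OF that])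
  show "wiener_shift 0 \<omega> = \<omega>" if "\<omega> \<in> \<Omega>" for \<omega> using D(3)[OF that] by (simp add: wiener_shift_def)
  show "\<phi> (t + s) \<omega> x = \<phi> t (wiener_shift s \<omega>) (\<phi> s \<omega> x)" if "\<omega> \<in> \<Omega>" "s \<ge> 0" "t \<ge> 0" for \<omega> s t x
  proof -
    have "\<phi> (t + s) \<omega> = \<phi> t (wiener_shift s \<omega>) \<circ> \<phi> s \<omega>"
      using crds that unfolding continuous_rds_def space by blast
    then show ?thesis by simp
  qed
  show "continuous_on UNIV (\<phi> t \<omega>)" if "\<omega> \<in> \<Omega>" "t \<ge> 0" for \<omega> t
  proof -
    have "continuous_on ({0..} \<times> UNIV) (\<lambda>(t, x). \<phi> t \<omega> x)"
      using crds that(1) unfolding continuous_rds_def space by blast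
    then have "continuous_on UNIV (\<lambda>x. (\<lambda>(t, x). \<phi> t \<omega> x) (t, x))"
      by (rule continuous_on_compose2) (use that in \<open>auto intro!: continuous_intros\<close>)
    then show ?thesis by simp
  qed
  have piece: "locally_Hoelder \<nu> (wiener_shift a \<omega>)" "continuous_on UNIV (wiener_shift a \<omega>)" "wiener_shift a \<omega> 0 = 0"
      "0 \<le> b - a" "b - a \<le> 1" "\<And>r. r \<in> {0..b - a} \<Longrightarrow> \<bar>wiener_shift a \<omega> r\<bar> \<le> 1"
      "\<And>x. young_solution A f C (wiener_shift a \<omega>) x (\<lambda>t. \<phi> t (wiener_shift a \<omega>) x)"
    if "\<omega> \<in> \<Omega>" and cover: "osc_cover \<omega> a b 1" for \<omega> a b
  proof -
    show "locally_Hoelder \<nu> (wiener_shift a \<omega>)" "continuous_on UNIV (wiener_shift a \<omega>)" "wiener_shift a \<omega> 0 = 0"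
      using D(1-3)[OF D(4)[OF that(1)]] by auto
    show "0 \<le> b - a" "b - a \<le> 1" using osc_cover_le[OF cover] osc_cover_1D(1)[OF cover] by auto
    show "\<bar>wiener_shift a \<omega> r\<bar> \<le> 1" if "r \<in> {0..b - a}" for r
      using osc_cover_1D(2)[OF cover, of "a + r" a] that by (auto simp: wiener_shift_def)
    show "young_solution A f C (wiener_shift a \<omega>) x (\<lambda>t. \<phi> t (wiener_shift a \<omega>) x)" for x
      by (rule sol[OF D(4)[OF that(1)]])
  qed
  show "norm (\<phi> (b - a) (wiener_shift a \<omega>) x - \<phi> (b - a) (wiener_shift a \<omega>) y) \<le>
      exp (onorm ((*v) C) - \<kappa> * (b - a)) * norm (x - y)" if "\<omega> \<in> \<Omega>" "osc_cover \<omega> a b 1" for \<omega> a b x y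
    by (rule young_solution_contraction[OF A f cf piece(1)[OF that] \<nu> piece(2,3,4,6)[OF that] refl \<kappa> piece(7,7)[OF that]])
  show "norm (\<phi> (b - a) (wiener_shift a \<omega>) x) \<le>
      exp (onorm ((*v) C)) * (norm x + exp (onorm ((*v) C)) * norm (f 0) * sqrt (1 / (2 * \<kappa>)))"
    if "\<omega> \<in> \<Omega>" "osc_cover \<omega> a b 1" for \<omega> a b x
  proof -
    have "norm (\<phi> (b - a) (wiener_shift a \<omega>) x) \<le>
      exp (onorm ((*v) C)) * (norm x + exp (onorm ((*v) C)) * norm (f 0) * sqrt ((b - a) / (2 * \<kappa>)))"
      by (rule young_solution_growth[OF A f cf piece(1)[OF that] \<nu> piece(2,3,4,6)[OF that] refl \<kappa> piece(7)[OF that]])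
    also have "\<dots> \<le> exp (onorm ((*v) C)) * (norm x + exp (onorm ((*v) C)) * norm (f 0) * sqrt (1 / (2 * \<kappa>)))"
      using piece(5)[OF that] \<kappa>(2) by (intro mult_left_mono add_left_mono real_sqrt_le_mono divide_right_mono) auto
    finally show ?thesis .
  qed
  show "0 \<le> onorm ((*v) C)" using norm_ge_zero[of "endo_of_matrix C"] by (simp add: norm_endo_of_matrix)
qed (use \<kappa> \<mu> in auto)

section \<open>The equilibrium as a random attractor\<close>

context contracting_cocycle
begin

context
  fixes M :: "(real \<Rightarrow> real) measure"
  assumes space: "space M = \<Omega>" and rate: "AE \<omega> in M. cover_rate \<mu> \<omega>"
    and shift_measurable: "\<And>t. wiener_shift t \<in> measurable M M"
    and \<phi>_measurable: "\<And>t x. t \<ge> 0 \<Longrightarrow> (\<lambda>\<omega>. \<phi> t \<omega> x) \<in> borel_measurable M"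
begin

lemma equilibrium_measurable: "equilibrium \<in> borel_measurable M"
proof -
  have "(\<lambda>\<omega>. pullback \<omega> (real n)) \<in> borel_measurable M" for n
    unfolding pullback_def by (rule measurable_compose[OF shift_measurable \<phi>_measurable]) simp
  then have "(\<lambda>\<omega>. lim (\<lambda>n. pullback \<omega> (real n))) \<in> borel_measurable M" by (rule borel_measurable_lim_metric)
  then show ?thesis by (simp add: equilibrium_def[abs_def])
qed

text \<open>Adding 1 to the norm makes the radius positive and its logarithm nonnegative, so that
  the upper bound of \<open>equilibrium_limit_bound\<close> alone controls the modulus of the
  logarithm.\<close>

lemma equilibrium_tempered: "(\<lambda>\<omega>. {equilibrium \<omega>}) \<in> tempered_sets wiener_shift M"
  unfolding tempered_sets_def
proof (intro CollectI conjI exI[of _ "\<lambda>\<omega>. norm (equilibrium \<omega>) + 1"] ballI)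
  show "random_set M (\<lambda>\<omega>. {equilibrium \<omega>})"
    using equilibrium_measurable by (simp add: random_set_def)
  show "{equilibrium \<omega>} \<subseteq> ball 0 (norm (equilibrium \<omega>) + 1)" for \<omega> by simp
  show "tempered_variable wiener_shift M (\<lambda>\<omega>. norm (equilibrium \<omega>) + 1)"
    unfolding tempered_variable_def
  proof (intro conjI ballI)
    show "(\<lambda>\<omega>. norm (equilibrium \<omega>) + 1) \<in> borel_measurable M" using equilibrium_measurable by measurable
    show "0 < norm (equilibrium \<omega>) + 1" for \<omega> by (simp add: add_nonneg_pos)
    show "AE \<omega> in M. ((\<lambda>t. 1 / t * ln (norm (equilibrium (wiener_shift t \<omega>)) + 1)) \<longlongrightarrow> 0) at_top \<and>
                 ((\<lambda>t. 1 / t * ln (norm (equilibrium (wiener_shift t \<omega>)) + 1)) \<longlongrightarrow> 0) at_bot"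
      using rate AE_space
    proof eventually_elim
      case (elim \<omega>)
      have "((\<lambda>t. 1 / t * ln (norm (equilibrium (wiener_shift t \<omega>)) + 1)) \<longlongrightarrow> 0) at_infinity"
      proof (rule tendsto_sublinear)
        fix \<delta> :: real assume \<delta>: "\<delta> > 0"
        obtain L where L: "\<And>t. norm (equilibrium (wiener_shift t \<omega>)) \<le> exp (\<delta> * \<bar>t\<bar> + L)"
          using equilibrium_limit_bound(2)[OF _ elim(1) \<delta>] elim(2) space by blast
        show "\<exists>L. \<forall>t. \<bar>ln (norm (equilibrium (wiener_shift t \<omega>)) + 1)\<bar> \<le> \<delta> * \<bar>t\<bar> + L"
        proof (intro exI[of _ "\<bar>L\<bar> + ln 2"] allI)
          fix t
          have "norm (equilibrium (wiener_shift t \<omega>)) + 1 \<le> exp (\<delta> * \<bar>t\<bar> + \<bar>L\<bar>) + exp (\<delta> * \<bar>t\<bar> + \<bar>L\<bar>)"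
            using \<delta> by (intro add_mono order_trans[OF L]) auto
          also have "\<dots> = exp (\<delta> * \<bar>t\<bar> + (\<bar>L\<bar> + ln 2))" by (simp add: exp_add)
          finally have "ln (norm (equilibrium (wiener_shift t \<omega>)) + 1) \<le> ln (exp (\<delta> * \<bar>t\<bar> + (\<bar>L\<bar> + ln 2)))"
            by (intro ln_mono) (auto simp: add_nonneg_pos)
          then show "\<bar>ln (norm (equilibrium (wiener_shift t \<omega>)) + 1)\<bar> \<le> \<delta> * \<bar>t\<bar> + (\<bar>L\<bar> + ln 2)" by simp
        qed
      qed
      then show ?case
        using tendsto_mono[OF at_top_le_at_infinity] tendsto_mono[OF at_bot_le_at_infinity] by blast
    qed
  qed
qed

text \<open>The common source of attraction and of the exponential rate; the lower bound serves to
  squeeze the semidistance to 0.\<close>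

lemma semidist_exponentially_small:
  assumes "D \<in> tempered_sets wiener_shift M"
  shows "AE \<omega> in M. \<forall>\<^sub>F t in at_top.
    0 \<le> semidist (\<phi> t (wiener_shift (- t) \<omega>) ` D (wiener_shift (- t) \<omega>)) {equilibrium \<omega>} \<and>
    semidist (\<phi> t (wiener_shift (- t) \<omega>) ` D (wiener_shift (- t) \<omega>)) {equilibrium \<omega>} \<le> ereal (exp (- (\<kappa> / 4) * t))"
proof -
  obtain \<rho> where \<rho>: "tempered_variable wiener_shift M \<rho>" "\<And>\<omega>. \<omega> \<in> \<Omega> \<Longrightarrow> D \<omega> \<subseteq> ball 0 (\<rho> \<omega>)"
    and ne: "\<And>\<omega>. \<omega> \<in> \<Omega> \<Longrightarrow> D \<omega> \<noteq> {}"
    using assms unfolding tempered_sets_def random_set_def space by blast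
  have pos: "\<And>\<omega>. \<omega> \<in> \<Omega> \<Longrightarrow> \<rho> \<omega> > 0"
    and "AE \<omega> in M. ((\<lambda>t. 1 / t * ln (\<rho> (wiener_shift t \<omega>))) \<longlongrightarrow> 0) at_top \<and>
                 ((\<lambda>t. 1 / t * ln (\<rho> (wiener_shift t \<omega>))) \<longlongrightarrow> 0) at_bot"
    using \<rho>(1) unfolding tempered_variable_def space by auto
  from this(2) rate AE_space show ?thesis
  proof eventually_elim
    case (elim \<omega>)
    then have \<omega>: "\<omega> \<in> \<Omega>" by (simp add: space)
    have "\<forall>\<^sub>F t in at_top. \<forall>x. norm x < \<rho> (wiener_shift (- t) \<omega>) \<longrightarrow>
      norm (\<phi> t (wiener_shift (- t) \<omega>) x - equilibrium \<omega>) \<le> exp (- (\<kappa> / 4) * t)"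
      by (rule equilibrium_attracts[OF \<omega> elim(2)]) (use elim(1) pos shift[OF \<omega>] in auto)
    then show ?case
    proof eventually_elim
      case (elim t)
      let ?E = "\<phi> t (wiener_shift (- t) \<omega>) ` D (wiener_shift (- t) \<omega>)"
      have "?E \<noteq> {}" using ne[OF shift[OF \<omega>]] by simp
      moreover have "dist y (equilibrium \<omega>) \<le> exp (- (\<kappa> / 4) * t)" if "y \<in> ?E" for y
        using that elim \<rho>(2)[OF shift[OF \<omega>, of "- t"]] by (auto simp: dist_norm)
      ultimately show ?case by (intro conjI semidist_singleton_bounds)
    qed
  qed
qed

lemma equilibrium_pullback_attractor: "pullback_attractor wiener_shift M \<phi> (\<lambda>\<omega>. {equilibrium \<omega>})"
  unfolding pullback_attractor_def
proof (intro conjI ballI impI equilibrium_tempered)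
  show "AE \<omega> in M. \<forall>t\<ge>0. \<phi> t \<omega> ` {equilibrium \<omega>} = {equilibrium (wiener_shift t \<omega>)}"
    using rate AE_space
  proof eventually_elim
    case (elim \<omega>)
    then show ?case using equilibrium_invariant[of \<omega>] by (simp add: space)
  qed
  fix D :: "(real \<Rightarrow> real) \<Rightarrow> 'a set" assume D: "D \<in> tempered_sets wiener_shift M"
  show "AE \<omega> in M. ((\<lambda>t. semidist (\<phi> t (wiener_shift (- t) \<omega>) ` D (wiener_shift (- t) \<omega>)) {equilibrium \<omega>}) \<longlongrightarrow> 0) at_top"
    using semidist_exponentially_small[OF D]
  proof eventually_elim
    case (elim \<omega>)
    have "((\<lambda>t. exp (- (\<kappa> / 4) * t)) \<longlongrightarrow> 0) at_top" using \<kappa> by real_asymp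
    then have lim: "((\<lambda>t. ereal (exp (- (\<kappa> / 4) * t))) \<longlongrightarrow> 0) at_top" by (simp add: zero_ereal_def)
    show ?case
      by (rule tendsto_sandwich[OF _ _ tendsto_const lim]) (use elim in \<open>auto elim: eventually_mono\<close>)
  qed
qed simp

lemma equilibrium_exponential_convergence:
  assumes "D \<in> tempered_sets wiener_shift M"
  shows "exponential_pullback_convergence wiener_shift M \<phi> D (\<lambda>\<omega>. {equilibrium \<omega>})"
  unfolding exponential_pullback_convergence_def
  using semidist_exponentially_small[OF assms]
proof eventually_elim
  case (elim \<omega>)
  have "Limsup at_top (\<lambda>t. ereal (1 / t) *
        ereal_ln (semidist (\<phi> t (wiener_shift (- t) \<omega>) ` D (wiener_shift (- t) \<omega>)) {equilibrium \<omega>})) \<le> ereal (- (\<kappa> / 4))"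
  proof (rule Limsup_bounded)
    show "\<forall>\<^sub>F t in at_top. ereal (1 / t) *
        ereal_ln (semidist (\<phi> t (wiener_shift (- t) \<omega>) ` D (wiener_shift (- t) \<omega>)) {equilibrium \<omega>}) \<le> ereal (- (\<kappa> / 4))"
      using elim eventually_gt_at_top[of 0]
      by eventually_elim (rule scaled_ereal_ln_le, auto)
  qed
  also have "\<dots> < 0" using \<kappa> by simp
  finally show ?case .
qed

end

end

theorem theorem4p4:
  fixes H \<nu> hA cf :: real
    and P :: "(real \<Rightarrow> real) measure" and \<Omega> :: "(real \<Rightarrow> real) set"
    and A :: "real^'n^'n" and f :: "real^'n \<Rightarrow> real^'n"
  assumes "1/2 < H" "H < 1" and "1/2 < \<nu>" "\<nu> < H"
    and "fbm_law H P" and "admissible_paths \<nu> P \<Omega>"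
    and "hA > 0" "cf > 0"
    and "\<And>x. x \<bullet> (A *v x) \<le> - hA * (norm x)\<^sup>2"
    and "\<And>x y. norm (f x - f y) \<le> cf * norm (x - y)"
    and "hA > cf"
  shows "\<exists>\<epsilon>>0. \<forall>C::real^'n^'n. onorm ((*v) C) < \<epsilon> \<longrightarrow>
    (\<forall>\<phi>. young_rds A f C (restrict_space P \<Omega>) \<phi> \<longrightarrow>
      (\<exists>a. a \<in> borel_measurable (restrict_space P \<Omega>) \<and>
        pullback_attractor wiener_shift (restrict_space P \<Omega>) \<phi> (\<lambda>\<omega>. {a \<omega>}) \<and>
        (\<forall>D\<in>tempered_sets wiener_shift (restrict_space P \<Omega>).
          exponential_pullback_convergence wiener_shift (restrict_space P \<Omega>) \<phi> D (\<lambda>\<omega>. {a \<omega>}))))"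
proof -
  interpret fbm H P using assms by unfold_locales
  let ?M = "restrict_space P \<Omega>"
  have \<Omega>: "\<Omega> \<in> sets P" "AE \<omega> in P. \<omega> \<in> \<Omega>" using assms(6) unfolding admissible_paths_def by blast+
  then have space: "space ?M = \<Omega>" using sets.sets_into_space by (auto simp: space_restrict_space)
  have "AE \<omega> in P. locally_Hoelder \<nu> \<omega> \<and> continuous_on UNIV \<omega>"
    using \<Omega>(2) by eventually_elim (use admissible_pathsD[OF assms(5,6)] in blast)
  then obtain \<mu> where \<mu>: "\<mu> \<ge> 0" "AE \<omega> in P. cover_rate \<mu> \<omega>"
    using AE_cover_rate[OF _ assms(3,4)] by blast
  have rate: "AE \<omega> in ?M. cover_rate \<mu> \<omega>"
    using \<mu>(2) \<Omega>(1) by (auto simp: AE_restrict_space_iff elim: eventually_mono)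
  obtain d where d: "d > 0" "\<And>c. 0 \<le> c \<Longrightarrow> c < d \<Longrightarrow>
      (hA - cf) / 2 \<le> hA - cf * exp (2 * c) - onorm ((*v) A) * (exp (2 * c) - 1)"
    using small_noise_rate[OF assms(11)] by blast
  define \<kappa> where "\<kappa> = (hA - cf) / 2"
  have \<kappa>: "\<kappa> > 0" using assms(11) by (simp add: \<kappa>_def)
  \<comment> \<open>Below \<open>d\<close>, conjugation leaves the dissipation rate
    \<open>\<kappa>\<close>; the second bound gives \<open>c * \<mu> \<le> \<kappa> / 2\<close>,
    with \<open>\<mu> + 1\<close> to avoid a division by 0. The rate \<open>\<mu>\<close> was
    obtained from the noise alone, so \<open>\<epsilon>\<close> is fixed before
    \<open>C\<close>.\<close>
  define \<epsilon> where "\<epsilon> = min d (\<kappa> / (2 * (\<mu> + 1)))"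
  show ?thesis
  proof (intro exI[of _ \<epsilon>] conjI allI impI)
    show "\<epsilon> > 0" using d \<kappa> \<mu> by (simp add: \<epsilon>_def)
    fix C :: "real^'n^'n" and \<phi>
    assume C: "onorm ((*v) C) < \<epsilon>" and rds: "young_rds A f C ?M \<phi>"
    define c where "c = onorm ((*v) C)"
    have c: "0 \<le> c" "c < d" "c \<le> \<kappa> / (2 * (\<mu> + 1))"
      using C norm_ge_zero[of "endo_of_matrix C"] by (auto simp: c_def \<epsilon>_def norm_endo_of_matrix)
    have "c * \<mu> \<le> \<kappa> / 2"
    proof -
      have "c * (2 * (\<mu> + 1)) \<le> \<kappa>" using c(3) \<mu>(1) by (simp add: pos_le_divide_eq)
      then show ?thesis using c(1) by (simp add: algebra_simps)
    qed
    then interpret contracting_cocycle \<phi> \<Omega> c \<kappa> "exp c * norm (f 0) * sqrt (1 / (2 * \<kappa>))" \<mu>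
      unfolding c_def
      by (intro young_rds_contracting_cocycle[OF assms(5,6,3,9,10) _ rds _ \<kappa> \<mu>(1)])
        (use d(2)[OF c(1,2)] assms in \<open>auto simp: \<kappa>_def c_def\<close>)
    have "continuous_rds wiener_shift ?M \<phi>" using rds unfolding young_rds_def by blast
    note M = space rate wiener_shift_measurable[OF assms(5,6)] continuous_rds_measurable[OF this]
    show "\<exists>a. a \<in> borel_measurable ?M \<and> pullback_attractor wiener_shift ?M \<phi> (\<lambda>\<omega>. {a \<omega>}) \<and>
        (\<forall>D\<in>tempered_sets wiener_shift ?M. exponential_pullback_convergence wiener_shift ?M \<phi> D (\<lambda>\<omega>. {a \<omega>}))"
      using equilibrium_measurable[OF M] equilibrium_pullback_attractor[OF M]
        equilibrium_exponential_convergence[OF M] by (intro exI[of _ equilibrium]) blast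
  qed
qed

end
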